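(* Let $L>0$, $T>0$, and let $H:\mathbb R^d\to\mathbb R$ satisfy $H=H_1-H_2$ with $H_1,H_2:\mathbb R^d\to\mathbb R$ convex and nonnegative, and $\|DH\|_\infty<\infty$. Let $u_0:\mathbb R^d\to\mathbb R$ be bounded and Lipschitz with $\|Du_0\|_\infty\le L$. For $h>0$, $0\le s\le t\le T$, $\zeta\in C([0,T];\mathbb R)$ let $S_h(t,s;\zeta)$ be a scheme operator satisfying, for some $\lambda_0>0$: (1) $S_h(t,s;\zeta)(w+c)=S_h(t,s;\zeta)w+c$ for all $c\in\mathbb R$, and $S_h(t,s;\zeta)$ commutes with the translations $w\mapsto w(\cdot+v)$, $v\in\mathbb R^d$; (2) if $w_1\le w_2$ and $\mathrm{osc}(\zeta,s,t)\le\lambda_0h$, then $S_h(t,s;\zeta)w_1\le S_h(t,s;\zeta)w_2$; (3) there is a constant $C_0=C_0(L)>0$ such that, if $\zeta\in C([0,T];\mathbb R)$, $\Phi\in C(I,C^{1,1}(\mathbb R^d))$ is a solution of $d\Phi=H(D\Phi)\circ d\zeta$ in $\mathbb R^d\times I$, $s\le t$ in $I$, and $\mathrm{osc}(\zeta,s,t)\le\lambda_0h$, then $\|S_h(t,s;\zeta)\Phi(\cdot,s)-\Phi(\cdot,t)\|_\infty\le C_0\|D^2\Phi\|_\infty h^2$. Let $W$ be a standard one-dimensional Brownian motion on $(\Omega,\mathcal F,\mathbf P)$. For small $h>0$ set $\eta_h:=h^{1/3}|\log h|^{-2/3}$, $T_0:=0$, and, for $k\in\mathbb N_0$, $T_{k+1}:=\inf\{t>T_k:\mathrm{osc}(W,T_k,t)>\eta_h\}$,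 $\tau_{k+1}:=T_{k+1}-T_k$. Let $$W_h(t):=W(T_k)+\frac{W(T_{k+1})-W(T_k)}{\tau_{k+1}}(t-T_k)\quad\text{for }T_k\le t<T_{k+1},$$ $M_h:=\lceil\eta_h/(\lambda_0h)\rceil$, $t_n:=T_k+(n-kM_h)\frac{\tau_{k+1}}{M_h}$ whenever $kM_h\le n<(k+1)M_h$, and $\mathcal P_h:=\{t_n:t_n<T\}\cup\{T\}=\{0=s_0<s_1<\dots<s_{N}=T\}$. Let $u_h(\cdot,0):=u_0$, $u_h(\cdot,t):=S_h(t,s_n;W_h)u_h(\cdot,s_n)$ for $t\in(s_n,s_{n+1}]$, $n=0,\dots,N-1$, and let $u$ be the pathwise viscosity solution of $du=H(Du)\circ dW$ in $\mathbb R^d\times(0,T]$, $u(\cdot,0)=u_0$. Then there exists a deterministic constant $C=C_L>0$ such that $$\mathbf P\left(\limsup_{h\to0}\ \max_{(x,t)\in\mathbb R^d\times[0,T]}\frac{|u_h(x,t)-u(x,t)|}{h^{1/3}|\log h|^{1/3}}\le C(1+T)\right)=1 .$$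
   Context: $\mathrm{osc}(\zeta,s,t):=\max_{r_1,r_2\in[s,t]}|\zeta(r_1)-\zeta(r_2)|$. $W$ is defined on $[0,\infty)$, and the equation is solved for each continuous sample path. $C_L$ denotes a constant depending on $L$ and the fixed data $H,\lambda_0,C_0$, but not on $T$ or $u_0$. The "max" over $(x,t)$ is understood as a supremum. Domain of the scheme: $S_h(t,s;\zeta)$ maps $BUC(\mathbb R^d)$ (bounded uniformly continuous functions) into itself and is also defined on $C^{1,1}(\mathbb R^d)$, the $C^1$ functions (possibly unbounded) with globally Lipschitz gradient, with values in continuous functions; (1) and (2) are assumed for arguments in $BUC(\mathbb R^d)\cup C^{1,1}(\mathbb R^d)$. For a relatively open interval $I\subset[0,T]$, $C(I,C^{1,1}(\mathbb R^d))$ denotes functions $\Phi$ with $\Phi,D\Phi$ continuous on $\mathbb R^d\times I$ and $D\Phi(\cdot,t)$ Lipschitz, locally uniformly in $t$; $\|D^2\Phi\|_\infty$ is the supremum over $t\in I$ of the Lipschitz constants of $D\Phi(\cdot,t)$. For a continuous path $\zeta$, such $\Phi$ is a solution of $d\Phi=H(D\Phi)\circ d\zeta$ in $\mathbb R^d\times I$ if it is obtained by continuous extension from smooth paths: there are $C^1$ paths $\zeta_n\to\zeta$ uniformly on $I$ and $\Phi_n\in C(I,C^{1,1}(\mathbb R^d))$, with Lipschitz constants of $D\Phi_n(\cdot,t)$ bounded uniformly in $n$ locally uniformly in $t$, satisfying $\partial_t\Phi_n=H(D\Phi_n)\dot\zeta_n$ pointwise, with $\Phi_n\to\Phi$ and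 $D\Phi_n\to D\Phi$ locally uniformly. Pathwise viscosity solutions. An upper (resp. lower) semicontinuous $u$ on $\mathbb R^d\times[0,T]$ is a sub- (resp. super-) solution of $du=H(Du)\circ dW$, $u(\cdot,0)=u_0$, if $u(\cdot,0)\le u_0$ (resp. $\ge$) and, whenever $\psi\in C^1([0,T])$, $\Phi\in C(I,C^{1,1}(\mathbb R^d))$ is a solution of $d\Phi=H(D\Phi)\circ dW$ in $\mathbb R^d\times I$, and $u-\Phi-\psi$ attains a local maximum (resp. minimum) at $(x_0,t_0)\in\mathbb R^d\times I$ with $t_0>0$, then $\psi'(t_0)\le0$ (resp. $\ge0$). A solution is both. There is a unique bounded uniformly continuous solution. *)

theory Defs
  imports "HOL-Probability.Probability"
begin

section \<open>Function spaces\<close>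

definition BUC :: "('a::euclidean_space \<Rightarrow> real) set" where
  "BUC = {w. bounded (range w) \<and> uniformly_continuous_on UNIV w}"

definition grad :: "('a::euclidean_space \<Rightarrow> real) \<Rightarrow> 'a \<Rightarrow> 'a" where
  "grad f x = (THE D. GDERIV f x :> D)"

definition C11 :: "('a::euclidean_space \<Rightarrow> real) set" where
  "C11 = {w. (\<forall>x. w differentiable (at x)) \<and> (\<exists>K. K-lipschitz_on UNIV (grad w))}"

(* Paths in C([0,T]) are extensional functions, so that an operator acting on them
   can only use the values on [0,T]. *)
definition Cpaths :: "real \<Rightarrow> (real \<Rightarrow> real) set" where
  "Cpaths T = {\<zeta> \<in> extensional {0..T}. continuous_on {0..T} \<zeta>}"

definition osc :: "(real \<Rightarrow> real) \<Rightarrow> real \<Rightarrow> real \<Rightarrow> real" where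
  "osc \<zeta> s t = (SUP (r1, r2) \<in> {s..t} \<times> {s..t}. \<bar>\<zeta> r1 - \<zeta> r2\<bar>)"

definition rel_open_interval :: "real \<Rightarrow> real set \<Rightarrow> bool" where
  "rel_open_interval T I \<longleftrightarrow> is_interval I \<and> openin (top_of_set {0..T}) I"

(* "Locally uniformly" is rendered as "uniformly on compact subsets" throughout;
   the underlying sets are locally compact. *)
definition C_C11 :: "real set \<Rightarrow> ('a::euclidean_space \<Rightarrow> real \<Rightarrow> real) set" where
  "C_C11 I = {\<Phi>.
     continuous_on (UNIV \<times> I) (\<lambda>(x, t). \<Phi> x t) \<and>
     (\<forall>t\<in>I. \<forall>x. (\<lambda>y. \<Phi> y t) differentiable (at x)) \<and>
     continuous_on (UNIV \<times> I) (\<lambda>(x, t). grad (\<lambda>y. \<Phi> y t) x) \<and>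
     (\<forall>J. compact J \<and> J \<subseteq> I \<longrightarrow> (\<exists>K. \<forall>t\<in>J. K-lipschitz_on UNIV (grad (\<lambda>y. \<Phi> y t))))}"

(* The supremum over t in I of the best Lipschitz constant of the spatial gradient;
   the value is infinity if there is no finite bound. *)
definition D2_norm :: "real set \<Rightarrow> ('a::euclidean_space \<Rightarrow> real \<Rightarrow> real) \<Rightarrow> ereal" where
  "D2_norm I \<Phi> = (SUP t\<in>I. Inf {ereal K |K. K-lipschitz_on UNIV (grad (\<lambda>x. \<Phi> x t))})"


section \<open>Pathwise viscosity solutions\<close>

definition smooth_path_solution ::
  "('a::euclidean_space \<Rightarrow> real) \<Rightarrow> (real \<Rightarrow> real) \<Rightarrow> real set \<Rightarrow> ('a \<Rightarrow> real \<Rightarrow> real) \<Rightarrow> bool" where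
  "smooth_path_solution H \<zeta> I \<Phi> \<longleftrightarrow>
     \<Phi> \<in> C_C11 I \<and>
     (\<exists>\<zeta>'. continuous_on I \<zeta>' \<and>
       (\<forall>t\<in>I. (\<zeta> has_real_derivative \<zeta>' t) (at t within I)) \<and>
       (\<forall>t\<in>I. \<forall>x. ((\<lambda>r. \<Phi> x r) has_real_derivative
          H (grad (\<lambda>y. \<Phi> y t) x) * \<zeta>' t) (at t within I)))"

definition path_solution ::
  "('a::euclidean_space \<Rightarrow> real) \<Rightarrow> (real \<Rightarrow> real) \<Rightarrow> real set \<Rightarrow> ('a \<Rightarrow> real \<Rightarrow> real) \<Rightarrow> bool" where
  "path_solution H \<zeta> I \<Phi> \<longleftrightarrow>
     \<Phi> \<in> C_C11 I \<and>
     (\<exists>\<zeta>n \<Phi>n.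
        (\<forall>n. smooth_path_solution H (\<zeta>n n) I (\<Phi>n n)) \<and>
        uniform_limit I \<zeta>n \<zeta> sequentially \<and>
        (\<forall>J. compact J \<and> J \<subseteq> I \<longrightarrow>
           (\<exists>K. \<forall>n. \<forall>t\<in>J. K-lipschitz_on UNIV (grad (\<lambda>y. \<Phi>n n y t)))) \<and>
        (\<forall>Q. compact Q \<and> Q \<subseteq> UNIV \<times> I \<longrightarrow>
           uniform_limit Q (\<lambda>n (x, t). \<Phi>n n x t) (\<lambda>(x, t). \<Phi> x t) sequentially \<and>
           uniform_limit Q (\<lambda>n (x, t). grad (\<lambda>y. \<Phi>n n y t) x)
             (\<lambda>(x, t). grad (\<lambda>y. \<Phi> y t) x) sequentially))"

definition usc_on :: "'b::topological_space set \<Rightarrow> ('b \<Rightarrow> real) \<Rightarrow> bool" where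
  "usc_on X f \<longleftrightarrow> (\<forall>z\<in>X. \<forall>a > f z. \<forall>\<^sub>F y in at z within X. f y < a)"

definition lsc_on :: "'b::topological_space set \<Rightarrow> ('b \<Rightarrow> real) \<Rightarrow> bool" where
  "lsc_on X f \<longleftrightarrow> (\<forall>z\<in>X. \<forall>a < f z. \<forall>\<^sub>F y in at z within X. a < f y)"

definition C1_on :: "real \<Rightarrow> (real \<Rightarrow> real) \<Rightarrow> (real \<Rightarrow> real) \<Rightarrow> bool" where
  "C1_on T \<psi> \<psi>' \<longleftrightarrow> continuous_on {0..T} \<psi>' \<and>
     (\<forall>t\<in>{0..T}. (\<psi> has_real_derivative \<psi>' t) (at t within {0..T}))"

definition pathwise_subsolution ::
  "('a::euclidean_space \<Rightarrow> real) \<Rightarrow> real \<Rightarrow> (real \<Rightarrow> real) \<Rightarrow> ('a \<Rightarrow> real) \<Rightarrow>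
   ('a \<Rightarrow> real \<Rightarrow> real) \<Rightarrow> bool" where
  "pathwise_subsolution H T \<zeta> u0 u \<longleftrightarrow>
     usc_on (UNIV \<times> {0..T}) (\<lambda>(x, t). u x t) \<and>
     (\<forall>x. u x 0 \<le> u0 x) \<and>
     (\<forall>I \<Phi> \<psi> \<psi>' x0 t0.
        rel_open_interval T I \<and> path_solution H \<zeta> I \<Phi> \<and> C1_on T \<psi> \<psi>' \<and> t0 \<in> I \<and> 0 < t0 \<and>
        (\<forall>\<^sub>F (x, t) in at (x0, t0) within UNIV \<times> I.
           u x t - \<Phi> x t - \<psi> t \<le> u x0 t0 - \<Phi> x0 t0 - \<psi> t0)
        \<longrightarrow> \<psi>' t0 \<le> 0)"

definition pathwise_supersolution ::
  "('a::euclidean_space \<Rightarrow> real) \<Rightarrow> real \<Rightarrow> (real \<Rightarrow> real) \<Rightarrow> ('a \<Rightarrow> real) \<Rightarrow>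
   ('a \<Rightarrow> real \<Rightarrow> real) \<Rightarrow> bool" where
  "pathwise_supersolution H T \<zeta> u0 u \<longleftrightarrow>
     lsc_on (UNIV \<times> {0..T}) (\<lambda>(x, t). u x t) \<and>
     (\<forall>x. u x 0 \<ge> u0 x) \<and>
     (\<forall>I \<Phi> \<psi> \<psi>' x0 t0.
        rel_open_interval T I \<and> path_solution H \<zeta> I \<Phi> \<and> C1_on T \<psi> \<psi>' \<and> t0 \<in> I \<and> 0 < t0 \<and>
        (\<forall>\<^sub>F (x, t) in at (x0, t0) within UNIV \<times> I.
           u x t - \<Phi> x t - \<psi> t \<ge> u x0 t0 - \<Phi> x0 t0 - \<psi> t0)
        \<longrightarrow> \<psi>' t0 \<ge> 0)"

(* Boundedness and uniform continuity are part of the notion: the solution is unique in that class. *)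
definition pathwise_viscosity_solution ::
  "('a::euclidean_space \<Rightarrow> real) \<Rightarrow> real \<Rightarrow> (real \<Rightarrow> real) \<Rightarrow> ('a \<Rightarrow> real) \<Rightarrow>
   ('a \<Rightarrow> real \<Rightarrow> real) \<Rightarrow> bool" where
  "pathwise_viscosity_solution H T \<zeta> u0 u \<longleftrightarrow>
     bounded ((\<lambda>(x, t). u x t) ` (UNIV \<times> {0..T})) \<and>
     uniformly_continuous_on (UNIV \<times> {0..T}) (\<lambda>(x, t). u x t) \<and>
     pathwise_subsolution H T \<zeta> u0 u \<and> pathwise_supersolution H T \<zeta> u0 u"


section \<open>Scheme operators\<close>

(* The argument order S h t s \<zeta> corresponds to S_h(t,s;\<zeta>). *)
type_synonym 'a scheme = "real \<Rightarrow> real \<Rightarrow> real \<Rightarrow> (real \<Rightarrow> real) \<Rightarrow> ('a \<Rightarrow> real) \<Rightarrow> 'a \<Rightarrow> real"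

definition scheme_maps :: "real \<Rightarrow> 'a::euclidean_space scheme \<Rightarrow> bool" where
  "scheme_maps T S \<longleftrightarrow>
     (\<forall>h>0. \<forall>s t. \<forall>\<zeta>\<in>Cpaths T. 0 \<le> s \<and> s \<le> t \<and> t \<le> T \<longrightarrow>
        (\<forall>w\<in>BUC. S h t s \<zeta> w \<in> BUC) \<and> (\<forall>w\<in>C11. continuous_on UNIV (S h t s \<zeta> w)))"

definition scheme_invariant :: "real \<Rightarrow> 'a::euclidean_space scheme \<Rightarrow> bool" where
  "scheme_invariant T S \<longleftrightarrow>
     (\<forall>h>0. \<forall>s t. \<forall>\<zeta>\<in>Cpaths T. \<forall>w \<in> BUC \<union> C11. 0 \<le> s \<and> s \<le> t \<and> t \<le> T \<longrightarrow>
        (\<forall>c. S h t s \<zeta> (\<lambda>x. w x + c) = (\<lambda>x. S h t s \<zeta> w x + c)) \<and>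
        (\<forall>v. S h t s \<zeta> (\<lambda>x. w (x + v)) = (\<lambda>x. S h t s \<zeta> w (x + v))))"

definition scheme_monotone :: "real \<Rightarrow> real \<Rightarrow> 'a::euclidean_space scheme \<Rightarrow> bool" where
  "scheme_monotone T lam0 S \<longleftrightarrow>
     (\<forall>h>0. \<forall>s t. \<forall>\<zeta>\<in>Cpaths T. \<forall>w1 \<in> BUC \<union> C11. \<forall>w2 \<in> BUC \<union> C11.
        0 \<le> s \<and> s \<le> t \<and> t \<le> T \<and> osc \<zeta> s t \<le> lam0 * h \<and> (\<forall>x. w1 x \<le> w2 x) \<longrightarrow>
        (\<forall>x. S h t s \<zeta> w1 x \<le> S h t s \<zeta> w2 x))"

definition scheme_consistent ::
  "('a::euclidean_space \<Rightarrow> real) \<Rightarrow> real \<Rightarrow> real \<Rightarrow> real \<Rightarrow> 'a scheme \<Rightarrow> bool" where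
  "scheme_consistent H T lam0 C0 S \<longleftrightarrow>
     (\<forall>h>0. \<forall>s t I \<Phi>. \<forall>\<zeta>\<in>Cpaths T.
        rel_open_interval T I \<and> path_solution H \<zeta> I \<Phi> \<and> s \<in> I \<and> t \<in> I \<and> s \<le> t \<and>
        osc \<zeta> s t \<le> lam0 * h \<longrightarrow>
        (SUP x. ereal \<bar>S h t s \<zeta> (\<lambda>y. \<Phi> y s) x - \<Phi> x t\<bar>)
          \<le> ereal C0 * D2_norm I \<Phi> * ereal (h^2))"


section \<open>Brownian motion\<close>

definition brownian_motion :: "'w measure \<Rightarrow> (real \<Rightarrow> 'w \<Rightarrow> real) \<Rightarrow> bool" where
  "brownian_motion M W \<longleftrightarrow>
     prob_space M \<and>
     (\<forall>t\<ge>0. W t \<in> borel_measurable M) \<and>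
     (AE \<omega> in M. W 0 \<omega> = 0) \<and>
     (\<forall>(n::nat) (r::nat \<Rightarrow> real). 0 \<le> r 0 \<and> mono r \<longrightarrow>
        prob_space.indep_vars M (\<lambda>_. borel) (\<lambda>i \<omega>. W (r (Suc i)) \<omega> - W (r i) \<omega>) {..<n}) \<and>
     (\<forall>s t. 0 \<le> s \<and> s < t \<longrightarrow>
        distributed M lborel (\<lambda>\<omega>. W t \<omega> - W s \<omega>) (normal_density 0 (sqrt (t - s)))) \<and>
     (AE \<omega> in M. continuous_on {0..} (\<lambda>t. W t \<omega>))"


section \<open>The random partition and the approximation\<close>

text \<open>Here \<open>w\<close> is one sample path of \<open>W\<close> on \<open>[0, \<infinity>)\<close>.\<close>

definition eta :: "real \<Rightarrow> real" where
  "eta h = h powr (1/3) * \<bar>ln h\<bar> powr (-2/3)"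

(* Real-valued; for almost every Brownian path all these infima are over nonempty sets. *)
primrec stop_time :: "(real \<Rightarrow> real) \<Rightarrow> real \<Rightarrow> nat \<Rightarrow> real" where
  "stop_time w h 0 = 0"
| "stop_time w h (Suc k) = Inf {t. t > stop_time w h k \<and> osc w (stop_time w h k) t > eta h}"

definition tau :: "(real \<Rightarrow> real) \<Rightarrow> real \<Rightarrow> nat \<Rightarrow> real" where
  "tau w h k = stop_time w h k - stop_time w h (k - 1)"

definition interp_path :: "(real \<Rightarrow> real) \<Rightarrow> real \<Rightarrow> real \<Rightarrow> real" where
  "interp_path w h t =
     (let k = (THE k. stop_time w h k \<le> t \<and> t < stop_time w h (Suc k)) in
      w (stop_time w h k)
        + (w (stop_time w h (Suc k)) - w (stop_time w h k)) / tau w h (Suc k) * (t - stop_time w h k))"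

definition Mh :: "real \<Rightarrow> real \<Rightarrow> nat" where
  "Mh lam0 h = nat \<lceil>eta h / (lam0 * h)\<rceil>"

definition grid_time :: "(real \<Rightarrow> real) \<Rightarrow> real \<Rightarrow> real \<Rightarrow> nat \<Rightarrow> real" where
  "grid_time w lam0 h n =
     (let k = n div Mh lam0 h in
      stop_time w h k + real (n - k * Mh lam0 h) * (tau w h (Suc k) / real (Mh lam0 h)))"

definition time_partition :: "(real \<Rightarrow> real) \<Rightarrow> real \<Rightarrow> real \<Rightarrow> real \<Rightarrow> real set" where
  "time_partition w lam0 T h = {grid_time w lam0 h n |n. grid_time w lam0 h n < T} \<union> {T}"

(* s_0 < s_1 < ... < s_N = T; for almost every Brownian path the partition is finite. *)
definition partition_list :: "(real \<Rightarrow> real) \<Rightarrow> real \<Rightarrow> real \<Rightarrow> real \<Rightarrow> real list" where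
  "partition_list w lam0 T h = sorted_list_of_set (time_partition w lam0 T h)"

primrec scheme_at_grid ::
  "'a scheme \<Rightarrow> (real \<Rightarrow> real) \<Rightarrow> real list \<Rightarrow> ('a \<Rightarrow> real) \<Rightarrow> real \<Rightarrow> nat \<Rightarrow> 'a \<Rightarrow> real" where
  "scheme_at_grid S \<zeta> ss u0 h 0 = u0"
| "scheme_at_grid S \<zeta> ss u0 h (Suc n) =
     S h (ss ! Suc n) (ss ! n) \<zeta> (scheme_at_grid S \<zeta> ss u0 h n)"

definition scheme_solution ::
  "'a scheme \<Rightarrow> (real \<Rightarrow> real) \<Rightarrow> real \<Rightarrow> real \<Rightarrow> ('a \<Rightarrow> real) \<Rightarrow> real \<Rightarrow> 'a \<Rightarrow> real \<Rightarrow> real" where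
  "scheme_solution S w lam0 T u0 h x t =
     (let \<zeta> = restrict (interp_path w h) {0..T};
          ss = partition_list w lam0 T h in
      if t = 0 then u0 x
      else let n = (THE n. Suc n < length ss \<and> ss ! n < t \<and> t \<le> ss ! Suc n) in
        S h t (ss ! n) \<zeta> (scheme_at_grid S \<zeta> ss u0 h n) x)"

end

(* For |a| <= c let
     Phi(z,a) = sup_p (p.z - d/2 |p|^2 - (c - a) H1(p) - (c + a) H2(p)).
   The bracket is strongly concave in p, so Phi(.,a) is C^{1,1} with D^2 Phi = O(1/d), and by the
   envelope theorem its derivative in a is H1 - H2 at the maximizer p = D Phi. Hence
   Phi(x, xi(t)) solves d Phi = H(D Phi) o d xi for every path xi with values in [-c,c]: this is
   where H = H1 - H2 is used, and no smallness of c against d is needed. One doubles only the space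
   variable and shows that u_h(x,t) - u(y,t) <= m_n + Phi(x - y, W_h(t) - W(t)) on the n-th grid
   interval, where |W_h - W| <= eta_h =: c/5: the consistency of the scheme moves x along W_h at the
   cost O(h^2/d), and the definition of viscosity solution moves y along W at no cost. The reverse
   inequality is the same with (H2(-p), H1(-p)) in place of (H1, H2). With N grid points the error
   is O(d + eta_h + N h^2/d), and d = h^{1/3} |log h|^{1/3} gives the rate as soon as
   N = O((1 + T) / (eta_h h)), that is, as soon as there are O((1 + T) / eta_h^2) stopping times
   before T. A block between two of them that is shorter than eta_h^2 contains, by chaining, a dyadic
   interval of length 2^{-m} with an increment of order eta_h (9/10)^{m - m0}, 2^{-m0} ~ eta_h^2.
   The number of such intervals is controlled by the sums of the fourth powers of the dyadic
   increments, and these concentrate by Chebyshev and Borel-Cantelli; this is uniform in h, so that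
   neither the strong Markov property nor a discretization of h is needed. *)
theory Submission
  imports Defs "HOL-Real_Asymp.Real_Asymp"
begin

section \<open>Regularized conjugates\<close>

text \<open>The obstacle is that H is not smooth: its evolution along W_h - W may destroy the
  C^{1,1} regularity of the usual penalty |x - y|^2 / d at once (for H(p) = |p| a corner can
  appear). In the conjugate the path enters only through the weights c - a and c + a, which are
  nonnegative, so concavity in p is never lost.

  The radius is c = 5 eta_h: the gap W_h - W and one increment of each path make 3 eta_h; one eta_h
  pays for enlarging a closed time step to an open interval, and one keeps the smooth approximations
  of the path inside |a| < c.

  With N of order 1 / (eta_h h) the accumulated error N h^2 / d is h / (eta_h d), which equals d
  exactly when h = eta_h d^2.

  In the count, squares of increments would only bound the number of large increments of level m by
  a multiple of 1 / theta_m^2, which grows with m. Fourth powers gain 2^{-m}, and this beats the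
  loss (10/9)^{4m} in the thresholds. The level from which the sums are controlled is random, but it
  only affects how small h has to be; so the constant stays deterministic.\<close>

lemma grad_eq:
  assumes "GDERIV f x :> D" shows "grad f x = D"
  unfolding grad_def
proof (rule the_equality)
  fix D' assume "GDERIV f x :> D'"
  then have "(\<lambda>h. h \<bullet> D') = (\<lambda>h. h \<bullet> D)"
    using assms unfolding gderiv_def by (rule has_derivative_unique)
  from fun_cong[OF this, of "D' - D"] have "(D' - D) \<bullet> (D' - D) = 0"
    by (simp add: inner_diff_right)
  then show "D' = D" by simp
qed (fact assms)

locale conjugate =
  fixes A1 A2 :: "'a::euclidean_space \<Rightarrow> real" and d c K :: real
  assumes convex1: "convex_on UNIV A1" and convex2: "convex_on UNIV A2"
    and nonneg1: "\<And>p. 0 \<le> A1 p" and nonneg2: "\<And>p. 0 \<le> A2 p"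
    and d_pos: "0 < d" and lipschitz: "K-lipschitz_on UNIV (\<lambda>p. A1 p - A2 p)"
begin

definition cost :: "real \<Rightarrow> 'a \<Rightarrow> real" where
  "cost a p = d / 2 * (norm p)\<^sup>2 + (c - a) * A1 p + (c + a) * A2 p"

text \<open>Coercivity provides a maximizer for \<open>\<bar>a\<bar> \<le> c\<close> and strong
  concavity makes it unique; for other \<open>a\<close> the choice may be arbitrary.\<close>

definition argmax :: "real \<Rightarrow> 'a \<Rightarrow> 'a" where
  "argmax a x = (SOME p. \<forall>q. q \<bullet> x - cost a q \<le> p \<bullet> x - cost a p)"

definition Phi :: "real \<Rightarrow> 'a \<Rightarrow> real" where
  "Phi a x = argmax a x \<bullet> x - cost a (argmax a x)"

lemma cost_nonneg: "\<bar>a\<bar> \<le> c \<Longrightarrow> d / 2 * (norm p)\<^sup>2 \<le> cost a p"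
  unfolding cost_def using nonneg1[of p] nonneg2[of p] by simp

lemma continuous_A: "continuous_on UNIV A1" "continuous_on UNIV A2"
  using convex_on_continuous[OF open_UNIV] convex1 convex2 by auto

lemma continuous_on_cost: "continuous_on UNIV (cost a)"
  unfolding cost_def using continuous_A by (intro continuous_intros) auto

lemma ex_argmax:
  assumes "\<bar>a\<bar> \<le> c"
  shows "\<exists>p. \<forall>q. q \<bullet> x - cost a q \<le> p \<bullet> x - cost a p"
proof -
  \<comment> \<open>With this radius \<open>d / 2 * R\<close> exceeds
    \<open>norm x + 1 + cost a 0\<close>, so outside the ball the objective lies below
    \<open>- cost a 0\<close>, its value at 0.\<close>
  define R where "R = 2 * norm x / d + 2 * (1 + cost a 0) / d + 1"
  have c0: "0 \<le> cost a 0" using cost_nonneg[OF assms, of 0] by simp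
  have R: "R \<ge> 1" unfolding R_def using d_pos c0 by simp
  have "continuous_on (cball 0 R) (\<lambda>q. q \<bullet> x - cost a q)"
    by (intro continuous_intros continuous_on_subset[OF continuous_on_cost]) auto
  from continuous_attains_sup[OF compact_cball _ this]
  obtain p where p: "\<And>q. norm q \<le> R \<Longrightarrow> q \<bullet> x - cost a q \<le> p \<bullet> x - cost a p"
    using R by (auto simp: Ball_def)
  have "q \<bullet> x - cost a q \<le> p \<bullet> x - cost a p" for q
  proof (cases "norm q \<le> R")
    case False
    then have q: "norm q \<ge> R" by simp
    have "q \<bullet> x - cost a q \<le> norm q * norm x - d / 2 * (norm q)\<^sup>2"
      using cost_nonneg[OF assms, of q] norm_cauchy_schwarz[of q x] by linarith
    also have "\<dots> = - (norm q * (d / 2 * norm q - norm x))"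
      by (simp add: algebra_simps power2_eq_square)
    also have "\<dots> \<le> - (1 * (1 + cost a 0))"
    proof -
      have "d / 2 * R = norm x + (1 + cost a 0) + d / 2"
        unfolding R_def using d_pos by (simp add: field_simps)
      moreover have "d / 2 * R \<le> d / 2 * norm q" using q d_pos by simp
      ultimately have "1 + cost a 0 \<le> d / 2 * norm q - norm x" using d_pos by linarith
      then show ?thesis using q R c0 by (intro le_imp_neg_le mult_mono) auto
    qed
    also have "\<dots> \<le> 0 \<bullet> x - cost a 0" by simp
    also have "\<dots> \<le> p \<bullet> x - cost a p" using R by (intro p) auto
    finally show ?thesis .
  qed (rule p)
  then show ?thesis by blast
qed

lemma Phi_ge: "\<bar>a\<bar> \<le> c \<Longrightarrow> q \<bullet> x - cost a q \<le> Phi a x"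
  unfolding Phi_def argmax_def using someI_ex[OF ex_argmax, of a x] by blast

lemma Phi_zero_le: "\<bar>a\<bar> \<le> c \<Longrightarrow> Phi a 0 \<le> 0"
  unfolding Phi_def using cost_nonneg[of a "argmax a 0"] d_pos
  by (smt (verit) inner_zero_right zero_le_mult_iff zero_le_power2 divide_nonneg_nonneg)

text \<open>The competitor is \<open>l\<close> times the unit vector along \<open>x\<close>. With
  \<open>l = L\<close> the bound absorbs the initial data; with \<open>l = 1\<close> it is the
  coercivity that confines minimizers to a ball.\<close>

lemma Phi_ge_norm:
  assumes "\<bar>a\<bar> \<le> c" "0 \<le> l" "\<And>p. norm p \<le> l \<Longrightarrow> A1 p + A2 p \<le> B"
  shows "l * norm x - (d / 2 * l\<^sup>2 + 2 * c * B) \<le> Phi a x"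
proof -
  define p where "p = l *\<^sub>R sgn x"
  have n: "norm p \<le> l" unfolding p_def using assms(2) by (simp add: norm_sgn)
  have "cost a p \<le> d / 2 * l\<^sup>2 + 2 * c * (A1 p + A2 p)"
  proof -
    have "d / 2 * (norm p)\<^sup>2 \<le> d / 2 * l\<^sup>2" using n d_pos by (intro mult_left_mono power_mono) auto
    moreover have "(c - a) * A1 p \<le> 2 * c * A1 p" "(c + a) * A2 p \<le> 2 * c * A2 p"
      using assms(1) nonneg1[of p] nonneg2[of p] by (intro mult_right_mono; linarith)+
    ultimately show ?thesis unfolding cost_def by (simp add: algebra_simps)
  qed
  also have "\<dots> \<le> d / 2 * l\<^sup>2 + 2 * c * B"
    using assms(1) assms(3)[OF n] by (intro add_left_mono mult_left_mono; linarith)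
  finally have "cost a p \<le> d / 2 * l\<^sup>2 + 2 * c * B" .
  moreover have "p \<bullet> x = l * norm x"
    unfolding p_def sgn_div_norm
    by (cases "x = 0") (simp_all add: dot_square_norm power2_eq_square)
  ultimately show ?thesis using Phi_ge[OF assms(1), of p x] by linarith
qed

text \<open>Compare the maximum with the value at the midpoint of \<open>q\<close> and the
  maximizer: the parallelogram identity gains \<open>d / 8\<close> times the squared distance, and
  doubling the inequality turns this into \<open>d / 4\<close>.\<close>

lemma strong_argmax:
  assumes "\<bar>a\<bar> \<le> c"
  shows "q \<bullet> x - cost a q + d / 4 * (norm (q - argmax a x))\<^sup>2 \<le> Phi a x"
proof -
  define p where "p = argmax a x"
  define m where "m = (1/2) *\<^sub>R p + (1/2) *\<^sub>R q"
  have c1: "A1 m \<le> 1/2 * A1 p + 1/2 * A1 q" "A2 m \<le> 1/2 * A2 p + 1/2 * A2 q"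
    using convex_onD[OF convex1, of "1/2" p q] convex_onD[OF convex2, of "1/2" p q]
    unfolding m_def by simp_all
  have n: "(norm m)\<^sup>2 = (norm p)\<^sup>2 / 2 + (norm q)\<^sup>2 / 2 - (norm (q - p))\<^sup>2 / 4"
    unfolding m_def power2_norm_eq_inner using inner_commute[of p q]
    by (simp add: inner_add_left inner_add_right inner_diff_left inner_diff_right field_simps)
  have "cost a m \<le> cost a p / 2 + cost a q / 2 - d / 8 * (norm (q - p))\<^sup>2"
  proof -
    have "(c - a) * A1 m \<le> (c - a) * (1/2 * A1 p + 1/2 * A1 q)"
      "(c + a) * A2 m \<le> (c + a) * (1/2 * A2 p + 1/2 * A2 q)"
      using assms c1 by (intro mult_left_mono; linarith)+
    then show ?thesis unfolding cost_def n by (simp add: field_simps)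
  qed
  moreover have "m \<bullet> x - cost a m \<le> Phi a x" by (rule Phi_ge[OF assms])
  moreover have "m \<bullet> x = (p \<bullet> x) / 2 + (q \<bullet> x) / 2" unfolding m_def by (simp add: inner_simps)
  moreover have "Phi a x = p \<bullet> x - cost a p" unfolding Phi_def p_def ..
  ultimately show ?thesis unfolding p_def by linarith
qed

lemma cost_diff: "cost a p = cost b p - (a - b) * (A1 p - A2 p)"
  unfolding cost_def by (simp add: algebra_simps)

text \<open>Add the strong maximality inequalities at the two points. What survives is an inner
  product of differences and \<open>a - b\<close> times a difference of \<open>A1 - A2\<close>,
  where the Lipschitz bound enters. The factor \<open>2 / d\<close> becomes the bound on D^2
  Phi.\<close>

lemma argmax_lipschitz:
  assumes "\<bar>a\<bar> \<le> c" "\<bar>b\<bar> \<le> c"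
  shows "norm (argmax a x - argmax b y) \<le> 2 / d * (norm (x - y) + K * \<bar>a - b\<bar>)"
proof -
  define p where "p = argmax a x"
  define q where "q = argmax b y"
  have 1: "q \<bullet> x - cost a q + d / 4 * (norm (q - p))\<^sup>2 \<le> p \<bullet> x - cost a p"
    using strong_argmax[OF assms(1), of q x] unfolding Phi_def p_def .
  have 2: "p \<bullet> y - cost b p + d / 4 * (norm (q - p))\<^sup>2 \<le> q \<bullet> y - cost b q"
    using strong_argmax[OF assms(2), of p y] unfolding Phi_def q_def norm_minus_commute .
  have "d / 2 * (norm (q - p))\<^sup>2
      \<le> (p - q) \<bullet> (x - y) + (a - b) * ((A1 p - A2 p) - (A1 q - A2 q))"
    using 1 2 cost_diff[of a p b] cost_diff[of a q b]
    by (simp add: inner_simps algebra_simps)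
  also have "(p - q) \<bullet> (x - y) \<le> norm (q - p) * norm (x - y)"
    using norm_cauchy_schwarz[of "p - q" "x - y"] by (simp add: norm_minus_commute)
  also have "(a - b) * ((A1 p - A2 p) - (A1 q - A2 q)) \<le> \<bar>a - b\<bar> * (K * norm (q - p))"
  proof -
    have "(a - b) * ((A1 p - A2 p) - (A1 q - A2 q))
        \<le> \<bar>a - b\<bar> * \<bar>(A1 p - A2 p) - (A1 q - A2 q)\<bar>"
      by (metis abs_ge_self abs_mult)
    also have "\<dots> \<le> \<bar>a - b\<bar> * (K * norm (q - p))"
      using lipschitz_onD[OF lipschitz, of p q]
      by (intro mult_left_mono) (auto simp: dist_norm norm_minus_commute)
    finally show ?thesis .
  qed
  finally have "norm (q - p) * (d / 2 * norm (q - p))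
      \<le> norm (q - p) * (norm (x - y) + K * \<bar>a - b\<bar>)"
    by (simp add: algebra_simps power2_eq_square)
  moreover have "0 \<le> norm (x - y) + K * \<bar>a - b\<bar>"
    using lipschitz_on_nonneg[OF lipschitz] by auto
  ultimately have "d / 2 * norm (q - p) \<le> norm (x - y) + K * \<bar>a - b\<bar>"
    by (cases "norm (q - p) = 0") (auto simp: mult_le_cancel_left)
  then show ?thesis using d_pos unfolding p_def q_def
    by (simp add: field_simps norm_minus_commute)
qed

text \<open>The old maximizer is a competitor at the new point. Exchanging the two points bounds the
  difference from above, and both derivatives of \<open>Phi\<close> come from this sandwich.\<close>

lemma Phi_diff_ge:
  assumes "\<bar>a\<bar> \<le> c" "\<bar>b\<bar> \<le> c"
  shows "argmax a x \<bullet> (y - x) + (b - a) * (A1 (argmax a x) - A2 (argmax a x)) \<le> Phi b y - Phi a x"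
  using Phi_ge[OF assms(2), of "argmax a x" y] cost_diff[of b "argmax a x" a] unfolding Phi_def[of a x]
  by (simp add: inner_simps algebra_simps)

lemma continuous_on_argmax: "continuous_on ({-c..c} \<times> UNIV) (\<lambda>(a, x). argmax a x)"
proof -
  have "(2 / d * (1 + K))-lipschitz_on ({-c..c} \<times> UNIV) (\<lambda>(a, x). argmax a x)"
  proof (intro lipschitz_onI)
    fix z w :: "real \<times> 'a" assume "z \<in> {-c..c} \<times> UNIV" "w \<in> {-c..c} \<times> UNIV"
    then have "norm (argmax (fst z) (snd z) - argmax (fst w) (snd w))
        \<le> 2 / d * (dist (snd z) (snd w) + K * dist (fst z) (fst w))"
      using argmax_lipschitz[of "fst z" "fst w" "snd z" "snd w"] by (auto simp: dist_norm)
    also have "\<dots> \<le> 2 / d * (dist z w + K * dist z w)"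
      using lipschitz_on_nonneg[OF lipschitz] d_pos
      by (intro mult_left_mono add_mono dist_fst_le dist_snd_le) auto
    finally show "dist (case z of (a, x) \<Rightarrow> argmax a x) (case w of (a, x) \<Rightarrow> argmax a x)
        \<le> 2 / d * (1 + K) * dist z w"
      by (simp add: add_divide_distrib distrib_left distrib_right dist_norm case_prod_unfold mult_ac)
  qed (use d_pos lipschitz_on_nonneg[OF lipschitz] in auto)
  then show ?thesis by (rule lipschitz_on_continuous_on)
qed

lemma continuous_on_Phi: "continuous_on ({-c..c} \<times> UNIV) (\<lambda>(a, x). Phi a x)"
proof -
  have "continuous_on ({-c..c} \<times> UNIV) (\<lambda>z. A1 (argmax (fst z) (snd z)))"
    "continuous_on ({-c..c} \<times> UNIV) (\<lambda>z. A2 (argmax (fst z) (snd z)))"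
    using continuous_on_compose2[OF continuous_A(1) continuous_on_argmax]
      continuous_on_compose2[OF continuous_A(2) continuous_on_argmax]
    by (auto simp: case_prod_unfold)
  then show ?thesis using continuous_on_argmax
    unfolding Phi_def cost_def case_prod_unfold by (intro continuous_intros)
qed

lemma GDERIV_Phi:
  assumes "\<bar>a\<bar> \<le> c"
  shows "GDERIV (Phi a) x :> argmax a x"
  unfolding gderiv_def
proof (rule has_derivativeI_sandwich[of 1])
  show "bounded_linear (\<lambda>h. h \<bullet> argmax a x)" by (rule bounded_linear_inner_left)
  fix y assume "y \<noteq> x"
  have 1: "(y - x) \<bullet> argmax a x \<le> Phi a y - Phi a x"
    using Phi_diff_ge[OF assms assms, of x y] by (simp add: inner_commute)
  have "Phi a y - Phi a x \<le> (y - x) \<bullet> argmax a y"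
    using Phi_diff_ge[OF assms assms, of y x] by (simp add: inner_commute inner_simps)
  then have "\<bar>Phi a y - Phi a x - (y - x) \<bullet> argmax a x\<bar> \<le> (y - x) \<bullet> (argmax a y - argmax a x)"
    using 1 by (simp add: inner_simps)
  also have "\<dots> \<le> norm (y - x) * (2 / d * norm (y - x))"
    using argmax_lipschitz[OF assms assms, of y x]
    by (intro order_trans[OF norm_cauchy_schwarz] mult_left_mono) auto
  finally show "norm (Phi a y - Phi a x - (y - x) \<bullet> argmax a x) / norm (y - x) \<le> 2 / d * norm (y - x)"
    using \<open>y \<noteq> x\<close> by (simp add: pos_divide_le_eq mult_ac)
next
  show "((\<lambda>y. 2 / d * norm (y - x)) \<longlongrightarrow> 0) (at x)"
    by (rule tendsto_eq_intros refl | simp)+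
qed simp

lemma continuous_on_argmax_left: "continuous_on {-c..c} (\<lambda>a. argmax a x)"
proof -
  have "continuous_on {-c..c} (\<lambda>a. (a, x))" by (intro continuous_intros)
  from continuous_on_compose2[OF continuous_on_argmax this] show ?thesis by auto
qed

text \<open>The remainder is controlled by the continuity of \<open>A1 - A2\<close> along the
  maximizers. Strictness of \<open>\<bar>a\<bar> < c\<close> leaves admissible parameters on both
  sides of \<open>a\<close>.\<close>

lemma DERIV_Phi:
  assumes "\<bar>a\<bar> < c"
  shows "((\<lambda>a. Phi a x) has_real_derivative A1 (argmax a x) - A2 (argmax a x)) (at a)"
proof -
  let ?H = "\<lambda>b. A1 (argmax b x) - A2 (argmax b x)"
  have "((\<lambda>a. Phi a x) has_derivative (\<lambda>h. h * ?H a)) (at a)"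
  proof (rule has_derivativeI_sandwich[of "c - \<bar>a\<bar>"])
    show "bounded_linear (\<lambda>h. h * ?H a)" by (rule bounded_linear_mult_left)
    fix b assume b: "b \<noteq> a" "dist b a < c - \<bar>a\<bar>"
    then have bc: "\<bar>b\<bar> \<le> c" by (auto simp: dist_real_def)
    have 1: "(b - a) * ?H a \<le> Phi b x - Phi a x"
      using Phi_diff_ge[of a b x x] bc assms by simp
    have 2: "Phi b x - Phi a x \<le> (b - a) * ?H b"
      using Phi_diff_ge[of b a x x] bc assms by (simp add: algebra_simps)
    have "\<bar>Phi b x - Phi a x - (b - a) * ?H a\<bar> \<le> (b - a) * (?H b - ?H a)"
      using 1 2 by (simp add: algebra_simps)
    also have "\<dots> \<le> \<bar>b - a\<bar> * \<bar>?H b - ?H a\<bar>" by (metis abs_ge_self abs_mult)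
    finally show "norm (Phi b x - Phi a x - (b - a) * ?H a) / norm (b - a) \<le> \<bar>?H b - ?H a\<bar>"
      using b by (simp add: divide_simps mult.commute)
  next
    have "continuous_on {-c..c} ?H"
      using continuous_on_compose2[OF continuous_A(1) continuous_on_argmax_left, of x]
        continuous_on_compose2[OF continuous_A(2) continuous_on_argmax_left, of x]
      by (auto intro!: continuous_intros)
    then have "isCont ?H a"
      using assms by (intro continuous_on_interior) auto
    then show "((\<lambda>b. \<bar>?H b - ?H a\<bar>) \<longlongrightarrow> 0) (at a)"
      unfolding isCont_def by (intro tendsto_rabs_zero LIM_zero)
  qed (use assms in auto)
  then show ?thesis by (rule has_derivative_imp_has_field_derivative) simp
qed

end


section \<open>Conjugates as solutions along a path\<close>

lemma uniform_limit_realI: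
  fixes f :: "nat \<Rightarrow> 'b \<Rightarrow> real"
  assumes "\<And>n x. x \<in> X \<Longrightarrow> \<bar>f n x - g x\<bar> \<le> e n" "e \<longlonglongrightarrow> 0"
  shows "uniform_limit X f g sequentially"
proof (rule uniform_limitI)
  fix r :: real assume "0 < r"
  then have "\<forall>\<^sub>F n in sequentially. e n < r" using assms(2) by (simp add: order_tendsto_iff)
  then show "\<forall>\<^sub>F n in sequentially. \<forall>x\<in>X. dist (f n x) (g x) < r"
  proof eventually_elim
    case (elim n)
    then show ?case using assms(1)[of _ n] by (fastforce simp: dist_real_def)
  qed
qed

text \<open>Polynomials serve as the C^1 paths required by \<open>path_solution\<close>. The error
  is below \<open>e\<close> already for n = 0, so every member of the sequence is admissible, not
  only late ones.\<close>

lemma ex_polynomial_sequence: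
  fixes \<zeta> :: "real \<Rightarrow> real"
  assumes "compact X" "continuous_on X \<zeta>" "0 < e"
  obtains p p' where "\<And>n r. r \<in> X \<Longrightarrow> \<bar>\<zeta> r - p n r\<bar> < e / real (Suc n)"
    "\<And>n r. (p n has_real_derivative p' n r) (at r)" "\<And>n. continuous_on UNIV (p' n)"
proof -
  have "\<exists>q q'. (\<forall>r\<in>X. \<bar>\<zeta> r - q r\<bar> < e / real (Suc n)) \<and>
      (\<forall>r. (q has_real_derivative q' r) (at r)) \<and> continuous_on UNIV q'" for n
  proof -
    have "0 < e / real (Suc n)" using assms(3) by simp
    then obtain q where q: "real_polynomial_function q" "\<forall>r\<in>X. \<bar>\<zeta> r - q r\<bar> < e / real (Suc n)"
      using Stone_Weierstrass_real_polynomial_function[OF assms(1,2)] by metis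
    obtain q' where q': "real_polynomial_function q'" "\<forall>r. (q has_real_derivative q' r) (at r)"
      using has_real_derivative_polynomial_function[OF q(1)] by blast
    have "continuous_on UNIV q'"
      using q'(1) continuous_on_polymonial_function real_polynomial_function_eq by blast
    then show ?thesis using q q' by blast
  qed
  then obtain p p' where "\<forall>n. (\<forall>r\<in>X. \<bar>\<zeta> r - p n r\<bar> < e / real (Suc n)) \<and>
      (\<forall>r. (p n has_real_derivative p' n r) (at r)) \<and> continuous_on UNIV (p' n)"
    by metis
  then show ?thesis by (intro that[of p p']) auto
qed

context conjugate
begin

text \<open>The signs let one function serve in both variables and for both inequalities: the scheme
  step uses (\<open>\<epsilon>\<close>, 1) for (\<open>\<sigma>\<close>, \<open>\<theta>\<close>)
  and the viscosity step (-\<open>\<epsilon>\<close>, -1). In both cases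
  \<open>\<sigma> * \<theta>\<close> is \<open>\<epsilon>\<close>, the sign in front of the
  gradient.\<close>

definition test_fun :: "real \<Rightarrow> real \<Rightarrow> 'a \<Rightarrow> (real \<Rightarrow> real) \<Rightarrow> 'a \<Rightarrow> real \<Rightarrow> real" where
  "test_fun \<sigma> \<theta> y b x r = \<sigma> * Phi (b r) (\<theta> *\<^sub>R (x - y))"

lemma GDERIV_test:
  assumes "\<bar>b r\<bar> \<le> c"
  shows "GDERIV (\<lambda>x. test_fun \<sigma> \<theta> y b x r) x :> (\<sigma> * \<theta>) *\<^sub>R argmax (b r) (\<theta> *\<^sub>R (x - y))"
proof -
  let ?z = "\<lambda>x. \<theta> *\<^sub>R (x - y)"
  have 1: "(?z has_derivative (\<lambda>h. \<theta> *\<^sub>R h)) (at x)"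
    by (auto intro!: derivative_eq_intros)
  have 2: "(Phi (b r) has_derivative (\<lambda>h. h \<bullet> argmax (b r) (?z x))) (at (?z x))"
    using GDERIV_Phi[OF assms] unfolding gderiv_def .
  have 3: "((\<lambda>x. Phi (b r) (?z x)) has_derivative (\<lambda>h. (\<theta> *\<^sub>R h) \<bullet> argmax (b r) (?z x))) (at x)"
    using has_derivative_compose[OF 1 2] .
  show ?thesis
    unfolding test_fun_def gderiv_def
    by (rule has_derivative_eq_rhs[OF has_derivative_mult_right[OF 3, of \<sigma>]])
       (simp add: fun_eq_iff)
qed

lemma grad_test:
  "\<bar>b r\<bar> \<le> c \<Longrightarrow>
    grad (\<lambda>x. test_fun \<sigma> \<theta> y b x r) x = (\<sigma> * \<theta>) *\<^sub>R argmax (b r) (\<theta> *\<^sub>R (x - y))"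
  by (rule grad_eq[OF GDERIV_test])

lemma differentiable_test:
  "\<bar>b r\<bar> \<le> c \<Longrightarrow> (\<lambda>x. test_fun \<sigma> \<theta> y b x r) differentiable (at x)"
  using GDERIV_test unfolding gderiv_def differentiable_def by blast

lemma lipschitz_grad_test:
  assumes "\<bar>b r\<bar> \<le> c" "\<bar>\<sigma>\<bar> = 1" "\<bar>\<theta>\<bar> = 1"
  shows "(2 / d)-lipschitz_on UNIV (grad (\<lambda>x. test_fun \<sigma> \<theta> y b x r))"
proof (rule lipschitz_onI)
  fix x z :: 'a
  let ?P = "\<lambda>x. argmax (b r) (\<theta> *\<^sub>R (x - y))"
  have "dist (grad (\<lambda>x. test_fun \<sigma> \<theta> y b x r) x) (grad (\<lambda>x. test_fun \<sigma> \<theta> y b x r) z)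
      = \<bar>\<sigma> * \<theta>\<bar> * norm (?P x - ?P z)"
    unfolding grad_test[of b, OF assms(1)] dist_norm scaleR_diff_right[symmetric] norm_scaleR ..
  also have "\<dots> = norm (?P x - ?P z)" using assms by (simp add: abs_mult)
  also have "\<dots> \<le> 2 / d * norm (\<theta> *\<^sub>R (x - y) - \<theta> *\<^sub>R (z - y))"
    using argmax_lipschitz[OF assms(1,1), of "\<theta> *\<^sub>R (x - y)" "\<theta> *\<^sub>R (z - y)"] by simp
  also have "\<theta> *\<^sub>R (x - y) - \<theta> *\<^sub>R (z - y) = \<theta> *\<^sub>R (x - z)"
    unfolding scaleR_diff_right[symmetric] by simp
  finally show "dist (grad (\<lambda>x. test_fun \<sigma> \<theta> y b x r) x) (grad (\<lambda>x. test_fun \<sigma> \<theta> y b x r) z)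
      \<le> 2 / d * dist x z"
    using assms(3) by (simp add: dist_norm)
qed (use d_pos in auto)

lemma continuous_on_test_arg:
  fixes y :: 'a
  assumes "continuous_on I b"
  shows "continuous_on (UNIV \<times> I) (\<lambda>z. (b (snd z), \<theta> *\<^sub>R (fst z - y)))"
  using continuous_on_compose2[OF assms continuous_on_snd[OF continuous_on_id], of "UNIV \<times> I"]
  by (intro continuous_intros) auto

lemma test_in_C_C11:
  assumes "continuous_on I b" "\<And>r. r \<in> I \<Longrightarrow> \<bar>b r\<bar> \<le> c" "\<bar>\<sigma>\<bar> = 1" "\<bar>\<theta>\<bar> = 1"
  shows "test_fun \<sigma> \<theta> y b \<in> C_C11 I"
proof -
  have img: "(\<lambda>z. (b (snd z), \<theta> *\<^sub>R (fst z - y))) ` (UNIV \<times> I) \<subseteq> {-c..c} \<times> UNIV"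
    using assms(2) by (force simp: abs_le_iff)
  have "continuous_on (UNIV \<times> I) (\<lambda>(x, t). test_fun \<sigma> \<theta> y b x t)"
    using continuous_on_compose2[OF continuous_on_Phi continuous_on_test_arg[OF assms(1)] img]
    unfolding test_fun_def case_prod_unfold by (intro continuous_intros) auto
  moreover have "continuous_on (UNIV \<times> I) (\<lambda>(x, t). grad (\<lambda>y'. test_fun \<sigma> \<theta> y b y' t) x)"
  proof -
    have "continuous_on (UNIV \<times> I) (\<lambda>z. (\<sigma> * \<theta>) *\<^sub>R argmax (b (snd z)) (\<theta> *\<^sub>R (fst z - y)))"
      using continuous_on_compose2[OF continuous_on_argmax continuous_on_test_arg[OF assms(1)] img]
      unfolding case_prod_unfold by (intro continuous_intros) auto
    then show ?thesis
      by (rule continuous_on_eq) (use assms(2) grad_test in auto)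
  qed
  moreover have "\<exists>K. \<forall>t\<in>J. K-lipschitz_on UNIV (grad (\<lambda>x. test_fun \<sigma> \<theta> y b x t))"
    if "compact J \<and> J \<subseteq> I" for J
    using that lipschitz_grad_test assms(2-4) by blast
  ultimately show ?thesis
    unfolding C_C11_def using differentiable_test assms(2) by auto
qed

lemma D2_norm_test:
  assumes "\<And>r. r \<in> I \<Longrightarrow> \<bar>b r\<bar> \<le> c" "\<bar>\<sigma>\<bar> = 1" "\<bar>\<theta>\<bar> = 1"
  shows "D2_norm I (test_fun \<sigma> \<theta> y b) \<le> ereal (2 / d)"
  unfolding D2_norm_def
  using lipschitz_grad_test[of b, OF assms(1) assms(2,3)] by (intro SUP_least Inf_lower) auto

lemma smooth_path_solution_test:
  assumes \<zeta>: "\<And>r. (\<zeta> has_real_derivative \<zeta>' r) (at r)" "continuous_on UNIV \<zeta>'"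
    and b: "\<And>r. b r = a + \<kappa> * (\<zeta> r - z)" "\<And>r. r \<in> I \<Longrightarrow> \<bar>b r\<bar> < c"
    and signs: "\<bar>\<sigma>\<bar> = 1" "\<bar>\<theta>\<bar> = 1"
    and H: "\<And>p. H ((\<sigma> * \<theta>) *\<^sub>R p) = \<sigma> * \<kappa> * (A1 p - A2 p)"
  shows "smooth_path_solution H \<zeta> I (test_fun \<sigma> \<theta> y b)"
proof -
  have b': "(b has_real_derivative \<kappa> * \<zeta>' r) (at r)" for r
    unfolding b(1)[abs_def] by (rule derivative_eq_intros \<zeta>(1) refl | simp)+
  have "continuous_on UNIV b"
    using b' by (meson DERIV_isCont continuous_at_imp_continuous_on)
  then have "test_fun \<sigma> \<theta> y b \<in> C_C11 I"
    using b(2) signs by (intro test_in_C_C11) (auto intro: continuous_on_subset less_imp_le)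
  moreover have "((\<lambda>r. test_fun \<sigma> \<theta> y b x r) has_real_derivative
      H (grad (\<lambda>x. test_fun \<sigma> \<theta> y b x t) x) * \<zeta>' t) (at t within I)" if "t \<in> I" for t x
  proof -
    let ?p = "argmax (b t) (\<theta> *\<^sub>R (x - y))"
    have "((\<lambda>r. Phi (b r) (\<theta> *\<^sub>R (x - y))) has_real_derivative (A1 ?p - A2 ?p) * (\<kappa> * \<zeta>' t)) (at t)"
      by (rule DERIV_chain2[OF DERIV_Phi[OF b(2)[OF that]] b'])
    then have "((\<lambda>r. test_fun \<sigma> \<theta> y b x r) has_real_derivative \<sigma> * ((A1 ?p - A2 ?p) * (\<kappa> * \<zeta>' t))) (at t)"
      unfolding test_fun_def by (rule DERIV_cmult)
    moreover have "H (grad (\<lambda>x. test_fun \<sigma> \<theta> y b x t) x) = \<sigma> * \<kappa> * (A1 ?p - A2 ?p)"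
      using grad_test[of b t] b(2)[OF that] H by simp
    ultimately show ?thesis by (auto simp: mult_ac intro: has_field_derivative_at_within)
  qed
  ultimately show ?thesis
    unfolding smooth_path_solution_def using \<zeta>
    by (intro conjI exI[of _ \<zeta>'])
      (auto intro: continuous_on_subset has_field_derivative_at_within)
qed

text \<open>The margin \<open>e\<close> keeps the parameters of all approximating paths in the open
  range where \<open>DERIV_Phi\<close> applies. Convergence then follows from uniform continuity of
  \<open>Phi\<close> and \<open>argmax\<close> on a compact set.\<close>

lemma path_solution_test:
  assumes X: "compact X" "continuous_on X \<zeta>" "I \<subseteq> X" "s \<in> X" and "0 < e"
    and b: "\<And>r. r \<in> I \<Longrightarrow> \<bar>a + \<kappa> * (\<zeta> r - \<zeta> s)\<bar> \<le> c - e"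
    and signs: "\<bar>\<sigma>\<bar> = 1" "\<bar>\<theta>\<bar> = 1" "\<bar>\<kappa>\<bar> = 1"
    and H: "\<And>p. H ((\<sigma> * \<theta>) *\<^sub>R p) = \<sigma> * \<kappa> * (A1 p - A2 p)"
  shows "path_solution H \<zeta> I (test_fun \<sigma> \<theta> y (\<lambda>r. a + \<kappa> * (\<zeta> r - \<zeta> s)))"
proof -
  define bb where "bb r = a + \<kappa> * (\<zeta> r - \<zeta> s)" for r
  \<comment> \<open>The error of \<open>p n\<close> enters the parameter twice, at \<open>r\<close>
    and at \<open>s\<close>; with \<open>e/3\<close> the total stays below the margin
    \<open>e\<close>.\<close>
  obtain p p' where p: "\<And>n r. r \<in> X \<Longrightarrow> \<bar>\<zeta> r - p n r\<bar> < (e/3) / real (Suc n)"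
    "\<And>n r. (p n has_real_derivative p' n r) (at r)" "\<And>n. continuous_on UNIV (p' n)"
    using ex_polynomial_sequence[OF X(1,2), of "e/3"] \<open>0 < e\<close> by auto
  define b where "b n r = a + \<kappa> * (p n r - p n s)" for n r
  have bc: "\<bar>bb r\<bar> < c" if "r \<in> I" for r
    using b[OF that] \<open>0 < e\<close> unfolding bb_def by linarith
  have close: "\<bar>b n r - bb r\<bar> \<le> (e * (2/3)) / real (Suc n)" if "r \<in> I" for n r
  proof -
    have "b n r - bb r = \<kappa> * ((p n r - \<zeta> r) - (p n s - \<zeta> s))"
      unfolding b_def bb_def by (simp add: algebra_simps)
    then have "\<bar>b n r - bb r\<bar> = \<bar>(p n r - \<zeta> r) - (p n s - \<zeta> s)\<bar>"
      using signs(3) by (simp add: abs_mult)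
    also have "\<dots> \<le> (e/3) / real (Suc n) + (e/3) / real (Suc n)"
      using p(1)[of r n] p(1)[of s n] X that by (smt (verit) subsetD)
    finally show ?thesis unfolding add_divide_distrib[symmetric] by (simp add: mult.commute)
  qed
  have bnc: "\<bar>b n r\<bar> < c" if "r \<in> I" for n r
  proof -
    have "(e * (2/3)) / real (Suc n) \<le> (e * (2/3)) / 1"
      using \<open>0 < e\<close> by (intro divide_left_mono) auto
    then show ?thesis using close[OF that, of n] b[OF that] \<open>0 < e\<close> unfolding bb_def by simp
  qed
  have lim0: "(\<lambda>n. w / real (Suc n)) \<longlonglongrightarrow> 0" for w
    by (rule LIMSEQ_Suc[OF lim_const_over_n])
  have sol: "smooth_path_solution H (p n) I (test_fun \<sigma> \<theta> y (b n))" for n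
    by (rule smooth_path_solution_test[OF p(2,3) b_def _ signs(1,2) H]) (use bnc in auto)
  have "continuous_on I bb"
    unfolding bb_def using X by (intro continuous_intros continuous_on_subset[OF X(2)])
  then have 1: "test_fun \<sigma> \<theta> y bb \<in> C_C11 I"
    using bc by (intro test_in_C_C11 signs) (auto intro: less_imp_le)
  have 2: "uniform_limit I p \<zeta> sequentially"
    by (rule uniform_limit_realI[OF _ lim0[of "e/3"]])
       (use p(1) X(3) in \<open>force simp: abs_minus_commute intro: less_imp_le\<close>)
  have 3: "uniform_limit Q (\<lambda>n (x, t). test_fun \<sigma> \<theta> y (b n) x t) (\<lambda>(x, t). test_fun \<sigma> \<theta> y bb x t) sequentially
    \<and> uniform_limit Q (\<lambda>n (x, t). grad (\<lambda>z. test_fun \<sigma> \<theta> y (b n) z t) x)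
             (\<lambda>(x, t). grad (\<lambda>z. test_fun \<sigma> \<theta> y bb z t) x) sequentially"
    if Q: "compact Q" "Q \<subseteq> UNIV \<times> I" for Q
  proof -
    let ?g = "\<lambda>n z. (b n (snd z), \<theta> *\<^sub>R (fst z - y))"
    let ?g' = "\<lambda>z. (bb (snd z), \<theta> *\<^sub>R (fst z - y))"
    define Y where "Y = {-c..c} \<times> (\<lambda>z. \<theta> *\<^sub>R (fst z - y)) ` Q"
    have Y: "compact Y" unfolding Y_def
      using Q(1) by (intro compact_Times compact_continuous_image continuous_intros) auto
    have gl: "uniform_limit Q ?g ?g' sequentially"
    proof (intro uniform_limitI)
      fix r :: real assume "0 < r"
      then have "\<forall>\<^sub>F n in sequentially. (e * (2/3)) / real (Suc n) < r"
        using order_tendstoD(2)[OF lim0] by blast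
      then show "\<forall>\<^sub>F n in sequentially. \<forall>z\<in>Q. dist (?g n z) (?g' z) < r"
      proof eventually_elim
        case (elim n)
        show ?case
        proof
          fix z assume "z \<in> Q"
          then have "snd z \<in> I" using Q(2) by auto
          from close[OF this, of n] elim show "dist (?g n z) (?g' z) < r"
            by (simp add: dist_Pair_Pair dist_real_def)
        qed
      qed
    qed
    have inY: "\<forall>\<^sub>F n in sequentially. \<forall>z\<in>Q. ?g n z \<in> Y"
    proof (intro always_eventually allI ballI)
      fix n z assume "z \<in> Q"
      moreover then have "snd z \<in> I" using Q(2) by auto
      ultimately show "?g n z \<in> Y" using bnc[of "snd z" n] unfolding Y_def by auto
    qed
    have Ys: "Y \<subseteq> {-c..c} \<times> UNIV" unfolding Y_def by auto
    have "continuous_on Y (\<lambda>(a, x). \<sigma> * Phi a x)"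
      using continuous_on_subset[OF continuous_on_Phi Ys] unfolding case_prod_unfold
      by (intro continuous_intros) auto
    from uniform_limit_compose_uniformly_continuous_on[OF gl
        compact_uniformly_continuous[OF this Y] inY compact_imp_closed[OF Y]]
    have a: "uniform_limit Q (\<lambda>n (x, t). test_fun \<sigma> \<theta> y (b n) x t) (\<lambda>(x, t). test_fun \<sigma> \<theta> y bb x t) sequentially"
      by (simp add: test_fun_def case_prod_unfold)
    have "continuous_on Y (\<lambda>(a, x). (\<sigma> * \<theta>) *\<^sub>R argmax a x)"
      using continuous_on_subset[OF continuous_on_argmax Ys] unfolding case_prod_unfold
      by (intro continuous_intros) auto
    from uniform_limit_compose_uniformly_continuous_on[OF gl
        compact_uniformly_continuous[OF this Y] inY compact_imp_closed[OF Y]]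
    have "uniform_limit Q (\<lambda>n z. (\<sigma> * \<theta>) *\<^sub>R argmax (b n (snd z)) (\<theta> *\<^sub>R (fst z - y)))
        (\<lambda>z. (\<sigma> * \<theta>) *\<^sub>R argmax (bb (snd z)) (\<theta> *\<^sub>R (fst z - y))) sequentially"
      by simp
    moreover have "grad (\<lambda>x. test_fun \<sigma> \<theta> y (b n) x (snd z)) (fst z)
          = (\<sigma> * \<theta>) *\<^sub>R argmax (b n (snd z)) (\<theta> *\<^sub>R (fst z - y))"
        "grad (\<lambda>x. test_fun \<sigma> \<theta> y bb x (snd z)) (fst z)
          = (\<sigma> * \<theta>) *\<^sub>R argmax (bb (snd z)) (\<theta> *\<^sub>R (fst z - y))" if "z \<in> Q" for n z
    proof -
      have "snd z \<in> I" using that Q(2) by auto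
      then show "grad (\<lambda>x. test_fun \<sigma> \<theta> y (b n) x (snd z)) (fst z)
          = (\<sigma> * \<theta>) *\<^sub>R argmax (b n (snd z)) (\<theta> *\<^sub>R (fst z - y))"
        "grad (\<lambda>x. test_fun \<sigma> \<theta> y bb x (snd z)) (fst z)
          = (\<sigma> * \<theta>) *\<^sub>R argmax (bb (snd z)) (\<theta> *\<^sub>R (fst z - y))"
        using bnc[of "snd z" n] bc[of "snd z"] grad_test[of "b n" "snd z"] grad_test[of bb "snd z"]
        by (auto intro: less_imp_le)
    qed
    ultimately have "uniform_limit Q (\<lambda>n (x, t). grad (\<lambda>z. test_fun \<sigma> \<theta> y (b n) z t) x)
             (\<lambda>(x, t). grad (\<lambda>z. test_fun \<sigma> \<theta> y bb z t) x) sequentially"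
      unfolding case_prod_unfold by (subst uniform_limit_cong') (auto simp del: scaleR_scaleR)
    with a show ?thesis ..
  qed
  have 4: "\<exists>K. \<forall>n. \<forall>t\<in>J. K-lipschitz_on UNIV (grad (\<lambda>z. test_fun \<sigma> \<theta> y (b n) z t))"
    if "J \<subseteq> I" for J
    using that lipschitz_grad_test[OF _ signs(1,2)] bnc by (meson less_imp_le subsetD)
  show ?thesis
    unfolding path_solution_def bb_def[symmetric, abs_def]
    using 1 2 3 4 sol by (intro conjI exI[of _ p] exI[of _ "\<lambda>n. test_fun \<sigma> \<theta> y (b n)"]) auto
qed

end


section \<open>Comparison along one time step\<close>

text \<open>Test functions live on relatively open intervals, whereas a time step is closed. Uniform
  continuity of the path makes the enlargement cost only \<open>e\<close>.\<close>

lemma ex_rel_open_interval: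
  fixes \<zeta> :: "real \<Rightarrow> real"
  assumes "continuous_on {0..T} \<zeta>" "0 \<le> s" "s \<le> t" "t \<le> T" "0 < e"
  obtains I where "rel_open_interval T I" "{s..t} \<subseteq> I" "I \<subseteq> {0..T}"
    "\<And>r. r \<in> I \<Longrightarrow> \<exists>r'\<in>{s..t}. \<bar>\<zeta> r - \<zeta> r'\<bar> < e"
proof -
  have "uniformly_continuous_on {0..T} \<zeta>"
    using assms(1) by (intro compact_uniformly_continuous) auto
  then obtain \<rho> where \<rho>: "0 < \<rho>"
    "\<And>r r'. r \<in> {0..T} \<Longrightarrow> r' \<in> {0..T} \<Longrightarrow> dist r' r < \<rho> \<Longrightarrow> dist (\<zeta> r') (\<zeta> r) < e"
    using \<open>0 < e\<close> unfolding uniformly_continuous_on_def by metis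
  show ?thesis
  proof (rule that)
    show "rel_open_interval T ({0..T} \<inter> {s - \<rho><..<t + \<rho>})"
      unfolding rel_open_interval_def
      by (auto intro!: is_interval_Int is_interval_cc is_interval_oo openin_open_Int)
    show "{s..t} \<subseteq> {0..T} \<inter> {s - \<rho><..<t + \<rho>}" using assms \<rho> by auto
    fix r assume r: "r \<in> {0..T} \<inter> {s - \<rho><..<t + \<rho>}"
    define r' where "r' = max s (min t r)"
    have "r' \<in> {s..t}" "dist r r' < \<rho>" unfolding r'_def using r assms \<rho>(1)
      by (auto simp: dist_real_def max_def min_def)
    with \<rho>(2)[of r' r] r assms show "\<exists>r'\<in>{s..t}. \<bar>\<zeta> r - \<zeta> r'\<bar> < e"
      by (intro bexI[of _ r']) (auto simp: dist_real_def)
  qed auto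
qed

lemma C11_I:
  assumes "\<And>x. GDERIV f x :> g x" "K-lipschitz_on UNIV g"
  shows "f \<in> C11"
proof -
  have "grad f = g" using grad_eq[OF assms(1)] by auto
  then show ?thesis
    using assms unfolding C11_def gderiv_def differentiable_def by blast
qed

text \<open>Unifies the two halves of the notion: \<open>\<epsilon> = 1\<close> is the supersolution
  condition, and \<open>\<epsilon> = -1\<close> is the subsolution condition tested with the
  negative of \<open>\<psi>\<close>.\<close>

lemma viscosity_local_min:
  assumes "pathwise_subsolution H T \<zeta> u0 u" "pathwise_supersolution H T \<zeta> u0 u" "\<epsilon> = 1 \<or> \<epsilon> = -1"
    and "rel_open_interval T I" "path_solution H \<zeta> I \<Theta>" "C1_on T \<psi> \<psi>'" "t0 \<in> I" "0 < t0"
    and min: "\<forall>\<^sub>F (x, t) in at (x0, t0) within UNIV \<times> I.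
        \<epsilon> * u x0 t0 - \<epsilon> * \<Theta> x0 t0 - \<psi> t0 \<le> \<epsilon> * u x t - \<epsilon> * \<Theta> x t - \<psi> t"
  shows "0 \<le> \<psi>' t0"
  using assms(3)
proof
  assume "\<epsilon> = 1"
  with min have "\<forall>\<^sub>F (x, t) in at (x0, t0) within UNIV \<times> I.
      u x t - \<Theta> x t - \<psi> t \<ge> u x0 t0 - \<Theta> x0 t0 - \<psi> t0" by simp
  with assms show ?thesis unfolding pathwise_supersolution_def by blast
next
  assume "\<epsilon> = -1"
  with min have "\<forall>\<^sub>F (x, t) in at (x0, t0) within UNIV \<times> I.
      u x t - \<Theta> x t - (- \<psi> t) \<le> u x0 t0 - \<Theta> x0 t0 - (- \<psi> t0)"
    by (auto elim!: eventually_mono)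
  moreover have "C1_on T (\<lambda>t. - \<psi> t) (\<lambda>t. - \<psi>' t)"
    using assms(6) unfolding C1_on_def by (auto intro!: continuous_intros derivative_eq_intros)
  ultimately have "- \<psi>' t0 \<le> 0"
    using assms unfolding pathwise_subsolution_def by blast
  then show ?thesis by simp
qed

text \<open>A time penalty has to vanish up to \<open>a\<close> and still be C^1; squaring removes
  the corner of \<open>max 0 (r - a)\<close>.\<close>

lemma has_derivative_square_max:
  fixes a r :: real
  shows "((\<lambda>r. (max 0 (r - a))\<^sup>2) has_real_derivative 2 * max 0 (r - a)) (at r)"
proof -
  have "((\<lambda>r. if r \<in> {a..} then (r - a)\<^sup>2 else 0) has_vector_derivative
      (if r \<in> {a..} then 2 * (r - a) else 0)) (at r within UNIV)"
    by (rule has_vector_derivative_If_within_closures[where T = "{..<a}" and f' = "\<lambda>r. 2 * (r - a)"])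
      (auto simp flip: has_real_derivative_iff_has_vector_derivative intro!: derivative_eq_intros)
  moreover have "(\<lambda>r. if r \<in> {a..} then (r - a)\<^sup>2 else 0) = (\<lambda>r. (max 0 (r - a))\<^sup>2)"
    by (auto simp: max_def)
  moreover have "(if r \<in> {a..} then 2 * (r - a) else 0) = 2 * max 0 (r - a)"
    by (auto simp: max_def)
  ultimately show ?thesis by (simp add: has_real_derivative_iff_has_vector_derivative)
qed

locale comparison = conjugate A1 A2 d c K
  for A1 A2 :: "'a::euclidean_space \<Rightarrow> real" and d c K :: real +
  fixes H :: "'a \<Rightarrow> real" and \<epsilon> :: real
  assumes sign: "\<epsilon> = 1 \<or> \<epsilon> = -1" and H_eq: "\<And>p. H (\<epsilon> *\<^sub>R p) = \<epsilon> * (A1 p - A2 p)"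
begin

lemma bounded_A: "\<exists>B\<ge>0. \<forall>p. norm p \<le> l \<longrightarrow> A1 p + A2 p \<le> B"
proof -
  have "compact ((\<lambda>p. A1 p + A2 p) ` cball 0 l)"
    using continuous_A by (intro compact_continuous_image continuous_intros)
      (auto intro: continuous_on_subset)
  then obtain B where "\<forall>v\<in>(\<lambda>p. A1 p + A2 p) ` cball 0 l. norm v \<le> B"
    using compact_imp_bounded bounded_iff by blast
  then show ?thesis by (intro exI[of _ "\<bar>B\<bar>"]) force
qed

text \<open>The minimum over \<open>y\<close> of \<open>\<epsilon> u(y,r) + \<Phi>(x - y,r)\<close> cannot decrease in \<open>r\<close>: otherwise adding
  \<open>\<nu> (r - s) + A max(0, r - r0)\<^sup>2\<close> moves its minimum to an interior time, where the definition
  of a viscosity solution applies.\<close>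

lemma viscosity_step:
  assumes sol: "pathwise_viscosity_solution H T \<zeta> u0 u"
    and st: "0 \<le> s" "s \<le> t" "t \<le> T" and \<zeta>: "continuous_on {0..T} \<zeta>" and "0 < e"
    and slack: "\<And>r. r \<in> {s..t} \<Longrightarrow> \<bar>a - (\<zeta> r - \<zeta> s)\<bar> \<le> c - 2 * e"
    and init: "\<And>y. k \<le> \<epsilon> * u y s + Phi a (x - y)"
  shows "k \<le> \<epsilon> * u y t + Phi (a - (\<zeta> t - \<zeta> s)) (x - y)"
proof (cases "s = t")
  case True
  then show ?thesis using init by simp
next
  case False
  with st have "s < t" by simp
  have sub: "pathwise_subsolution H T \<zeta> u0 u" and super: "pathwise_supersolution H T \<zeta> u0 u"
    and ucont: "continuous_on (UNIV \<times> {0..T}) (\<lambda>(x, t). u x t)"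
    using sol uniformly_continuous_imp_continuous unfolding pathwise_viscosity_solution_def by auto
  obtain U where U: "\<And>x r. r \<in> {0..T} \<Longrightarrow> \<bar>u x r\<bar> \<le> U"
    using sol unfolding pathwise_viscosity_solution_def bounded_iff by force
  define b where "b r = a + (-1) * (\<zeta> r - \<zeta> s)" for r
  obtain I where I: "rel_open_interval T I" "{s..t} \<subseteq> I" "I \<subseteq> {0..T}"
    "\<And>r. r \<in> I \<Longrightarrow> \<exists>r'\<in>{s..t}. \<bar>\<zeta> r - \<zeta> r'\<bar> < e"
    using ex_rel_open_interval[OF \<zeta> st \<open>0 < e\<close>] by blast
  have bc: "\<bar>b r\<bar> \<le> c - e" if "r \<in> I" for r
    using I(4)[OF that] slack unfolding b_def by fastforce
  define \<Theta> where "\<Theta> = test_fun (- \<epsilon>) (-1) x b"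
  have path: "path_solution H \<zeta> I \<Theta>"
    unfolding \<Theta>_def b_def
    by (rule path_solution_test[OF compact_Icc \<zeta> I(3) _ \<open>0 < e\<close>])
      (use bc sign H_eq st in \<open>auto simp: b_def\<close>)
  have \<Theta>: "\<epsilon> * \<Theta> y r = - Phi (b r) (x - y)" for y r
    using sign by (auto simp: \<Theta>_def test_fun_def)
  define F where "F y r = \<epsilon> * u y r + Phi (b r) (x - y)" for y r
  have Fcont: "continuous_on (UNIV \<times> {s..t}) (\<lambda>z. F (fst z) (snd z))"
  proof -
    have "continuous_on (UNIV \<times> {s..t}) (\<lambda>z. u (fst z) (snd z))"
    proof (rule continuous_on_subset)
      show "continuous_on (UNIV \<times> {0..T}) (\<lambda>z. u (fst z) (snd z))"
        using ucont by (simp add: case_prod_unfold)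
    qed (use st in auto)
    moreover have "continuous_on {s..t} b"
      unfolding b_def using st by (intro continuous_intros continuous_on_subset[OF \<zeta>]) auto
    then have "continuous_on (UNIV \<times> {s..t}) (\<lambda>z. b (snd z))"
      by (rule continuous_on_compose2) (auto intro!: continuous_intros)
    then have 1: "continuous_on (UNIV \<times> {s..t}) (\<lambda>z. (b (snd z), x - fst z))"
      by (intro continuous_intros)
    have "continuous_on (UNIV \<times> {s..t}) (\<lambda>z. Phi (b (snd z)) (x - fst z))"
      using continuous_on_compose2[OF continuous_on_Phi 1] bc I(2) \<open>0 < e\<close>
      by (force simp: abs_le_iff)
    ultimately show ?thesis unfolding F_def by (intro continuous_intros)
  qed
  obtain B where B: "\<And>p. norm p \<le> 1 \<Longrightarrow> A1 p + A2 p \<le> B" using bounded_A by blast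
  define C where "C = d / 2 * 1\<^sup>2 + 2 * c * B"
  have Flow: "norm (x - y) - (\<bar>U\<bar> + \<bar>C\<bar>) \<le> F y r" if "r \<in> {s..t}" for y r
  proof -
    have "1 * norm (x - y) - C \<le> Phi (b r) (x - y)" unfolding C_def
      using bc[of r] that I(2) \<open>0 < e\<close> B by (intro Phi_ge_norm) fastforce+
    moreover have "- \<bar>U\<bar> \<le> \<epsilon> * u y r" using U[of r y] that st sign by auto
    ultimately show ?thesis unfolding F_def by simp
  qed
  show ?thesis
  proof (rule ccontr)
    assume "\<not> ?thesis"
    then have less: "F y t < k" unfolding F_def b_def by (simp add: algebra_simps)
    define g where "g = k - F y t"
    have "g > 0" using less unfolding g_def by simp
    have "continuous_on {s..t} (\<lambda>r. (y, r))" by (intro continuous_intros)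
    from continuous_on_compose2[OF Fcont this] have "continuous_on {s..t} (\<lambda>r. F y r)" by auto
    then have "((\<lambda>r. F y r) \<longlongrightarrow> F y t) (at t within {s..t})"
      using st unfolding continuous_on_def by auto
    moreover have "at t within {s..t} = at_left t"
      using \<open>s < t\<close> by (rule at_within_Icc_at_left)
    ultimately have "\<forall>\<^sub>F r in at_left t. F y r < k - g / 2"
      using \<open>g > 0\<close> by (intro order_tendstoD(2)[of _ "F y t"]) (auto simp: g_def field_simps)
    moreover have "\<forall>\<^sub>F r in at_left t. r \<in> {s<..<t}"
      using \<open>s < t\<close> by (rule eventually_at_left_real)
    ultimately have "\<forall>\<^sub>F r in at_left t. F y r < k - g / 2 \<and> r \<in> {s<..<t}"
      by (rule eventually_conj)
    \<comment> \<open>By continuity the bound fails by more than \<open>g / 2\<close> already before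
      \<open>t\<close>. A penalty that starts at \<open>r0\<close> leaves this value unchanged and
      can still grow up to time \<open>t\<close>.\<close>
    then obtain r0 where r0: "F y r0 < k - g / 2" "s < r0" "r0 < t"
      using eventually_happens by fastforce
    \<comment> \<open>The drift costs at most \<open>g / 4\<close> on the whole step, less than the
      deficit \<open>g / 2\<close> at \<open>r0\<close>; it makes the time derivative of
      \<open>\<psi>\<close> strictly negative.\<close>
    define \<nu> where "\<nu> = g / (4 * (t - s))"
    have "\<nu> > 0" using \<open>g > 0\<close> \<open>s < t\<close> unfolding \<nu>_def by simp
    have "\<nu> * (r0 - s) \<le> \<nu> * (t - s)" using r0 \<open>\<nu> > 0\<close> by simp
    also have "\<dots> = g / 4" using \<open>s < t\<close> unfolding \<nu>_def by (simp add: field_simps)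
    finally have \<nu>: "\<nu> * (r0 - s) \<le> g / 4" .
    \<comment> \<open>\<open>R\<close> plays two roles: at distance more than \<open>R\<close> from
      \<open>x\<close> coercivity lifts the function above \<open>k\<close>, and \<open>A\<close> is
      chosen so that the penalty at \<open>t\<close> equals \<open>R\<close>, which excludes a
      minimum there.\<close>
    define R where "R = \<bar>k\<bar> + \<bar>U\<bar> + \<bar>C\<bar> + 1"
    define A where "A = R / (t - r0)\<^sup>2"
    have "A \<ge> 0" unfolding A_def R_def by simp
    have At: "A * (t - r0)\<^sup>2 = R" using r0 unfolding A_def by simp
    define \<psi> where "\<psi> r = - (\<nu> * (r - s) + A * (max 0 (r - r0))\<^sup>2)" for r
    define \<psi>' where "\<psi>' r = - (\<nu> + A * (2 * max 0 (r - r0)))" for r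
    have "C1_on T \<psi> \<psi>'" unfolding C1_on_def
    proof (intro conjI ballI)
      show "continuous_on {0..T} \<psi>'" unfolding \<psi>'_def by (intro continuous_intros)
      fix r
      have "(\<psi> has_real_derivative \<psi>' r) (at r)" unfolding \<psi>_def \<psi>'_def
        by (rule derivative_eq_intros DERIV_cmult[OF has_derivative_square_max] refl | simp)+
      then show "(\<psi> has_real_derivative \<psi>' r) (at r within {0..T})"
        by (rule has_field_derivative_at_within)
    qed
    have \<psi>_le: "\<psi> r \<le> 0" if "r \<in> {s..t}" for r
      using that \<open>\<nu> > 0\<close> \<open>A \<ge> 0\<close> unfolding \<psi>_def
      by (intro neg_le_0_iff_le[THEN iffD2] add_nonneg_nonneg mult_nonneg_nonneg) auto
    have m1: "F y r0 - \<psi> r0 < k" using r0 \<nu> \<open>g > 0\<close> unfolding \<psi>_def by simp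
    have far: "k < F y' r - \<psi> r" if "r \<in> {s..t}" "\<not> dist x y' \<le> R" for y' r
      using Flow[OF that(1), of y'] \<psi>_le[OF that(1)] that(2) unfolding R_def dist_norm by linarith
    have yR: "dist x y \<le> R" using far[of r0 y] m1 r0 by force
    have "continuous_on (cball x R \<times> {s..t}) (\<lambda>z. F (fst z) (snd z) - \<psi> (snd z))"
      unfolding \<psi>_def by (intro continuous_intros continuous_on_subset[OF Fcont]) auto
    moreover have "(y, t) \<in> cball x R \<times> {s..t}" using yR st by simp
    then have "cball x R \<times> {s..t} \<noteq> {}" by blast
    ultimately have "\<exists>z\<in>cball x R \<times> {s..t}. \<forall>w\<in>cball x R \<times> {s..t}.
        F (fst z) (snd z) - \<psi> (snd z) \<le> F (fst w) (snd w) - \<psi> (snd w)"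
      by (intro continuous_attains_inf compact_Times compact_cball compact_Icc)
    then obtain z where z: "z \<in> cball x R \<times> {s..t}"
      "\<And>w. w \<in> cball x R \<times> {s..t} \<Longrightarrow> F (fst z) (snd z) - \<psi> (snd z) \<le> F (fst w) (snd w) - \<psi> (snd w)"
      by blast
    obtain y1 r1 where zz: "z = (y1, r1)" by (cases z)
    have r1: "r1 \<in> {s..t}" using z(1) zz by simp
    have low: "F y1 r1 - \<psi> r1 < k" using z(2)[of "(y, r0)"] yR r0 m1 zz by simp
    have glob: "F y1 r1 - \<psi> r1 \<le> F y' r - \<psi> r" if "r \<in> {s..t}" for y' r
      using z(2)[of "(y', r)"] far[OF that, of y'] low that zz by (cases "dist x y' \<le> R") auto
    \<comment> \<open>At time \<open>s\<close> both the drift and the penalty vanish, so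
      \<open>init\<close> keeps the function at least \<open>k\<close> there.\<close>
    have "r1 \<noteq> s"
      using low init[of y1] r0(2) unfolding F_def b_def \<psi>_def by auto
    moreover have "r1 \<noteq> t"
    proof
      assume "r1 = t"
      moreover have "F y1 t - \<psi> t \<ge> - (\<bar>U\<bar> + \<bar>C\<bar>) + R"
      proof -
        have "0 \<le> \<nu> * (t - s)" using \<open>\<nu> > 0\<close> \<open>s < t\<close> by simp
        then have "- \<psi> t \<ge> R" using r0 At unfolding \<psi>_def by (simp add: max_def)
        moreover have "F y1 t \<ge> - (\<bar>U\<bar> + \<bar>C\<bar>)"
          using order_trans[OF _ Flow[of t y1]] st by simp
        ultimately show ?thesis by linarith
      qed
      ultimately show False using low unfolding R_def by auto
    qed
    ultimately have r1': "s < r1" "r1 < t" using r1 by auto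
    have "\<forall>\<^sub>F w in at (y1, r1) within UNIV \<times> I. w \<in> UNIV \<times> {s<..<t}"
      using r1' by (intro eventually_at_topological[THEN iffD2] exI[of _ "UNIV \<times> {s<..<t}"])
        (auto intro: open_Times)
    then have "\<forall>\<^sub>F (x', t') in at (y1, r1) within UNIV \<times> I.
        \<epsilon> * u y1 r1 - \<epsilon> * \<Theta> y1 r1 - \<psi> r1 \<le> \<epsilon> * u x' t' - \<epsilon> * \<Theta> x' t' - \<psi> t'"
    proof eventually_elim
      case (elim w)
      then show ?case using glob[of "snd w" "fst w"] unfolding F_def \<Theta> by (auto simp: case_prod_unfold)
    qed
    from viscosity_local_min[OF sub super sign I(1) path \<open>C1_on T \<psi> \<psi>'\<close> _ _ this]
    have "0 \<le> \<psi>' r1" using subsetD[OF I(2) r1] r1' st by auto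
    moreover have "\<psi>' r1 < 0" using \<open>\<nu> > 0\<close> \<open>A \<ge> 0\<close> unfolding \<psi>'_def
      by (intro neg_less_0_iff_less[THEN iffD2] add_pos_nonneg mult_nonneg_nonneg) auto
    ultimately show False by simp
  qed
qed

text \<open>Monotonicity compares \<open>w\<close> with the test function shifted by a constant,
  invariance pulls the constant out, and consistency replaces the scheme by the exact evolution. For
  \<open>\<epsilon> = -1\<close> the test function lies below \<open>w\<close> instead of
  above.\<close>

lemma scheme_step:
  assumes S: "scheme_invariant T S" "scheme_monotone T lam0 S" "scheme_consistent H T lam0 C0 S"
    and "0 < h" "0 < C0" and \<zeta>: "\<zeta> \<in> Cpaths T" and st: "0 \<le> s" "s \<le> t" "t \<le> T"
    and osc: "osc \<zeta> s t \<le> lam0 * h" and "0 < e"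
    and slack: "\<And>r. r \<in> {s..t} \<Longrightarrow> \<bar>a + (\<zeta> r - \<zeta> s)\<bar> \<le> c - 2 * e"
    and w: "w \<in> BUC" and init: "\<And>x. \<epsilon> * w x \<le> k + Phi a (x - y)"
  shows "\<epsilon> * S h t s \<zeta> w x \<le> k + C0 * (2 / d) * h\<^sup>2 + Phi (a + (\<zeta> t - \<zeta> s)) (x - y)"
proof -
  have \<zeta>c: "continuous_on {0..T} \<zeta>" using \<zeta> unfolding Cpaths_def by auto
  define b where "b r = a + 1 * (\<zeta> r - \<zeta> s)" for r
  obtain I where I: "rel_open_interval T I" "{s..t} \<subseteq> I" "I \<subseteq> {0..T}"
    "\<And>r. r \<in> I \<Longrightarrow> \<exists>r'\<in>{s..t}. \<bar>\<zeta> r - \<zeta> r'\<bar> < e"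
    using ex_rel_open_interval[OF \<zeta>c st \<open>0 < e\<close>] by blast
  have bc: "\<bar>b r\<bar> \<le> c - e" if "r \<in> I" for r
    using I(4)[OF that] slack unfolding b_def by fastforce
  have bc': "\<bar>b r\<bar> \<le> c" if "r \<in> I" for r using bc[OF that] \<open>0 < e\<close> by simp
  have s_abs: "\<bar>\<epsilon>\<bar> = 1" using sign by auto
  define \<Theta> where "\<Theta> = test_fun \<epsilon> 1 y b"
  have path: "path_solution H \<zeta> I \<Theta>"
    unfolding \<Theta>_def b_def
    by (rule path_solution_test[OF compact_Icc \<zeta>c I(3) _ \<open>0 < e\<close>])
      (use bc sign H_eq st in \<open>auto simp: b_def\<close>)
  have C11: "(\<lambda>x. \<Theta> x s + m) \<in> C11" for m
  proof (rule C11_I)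
    have sI: "s \<in> I" using I(2) st by auto
    show "GDERIV (\<lambda>x. \<Theta> x s + m) x :> (\<epsilon> * 1) *\<^sub>R argmax (b s) (1 *\<^sub>R (x - y))" for x
      using GDERIV_test[of b s \<epsilon> 1 y x, OF bc'[OF sI]] unfolding \<Theta>_def gderiv_def
      by (rule has_derivative_add_const)
    show "(2 / d)-lipschitz_on UNIV (\<lambda>x. (\<epsilon> * 1) *\<^sub>R argmax (b s) (1 *\<^sub>R (x - y)))"
      using lipschitz_grad_test[of b s \<epsilon> 1 y, OF bc'[OF sI] s_abs] grad_test[of b s \<epsilon> 1 y, OF bc'[OF sI]]
      by (simp add: fun_eq_iff cong: lipschitz_on_cong)
  qed
  have "(SUP x. ereal \<bar>S h t s \<zeta> (\<lambda>y. \<Theta> y s) x - \<Theta> x t\<bar>) \<le> ereal C0 * D2_norm I \<Theta> * ereal (h\<^sup>2)"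
  proof -
    have "s \<in> I" "t \<in> I" using I(2) st by auto
    then show ?thesis
      using S(3) \<open>0 < h\<close> \<zeta> I(1) path st(2) osc unfolding scheme_consistent_def by blast
  qed
  also have "\<dots> \<le> ereal C0 * ereal (2 / d) * ereal (h\<^sup>2)"
    using D2_norm_test[OF bc' s_abs] \<open>0 < C0\<close> unfolding \<Theta>_def
    by (intro ereal_mult_right_mono ereal_mult_left_mono) auto
  also have "\<dots> = ereal (C0 * (2 / d) * h\<^sup>2)" by simp
  finally have "ereal \<bar>S h t s \<zeta> (\<lambda>y. \<Theta> y s) x - \<Theta> x t\<bar> \<le> ereal (C0 * (2 / d) * h\<^sup>2)"
    by (meson SUP_le_iff UNIV_I)
  then have cons: "\<bar>S h t s \<zeta> (\<lambda>y. \<Theta> y s) x - \<Theta> x t\<bar> \<le> C0 * (2 / d) * h\<^sup>2" by simp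
  have \<Theta>: "\<Theta> x s = \<epsilon> * Phi a (x - y)" "\<Theta> x t = \<epsilon> * Phi (a + (\<zeta> t - \<zeta> s)) (x - y)" for x
    unfolding \<Theta>_def test_fun_def b_def by auto
  have C11': "(\<lambda>x. \<Theta> x s) \<in> C11" using C11[of 0] by simp
  have const: "S h t s \<zeta> (\<lambda>x. \<Theta> x s + m) x = S h t s \<zeta> (\<lambda>x. \<Theta> x s) x + m" for m
    using S(1) \<open>0 < h\<close> \<zeta> C11' st unfolding scheme_invariant_def by (metis UnI2)
  have mono: "S h t s \<zeta> w1 x \<le> S h t s \<zeta> w2 x"
    if "w1 \<in> BUC \<union> C11" "w2 \<in> BUC \<union> C11" "\<And>x. w1 x \<le> w2 x" for w1 w2
    using S(2) \<open>0 < h\<close> \<zeta> st osc that unfolding scheme_monotone_def by blast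
  show ?thesis using sign
  proof
    assume 1: "\<epsilon> = 1"
    have "S h t s \<zeta> w x \<le> S h t s \<zeta> (\<lambda>x. \<Theta> x s + k) x"
      using init w C11 \<Theta>(1) 1 by (intro mono) (auto simp: add.commute)
    then show ?thesis using const[of k] cons \<Theta>(2)[of x] 1 by simp
  next
    assume 1: "\<epsilon> = -1"
    have "- Phi a (x' - y) + - k \<le> w x'" for x' using init[of x'] 1 by simp
    then have "S h t s \<zeta> (\<lambda>x. \<Theta> x s + - k) x \<le> S h t s \<zeta> w x"
      using w C11[of "-k"] \<Theta>(1) 1 by (intro mono) auto
    then show ?thesis using const[of "-k"] cons \<Theta>(2)[of x] 1 by simp
  qed
qed

text \<open>The error of the scheme is propagated in the form
  \<open>\<epsilon> (u\<^sub>h(x,r) - u(y,r)) \<le> m + \<Phi>(x - y, \<zeta>(r) - \<xi>(r))\<close>. The first step moves \<open>x\<close> along \<open>\<zeta>\<close>, the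
  second one moves \<open>y\<close> along \<open>\<xi>\<close>.\<close>

lemma doubled_step:
  assumes S: "scheme_invariant T S" "scheme_monotone T lam0 S" "scheme_consistent H T lam0 C0 S"
    and pos: "0 < h" "0 < C0" "0 < e" and \<zeta>: "\<zeta> \<in> Cpaths T" and st: "0 \<le> s" "s \<le> t" "t \<le> T"
    and osc: "osc \<zeta> s t \<le> lam0 * h"
    and sol: "pathwise_viscosity_solution H T \<xi> u0 u" and \<xi>: "continuous_on {0..T} \<xi>"
    and c: "c = 5 * e" and near: "\<bar>\<zeta> s - \<xi> s\<bar> \<le> e"
    and step: "\<And>r. r \<in> {s..t} \<Longrightarrow> \<bar>\<zeta> r - \<zeta> s\<bar> \<le> e" "\<And>r. r \<in> {s..t} \<Longrightarrow> \<bar>\<xi> r - \<xi> s\<bar> \<le> e"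
    and w: "w \<in> BUC" and init: "\<And>x y. \<epsilon> * (w x - u y s) \<le> m + Phi (\<zeta> s - \<xi> s) (x - y)"
  shows "\<epsilon> * (S h t s \<zeta> w x - u y t)
    \<le> m + C0 * (2 / d) * h\<^sup>2 + Phi (\<zeta> t - \<xi> t) (x - y)"
proof -
  define a where "a = \<zeta> s - \<xi> s + (\<zeta> t - \<zeta> s)"
  have "\<epsilon> * S h t s \<zeta> w x \<le> (m + \<epsilon> * u y s) + C0 * (2 / d) * h\<^sup>2 + Phi a (x - y)" for y
    unfolding a_def
  proof (rule scheme_step[OF S pos(1,2) \<zeta> st osc pos(3) _ w])
    show "\<bar>\<zeta> s - \<xi> s + (\<zeta> r - \<zeta> s)\<bar> \<le> c - 2 * e" if "r \<in> {s..t}" for r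
      using near step(1)[OF that] pos(3) unfolding c by linarith
    show "\<epsilon> * w x \<le> m + \<epsilon> * u y s + Phi (\<zeta> s - \<xi> s) (x - y)" for x
      using init[of x y] by (simp add: algebra_simps)
  qed
  then have k: "\<epsilon> * S h t s \<zeta> w x - m - C0 * (2 / d) * h\<^sup>2 \<le> \<epsilon> * u y s + Phi a (x - y)" for y
    by (simp add: algebra_simps)
  have "\<epsilon> * S h t s \<zeta> w x - m - C0 * (2 / d) * h\<^sup>2 \<le> \<epsilon> * u y t + Phi (a - (\<xi> t - \<xi> s)) (x - y)"
  proof (rule viscosity_step[OF sol st \<xi> pos(3) _ k])
    \<comment> \<open>The gap at \<open>s\<close>, the increment of \<open>\<zeta>\<close> and the
      increment of \<open>\<xi>\<close> are each at most \<open>e\<close>, and \<open>3 * e\<close>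
      is exactly \<open>c - 2 * e\<close>.\<close>
    show "\<bar>a - (\<xi> r - \<xi> s)\<bar> \<le> c - 2 * e" if "r \<in> {s..t}" for r
      using near step(1)[of t] step(2)[OF that] st unfolding c a_def by auto
  qed
  moreover have "a - (\<xi> t - \<xi> s) = \<zeta> t - \<xi> t" unfolding a_def by simp
  ultimately show ?thesis by (simp add: algebra_simps)
qed

end


section \<open>Error of the scheme for a given path\<close>

lemma osc_le:
  assumes "s \<le> t" "\<And>r1 r2. r1 \<in> {s..t} \<Longrightarrow> r2 \<in> {s..t} \<Longrightarrow> \<bar>\<zeta> r1 - \<zeta> r2\<bar> \<le> e"
  shows "osc \<zeta> s t \<le> e"
  unfolding osc_def using assms by (intro cSUP_least) auto

lemma le_osc:
  assumes "continuous_on {s..t} \<zeta>" "r1 \<in> {s..t}" "r2 \<in> {s..t}"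
  shows "\<bar>\<zeta> r1 - \<zeta> r2\<bar> \<le> osc \<zeta> s t"
proof -
  have "bounded (\<zeta> ` {s..t})"
    using assms(1) by (intro compact_imp_bounded compact_continuous_image) auto
  then obtain B where "\<forall>r\<in>{s..t}. \<bar>\<zeta> r\<bar> \<le> B"
    unfolding bounded_iff by auto
  then have "\<bar>\<zeta> r - \<zeta> r'\<bar> \<le> 2 * B" if "r \<in> {s..t}" "r' \<in> {s..t}" for r r'
    using that by (smt (verit))
  then have "bdd_above ((\<lambda>(r1, r2). \<bar>\<zeta> r1 - \<zeta> r2\<bar>) ` ({s..t} \<times> {s..t}))"
    by (intro bdd_aboveI2[of _ _ "2 * B"]) auto
  from cSUP_upper[OF _ this, of "(r1, r2)"] show ?thesis
    unfolding osc_def using assms(2,3) by simp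
qed

lemma lipschitz_in_BUC:
  assumes "bounded (range w)" "L-lipschitz_on UNIV w"
  shows "w \<in> BUC"
  using assms lipschitz_on_uniformly_continuous unfolding BUC_def by blast

context comparison
begin

text \<open>The constant \<open>m\<close> dominates the Lipschitz initial data through the slope
  \<open>L\<close> of \<open>Phi\<close>, and every step adds the consistency error once. Induction
  over the grid keeps the doubled inequality for all \<open>x\<close> and \<open>y\<close>; the
  diagonal is taken only at the end.\<close>

lemma grid_error:
  assumes S: "scheme_invariant T S" "scheme_monotone T lam0 S" "scheme_consistent H T lam0 C0 S"
    and maps: "scheme_maps T S"
    and pos: "0 < h" "0 < C0" "0 < e" and \<zeta>: "\<zeta> \<in> Cpaths T"
    and sol: "pathwise_viscosity_solution H T \<xi> u0 u" and \<xi>: "continuous_on {0..T} \<xi>"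
    and c: "c = 5 * e" and near: "\<And>r. r \<in> {0..T} \<Longrightarrow> \<bar>\<zeta> r - \<xi> r\<bar> \<le> e"
    and grid: "s 0 = 0" "0 \<le> T" "\<And>n. n < N \<Longrightarrow> 0 \<le> s n \<and> s n \<le> s (Suc n) \<and> s (Suc n) \<le> T"
    and step: "\<And>n r. n < N \<Longrightarrow> r \<in> {s n..s (Suc n)} \<Longrightarrow> \<bar>\<zeta> r - \<zeta> (s n)\<bar> \<le> e \<and> \<bar>\<xi> r - \<xi> (s n)\<bar> \<le> e"
    and osc: "\<And>n r r'. n < N \<Longrightarrow> r \<in> {s n..s (Suc n)} \<Longrightarrow> r' \<in> {s n..s (Suc n)}
      \<Longrightarrow> \<bar>\<zeta> r - \<zeta> r'\<bar> \<le> lam0 * h"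
    and U: "U 0 = u0" "\<And>n. n < N \<Longrightarrow> U (Suc n) = S h (s (Suc n)) (s n) \<zeta> (U n)"
    and u0: "bounded (range u0)" "L-lipschitz_on UNIV u0"
    and B: "\<And>p. norm p \<le> L \<Longrightarrow> A1 p + A2 p \<le> B"
    and n: "n < N" and t: "t \<in> {s n..s (Suc n)}"
  shows "\<epsilon> * (S h t (s n) \<zeta> (U n) x - u x t)
    \<le> (d / 2 * L\<^sup>2 + 2 * c * B) + real N * (C0 * (2 / d) * h\<^sup>2)"
proof -
  define m where "m = d / 2 * L\<^sup>2 + 2 * c * B"
  define \<kappa> where "\<kappa> = C0 * (2 / d) * h\<^sup>2"
  have nonneg: "0 \<le> \<kappa>" unfolding \<kappa>_def using pos d_pos by simp
  have L: "0 \<le> L" using u0(2) by (rule lipschitz_on_nonneg)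
  have step_n: "\<epsilon> * (S h t (s n) \<zeta> (U n) x - u y t) \<le> (m + real n * \<kappa>) + \<kappa> + Phi (\<zeta> t - \<xi> t) (x - y)"
    if n: "n < N" and t: "t \<in> {s n..s (Suc n)}" and "U n \<in> BUC"
      and "\<And>x y. \<epsilon> * (U n x - u y (s n)) \<le> m + real n * \<kappa> + Phi (\<zeta> (s n) - \<xi> (s n)) (x - y)"
    for n t x y
    unfolding \<kappa>_def
  proof (rule doubled_step[OF S pos \<zeta> _ _ _ _ sol \<xi> c])
    show "0 \<le> s n" "s n \<le> t" "t \<le> T" using grid(3)[OF n] t by auto
    then show "osc \<zeta> (s n) t \<le> lam0 * h" using t osc[OF n] by (intro osc_le) auto
    show "\<bar>\<zeta> (s n) - \<xi> (s n)\<bar> \<le> e" using grid(3)[OF n] by (intro near) auto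
  qed (use that step[OF n] in \<open>auto simp: \<kappa>_def\<close>)
  have claim: "U n \<in> BUC \<and>
      (\<forall>x y. \<epsilon> * (U n x - u y (s n)) \<le> m + real n * \<kappa> + Phi (\<zeta> (s n) - \<xi> (s n)) (x - y))"
    if "n \<le> N" for n
    using that
  proof (induction n)
    case 0
    have "u x 0 = u0 x" for x
      using sol unfolding pathwise_viscosity_solution_def pathwise_subsolution_def
        pathwise_supersolution_def by (meson order_antisym)
    moreover have "\<epsilon> * (u0 x - u0 y) \<le> m + Phi (\<zeta> 0 - \<xi> 0) (x - y)" for x y
    proof -
      have "\<epsilon> * (u0 x - u0 y) \<le> \<bar>u0 x - u0 y\<bar>" using sign by auto
      also have "\<dots> \<le> L * norm (x - y)"
        using lipschitz_onD[OF u0(2), of x y] by (simp add: dist_norm)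
      also have "\<dots> \<le> m + Phi (\<zeta> 0 - \<xi> 0) (x - y)"
        using Phi_ge_norm[of "\<zeta> 0 - \<xi> 0" L B "x - y"] near[of 0] grid(2) c pos L B
        unfolding m_def by auto
      finally show ?thesis .
    qed
    ultimately show ?case using U(1) grid(1) lipschitz_in_BUC[OF u0] by simp
  next
    case (Suc n)
    then have n: "n < N" by simp
    have "U (Suc n) \<in> BUC"
      using maps U(2)[OF n] Suc grid(3)[OF n] \<zeta> pos(1) unfolding scheme_maps_def by auto
    moreover have "\<epsilon> * (U (Suc n) x - u y (s (Suc n)))
        \<le> m + real (Suc n) * \<kappa> + Phi (\<zeta> (s (Suc n)) - \<xi> (s (Suc n))) (x - y)" for x y
      using step_n[OF n, of "s (Suc n)" x y] Suc grid(3)[OF n] unfolding U(2)[OF n]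
      by (auto simp: algebra_simps)
    ultimately show ?case by blast
  qed
  \<comment> \<open>The partial step ending at \<open>t\<close> costs as much as a full one, hence
    \<open>Suc n\<close> below. On the diagonal the penalty is nonpositive by
    \<open>Phi_zero_le\<close>.\<close>
  have "\<epsilon> * (S h t (s n) \<zeta> (U n) x - u x t) \<le> (m + real n * \<kappa>) + \<kappa> + Phi (\<zeta> t - \<xi> t) (x - x)"
    using claim[of n] n by (intro step_n[OF n t]) auto
  also have "\<dots> \<le> (m + real n * \<kappa>) + \<kappa>"
    using Phi_zero_le[of "\<zeta> t - \<xi> t"] near[of t] t grid(3)[OF n] c pos by auto
  also have "\<dots> = m + real (Suc n) * \<kappa>" by (simp add: algebra_simps)
  also have "\<dots> \<le> m + real N * \<kappa>"
    using n nonneg by (intro add_left_mono mult_right_mono) auto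
  finally show ?thesis unfolding m_def \<kappa>_def .
qed

end

text \<open>\<open>comparison\<close> bounds one sign of the error. Exchanging and reflecting the
  convex parts gives \<open>H (- p) = - (A1 p - A2 p)\<close>, hence the other sign. The term
  \<open>10 * e * B\<close> is \<open>2 * c * B\<close> with \<open>c = 5 * e\<close>.\<close>

lemma scheme_error:
  fixes H H1 H2 :: "'a::euclidean_space \<Rightarrow> real" and S :: "'a scheme"
  assumes H: "convex_on UNIV H1" "convex_on UNIV H2" "\<And>p. 0 \<le> H1 p" "\<And>p. 0 \<le> H2 p"
    "\<And>p. H p = H1 p - H2 p" "K-lipschitz_on UNIV H"
    and S: "scheme_invariant T S" "scheme_monotone T lam0 S" "scheme_consistent H T lam0 C0 S"
    and maps: "scheme_maps T S"
    and pos: "0 < h" "0 < C0" "0 < e" "0 < d" and \<zeta>: "\<zeta> \<in> Cpaths T"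
    and sol: "pathwise_viscosity_solution H T \<xi> u0 u" and \<xi>: "continuous_on {0..T} \<xi>"
    and near: "\<And>r. r \<in> {0..T} \<Longrightarrow> \<bar>\<zeta> r - \<xi> r\<bar> \<le> e"
    and grid: "s 0 = 0" "0 \<le> T" "\<And>n. n < N \<Longrightarrow> 0 \<le> s n \<and> s n \<le> s (Suc n) \<and> s (Suc n) \<le> T"
    and step: "\<And>n r. n < N \<Longrightarrow> r \<in> {s n..s (Suc n)} \<Longrightarrow> \<bar>\<zeta> r - \<zeta> (s n)\<bar> \<le> e \<and> \<bar>\<xi> r - \<xi> (s n)\<bar> \<le> e"
    and osc: "\<And>n r r'. n < N \<Longrightarrow> r \<in> {s n..s (Suc n)} \<Longrightarrow> r' \<in> {s n..s (Suc n)}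
      \<Longrightarrow> \<bar>\<zeta> r - \<zeta> r'\<bar> \<le> lam0 * h"
    and U: "U 0 = u0" "\<And>n. n < N \<Longrightarrow> U (Suc n) = S h (s (Suc n)) (s n) \<zeta> (U n)"
    and u0: "bounded (range u0)" "L-lipschitz_on UNIV u0"
    and B: "\<And>p. norm p \<le> L \<Longrightarrow> H1 p + H2 p \<le> B"
    and n: "n < N" and t: "t \<in> {s n..s (Suc n)}"
  shows "\<bar>S h t (s n) \<zeta> (U n) x - u x t\<bar> \<le> d / 2 * L\<^sup>2 + 10 * e * B + real N * (C0 * (2 / d) * h\<^sup>2)"
proof -
  have reflect: "convex_on UNIV (\<lambda>p. A (- p))" if "convex_on UNIV A" for A :: "'a \<Rightarrow> real"
    using that unfolding convex_on_def by (simp add: minus_add_distrib flip: scaleR_minus_right)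
  have Hm: "K-lipschitz_on UNIV (\<lambda>p. H2 (- p) - H1 (- p))"
  proof (rule lipschitz_onI)
    show "dist (H2 (- p) - H1 (- p)) (H2 (- q) - H1 (- q)) \<le> K * dist p q" for p q
      using lipschitz_onD[OF H(6), of "- q" "- p"] unfolding H(5)
      by (simp add: dist_norm norm_minus_commute algebra_simps)
  qed (rule lipschitz_on_nonneg[OF H(6)])
  interpret upper: comparison H1 H2 d "5 * e" K H 1
    by unfold_locales (use H pos in \<open>auto simp flip: H(5)\<close>)
  interpret lower: comparison "\<lambda>p. H2 (- p)" "\<lambda>p. H1 (- p)" d "5 * e" K H "-1"
    by unfold_locales (use H pos reflect Hm in auto)
  have "1 * (S h t (s n) \<zeta> (U n) x - u x t)
      \<le> (d / 2 * L\<^sup>2 + 2 * (5 * e) * B) + real N * (C0 * (2 / d) * h\<^sup>2)"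
    by (rule upper.grid_error[OF S maps pos(1-3) \<zeta> sol \<xi>, where s = s and N = N and U = U and L = L])
      (fact | rule refl)+
  moreover have "-1 * (S h t (s n) \<zeta> (U n) x - u x t)
      \<le> (d / 2 * L\<^sup>2 + 2 * (5 * e) * B) + real N * (C0 * (2 / d) * h\<^sup>2)"
    by (rule lower.grid_error[OF S maps pos(1-3) \<zeta> sol \<xi>, where s = s and N = N and U = U and L = L])
      (fact | rule refl | use B[of "- _"] in \<open>simp add: add.commute\<close>)+
  ultimately show ?thesis by (simp add: abs_le_iff)
qed


section \<open>Stopping times and the random grid\<close>

text \<open>Everything here concerns one fixed path. \<open>osc_exceeds\<close> guarantees that the
  infima defining the stopping times are taken over nonempty sets.\<close>

locale blocks =
  fixes w :: "real \<Rightarrow> real" and h :: real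
  assumes cont: "continuous_on {0..} w" and eta_pos: "0 < eta h"
    and osc_exceeds: "\<And>a. 0 \<le> a \<Longrightarrow> \<exists>t>a. eta h < osc w a t"
begin

abbreviation stop :: "nat \<Rightarrow> real" where "stop \<equiv> stop_time w h"

lemma near_point:
  assumes "0 \<le> a" "0 < e"
  obtains \<rho> where "0 < \<rho>" "\<And>r. 0 \<le> r \<Longrightarrow> \<bar>r - a\<bar> \<le> \<rho> \<Longrightarrow> \<bar>w r - w a\<bar> < e"
proof -
  obtain \<delta> where "0 < \<delta>" "\<And>r. r \<in> {0..} \<Longrightarrow> dist r a < \<delta> \<Longrightarrow> dist (w r) (w a) < e"
    using cont assms unfolding continuous_on_iff by (metis atLeast_iff)
  then show ?thesis by (intro that[of "\<delta> / 2"]) (auto simp: dist_real_def)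
qed

section \<open>First exit of the oscillation above \<open>eta h\<close> after an arbitrary
  time\<close>

context
  fixes a b :: real
  assumes a: "0 \<le> a" and b: "b = Inf {t. a < t \<and> eta h < osc w a t}"
begin

lemma exit_nonempty: "{t. a < t \<and> eta h < osc w a t} \<noteq> {}"
  using osc_exceeds[OF a] by auto

lemma exit_bdd: "bdd_below {t. a < t \<and> eta h < osc w a t}"
  by (rule bdd_belowI[of _ a]) auto

lemma exit_greater: "a < b"
proof -
  obtain \<rho> where \<rho>: "0 < \<rho>" "\<And>r. 0 \<le> r \<Longrightarrow> \<bar>r - a\<bar> \<le> \<rho> \<Longrightarrow> \<bar>w r - w a\<bar> < eta h / 2"
    using near_point[OF a, of "eta h / 2"] eta_pos by auto
  have "a + \<rho> \<le> t" if "a < t" "eta h < osc w a t" for t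
  proof (rule ccontr)
    assume "\<not> a + \<rho> \<le> t"
    then have "\<bar>w r - w a\<bar> < eta h / 2" if "r \<in> {a..t}" for r
      using \<rho>(2)[of r] that a by auto
    then have "osc w a t \<le> eta h" using that(1)
      by (intro osc_le) (auto, smt (verit) field_sum_of_halves)
    with that show False by simp
  qed
  then have "a + \<rho> \<le> b" unfolding b by (intro cInf_greatest exit_nonempty) auto
  with \<rho>(1) show ?thesis by simp
qed

text \<open>Before the infimum no oscillation exceeds \<open>eta h\<close>; continuity carries the
  bound to the closed interval, one variable at a time.\<close>

lemma exit_osc:
  assumes "r1 \<in> {a..b}" "r2 \<in> {a..b}"
  shows "\<bar>w r1 - w r2\<bar> \<le> eta h"
proof -
  have c: "continuous_on {a..b} w"
    using a by (intro continuous_on_subset[OF cont]) auto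
  have cl: "closure {a..<b} = {a..b}" using exit_greater by simp
  have 1: "\<bar>w r1 - w r2\<bar> \<le> eta h" if "r1 \<in> {a..<b}" "r2 \<in> {a..<b}" for r1 r2
  proof (cases "max r1 r2 = a")
    case True
    then have "r1 = r2" using that by (auto simp: max_def split: if_splits)
    then show ?thesis using eta_pos by simp
  next
    case False
    define t where "t = max r1 r2"
    have t: "a < t" "t < b" using False that unfolding t_def by (auto simp: max_def split: if_splits)
    then have "osc w a t \<le> eta h"
      using cInf_lower[OF _ exit_bdd, of t] unfolding b by fastforce
    moreover have "\<bar>w r1 - w r2\<bar> \<le> osc w a t"
      using that a unfolding t_def by (intro le_osc continuous_on_subset[OF cont]) auto
    ultimately show ?thesis by simp
  qed
  have 2: "\<bar>w r1 - w r2\<bar> \<le> eta h" if "r1 \<in> {a..<b}" "r2 \<in> {a..b}" for r1 r2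
    by (rule continuous_le_on_closure[of "{a..<b}" "\<lambda>r. \<bar>w r1 - w r\<bar>" r2])
      (use 1 that c in \<open>auto simp: cl intro!: continuous_intros\<close>)
  show ?thesis
    by (rule continuous_le_on_closure[of "{a..<b}" "\<lambda>r. \<bar>w r - w r2\<bar>" r1])
      (use 2 assms c in \<open>auto simp: cl intro!: continuous_intros\<close>)
qed

text \<open>If every increment ending at \<open>b\<close> were below \<open>eta h / 2\<close>,
  continuity would extend this slightly past \<open>b\<close>, and the triangle inequality through
  \<open>w b\<close> would keep the oscillation at most \<open>eta h\<close> beyond the infimum.
  Such an increment is what the block count needs.\<close>

lemma exit_increment: "\<exists>r\<in>{a..<b}. eta h / 2 \<le> \<bar>w b - w r\<bar>"
proof (rule ccontr)
  assume "\<not> ?thesis"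
  then have 1: "\<bar>w r - w b\<bar> < eta h / 2" if "r \<in> {a..<b}" for r
    using that by (force simp: abs_minus_commute)
  have "0 \<le> b" using a exit_greater by simp
  then obtain \<rho> where \<rho>: "0 < \<rho>" "\<And>r. 0 \<le> r \<Longrightarrow> \<bar>r - b\<bar> \<le> \<rho> \<Longrightarrow> \<bar>w r - w b\<bar> < eta h / 2"
    using near_point[of b "eta h / 2"] eta_pos by auto
  have 2: "\<bar>w r - w b\<bar> < eta h / 2" if "r \<in> {a..b + \<rho>}" for r
    using 1[of r] \<rho>(2)[of r] that a by (cases "r < b") auto
  have "b < b + \<rho>" using \<rho>(1) by simp
  then obtain t where t: "a < t" "eta h < osc w a t" "t < b + \<rho>"
    using cInf_lessD[OF exit_nonempty] unfolding b by blast
  have "osc w a t \<le> eta h"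
  proof (rule osc_le)
    fix r1 r2 assume "r1 \<in> {a..t}" "r2 \<in> {a..t}"
    then have "r1 \<in> {a..b + \<rho>}" "r2 \<in> {a..b + \<rho>}" using t by auto
    from 2[OF this(1)] 2[OF this(2)] show "\<bar>w r1 - w r2\<bar> \<le> eta h" by linarith
  qed (use t in simp)
  with t(2) show False by simp
qed

end

lemma stop_Suc: "stop (Suc k) = Inf {t. stop k < t \<and> eta h < osc w (stop k) t}"
  by simp

declare stop_time.simps(2) [simp del]

lemma stop_nonneg: "0 \<le> stop k"
proof (induction k)
  case (Suc k)
  then show ?case using exit_greater[OF Suc stop_Suc] by simp
qed simp

lemma stop_less_Suc: "stop k < stop (Suc k)"
  by (rule exit_greater[OF stop_nonneg stop_Suc])

lemma strict_mono_stop: "strict_mono stop"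
  using stop_less_Suc by (simp add: strict_mono_Suc_iff)

lemma stop_osc: "r1 \<in> {stop k..stop (Suc k)} \<Longrightarrow> r2 \<in> {stop k..stop (Suc k)} \<Longrightarrow> \<bar>w r1 - w r2\<bar> \<le> eta h"
  by (rule exit_osc[OF stop_nonneg stop_Suc])

lemma stop_increment: "\<exists>r\<in>{stop k..<stop (Suc k)}. eta h / 2 \<le> \<bar>w (stop (Suc k)) - w r\<bar>"
  by (rule exit_increment[OF stop_nonneg stop_Suc])

lemma stop_cover:
  assumes "0 \<le> t" "t < stop n"
  shows "\<exists>k<n. t \<in> {stop k..<stop (Suc k)}"
  using assms(2)
proof (induction n)
  case (Suc n)
  then show ?case by (cases "t < stop n") (auto intro: less_SucI)
qed (use assms(1) in simp)

section \<open>The piecewise linear path on the blocks\<close>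

definition slope :: "nat \<Rightarrow> real" where
  "slope k = (w (stop (Suc k)) - w (stop k)) / (stop (Suc k) - stop k)"

text \<open>At the right endpoint the definition already uses the next block; both formulas give the
  value of \<open>w\<close> there, so the closed block is allowed.\<close>

lemma interp_path_eq:
  assumes "t \<in> {stop k..stop (Suc k)}"
  shows "interp_path w h t = w (stop k) + slope k * (t - stop k)"
proof -
  have main: "interp_path w h t = w (stop k) + slope k * (t - stop k)"
    if "t \<in> {stop k..<stop (Suc k)}" for k
  proof -
    have "(THE k. stop k \<le> t \<and> t < stop (Suc k)) = k"
    proof (rule the_equality)
      fix j assume "stop j \<le> t \<and> t < stop (Suc j)"
      then have "stop j < stop (Suc k)" "stop k < stop (Suc j)" using that by auto
      then show "j = k" unfolding strict_mono_less[OF strict_mono_stop] by simp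
    qed (use that in auto)
    then show ?thesis unfolding interp_path_def Let_def slope_def tau_def by simp
  qed
  show ?thesis
  proof (cases "t = stop (Suc k)")
    case True
    then show ?thesis using main[of "Suc k"] stop_less_Suc[of k] stop_less_Suc[of "Suc k"]
      by (simp add: slope_def)
  qed (use main[of k] assms in auto)
qed

lemma abs_slope_le: "\<bar>slope k\<bar> * (stop (Suc k) - stop k) \<le> eta h"
  using stop_osc[of "stop (Suc k)" k "stop k"] stop_less_Suc[of k]
  by (simp add: slope_def abs_divide)

text \<open>The interpolation is a convex combination of the values of \<open>w\<close> at the two
  ends of the block, each within \<open>eta h\<close> of \<open>w t\<close>.\<close>

lemma interp_path_near:
  assumes "t \<in> {stop k..stop (Suc k)}"
  shows "\<bar>interp_path w h t - w t\<bar> \<le> eta h"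
proof -
  define l where "l = (t - stop k) / (stop (Suc k) - stop k)"
  have l: "0 \<le> l" "l \<le> 1" using assms stop_less_Suc[of k] unfolding l_def by auto
  have "interp_path w h t - w t = (1 - l) * (w (stop k) - w t) + l * (w (stop (Suc k)) - w t)"
    unfolding interp_path_eq[OF assms] slope_def l_def by (simp add: algebra_simps diff_divide_distrib)
  also have "\<bar>\<dots>\<bar> \<le> (1 - l) * \<bar>w (stop k) - w t\<bar> + l * \<bar>w (stop (Suc k)) - w t\<bar>"
    using l by (intro order_trans[OF abs_triangle_ineq]) (simp add: abs_mult)
  also have "\<dots> \<le> (1 - l) * eta h + l * eta h"
    using l assms stop_less_Suc[of k] by (intro add_mono mult_left_mono stop_osc[of _ k]) auto
  finally show ?thesis by (simp add: algebra_simps)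
qed

lemma continuous_on_interp_path: "continuous_on {0..stop n} (interp_path w h)"
proof (induction n)
  case 0
  then show ?case by simp
next
  case (Suc n)
  have "continuous_on {stop n..stop (Suc n)} (interp_path w h)"
    by (rule continuous_on_eq[of _ "\<lambda>t. w (stop n) + slope n * (t - stop n)"])
      (auto intro!: continuous_intros simp: interp_path_eq)
  with Suc have "continuous_on ({0..stop n} \<union> {stop n..stop (Suc n)}) (interp_path w h)"
    by (intro continuous_on_closed_Un) auto
  moreover have "{0..stop n} \<union> {stop n..stop (Suc n)} = {0..stop (Suc n)}"
    using stop_nonneg[of n] stop_less_Suc[of n] by auto
  ultimately show ?case by simp
qed

section \<open>The grid with \<open>M\<close> equal steps in every block\<close>

context
  fixes lam0 :: real
  assumes lam0: "0 < lam0" and h: "0 < h"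
begin

abbreviation "M \<equiv> Mh lam0 h"
abbreviation "grid \<equiv> grid_time w lam0 h"

lemma M_ge: "eta h / (lam0 * h) \<le> real M"
  unfolding Mh_def by (rule order_trans[OF le_of_int_ceiling]) simp

lemma M_pos: "0 < M"
proof -
  have "0 < eta h / (lam0 * h)" using eta_pos lam0 h by simp
  with M_ge have "0 < real M" by linarith
  then show ?thesis by simp
qed

lemma M_le: "real M \<le> eta h / (lam0 * h) + 1"
proof -
  have "0 \<le> eta h / (lam0 * h)" using eta_pos lam0 h by simp
  then have "real M = of_int \<lceil>eta h / (lam0 * h)\<rceil>" unfolding Mh_def by simp
  then show ?thesis by linarith
qed

lemma grid_eq:
  "grid n = stop (n div M) + real (n mod M) * ((stop (Suc (n div M)) - stop (n div M)) / real M)"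
  unfolding grid_time_def Let_def tau_def by (simp add: minus_div_mult_eq_mod)

text \<open>Expressed by the block of \<open>n\<close> even if \<open>Suc n\<close> opens the next
  one: then \<open>Suc (n mod M)\<close> is \<open>M\<close>, and the formula yields the end of the
  old block.\<close>

lemma grid_Suc:
  "grid (Suc n) = stop (n div M) + real (Suc (n mod M)) * ((stop (Suc (n div M)) - stop (n div M)) / real M)"
proof (cases "Suc (n mod M) = M")
  case True
  then have "Suc n div M = Suc (n div M)" "Suc n mod M = 0" by (auto simp: div_Suc mod_Suc)
  then show ?thesis using M_pos unfolding grid_eq[of "Suc n"] True by simp
next
  case False
  then have "Suc n div M = n div M" "Suc n mod M = Suc (n mod M)" by (auto simp: div_Suc mod_Suc)
  then show ?thesis unfolding grid_eq[of "Suc n"] by simp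
qed

lemma grid_Suc_diff: "grid (Suc n) - grid n = (stop (Suc (n div M)) - stop (n div M)) / real M"
  unfolding grid_Suc unfolding grid_eq
  by (simp add: algebra_simps add_divide_distrib diff_divide_distrib)

lemma strict_mono_grid: "strict_mono grid"
proof -
  have "0 < grid (Suc n) - grid n" for n
    unfolding grid_Suc_diff using stop_less_Suc M_pos by simp
  then show ?thesis by (simp add: strict_mono_Suc_iff)
qed

lemma grid_subset: "{grid n..grid (Suc n)} \<subseteq> {stop (n div M)..stop (Suc (n div M))}"
proof -
  have "real (Suc (n mod M)) * ((stop (Suc (n div M)) - stop (n div M)) / real M)
      \<le> real M * ((stop (Suc (n div M)) - stop (n div M)) / real M)"
    using M_pos stop_less_Suc[of "n div M"]
    by (intro mult_right_mono of_nat_mono) (auto simp: Suc_leI)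
  then have "grid (Suc n) \<le> stop (Suc (n div M))" unfolding grid_Suc using M_pos by simp
  moreover have "stop (n div M) \<le> grid n"
    unfolding grid_eq using M_pos stop_less_Suc[of "n div M"] by simp
  ultimately show ?thesis by auto
qed

lemma grid_0: "grid 0 = 0"
  by (simp add: grid_eq)

lemma grid_mult: "grid (k * M) = stop k"
  using M_pos by (simp add: grid_eq)

text \<open>A grid step is one \<open>M\<close>-th of a linear piece of height at most
  \<open>eta h\<close>. By the choice of \<open>M\<close> this is at most \<open>lam0 * h\<close>,
  the restriction under which the scheme is monotone and consistent.\<close>

lemma interp_path_grid_osc:
  assumes "r \<in> {grid n..grid (Suc n)}" "r' \<in> {grid n..grid (Suc n)}"
  shows "\<bar>interp_path w h r - interp_path w h r'\<bar> \<le> eta h / real M"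
proof -
  let ?k = "n div M"
  have "interp_path w h r - interp_path w h r' = slope ?k * (r - r')"
    using assms grid_subset[of n] interp_path_eq[of r ?k] interp_path_eq[of r' ?k]
    by (auto simp: algebra_simps)
  then have "\<bar>interp_path w h r - interp_path w h r'\<bar> = \<bar>slope ?k\<bar> * \<bar>r - r'\<bar>"
    by (simp add: abs_mult)
  also have "\<dots> \<le> \<bar>slope ?k\<bar> * (grid (Suc n) - grid n)"
    using assms by (intro mult_left_mono) auto
  also have "\<dots> = (\<bar>slope ?k\<bar> * (stop (Suc ?k) - stop ?k)) / real M"
    unfolding grid_Suc_diff by simp
  also have "\<dots> \<le> eta h / real M"
    using abs_slope_le[of ?k] by (intro divide_right_mono) auto
  finally show ?thesis .
qed

end

end

text \<open>\<open>N\<close> is the first index at which the grid reaches \<open>T\<close>. The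
  points before it are already sorted and strictly below \<open>T\<close>, so appending
  \<open>T\<close> gives the sorted list; the index \<open>m\<close> makes it finite.\<close>

lemma partition_list_eq:
  fixes w lam0 h
  defines "g \<equiv> grid_time w lam0 h"
  assumes g: "strict_mono g" "g 0 = 0" and T: "0 < T" "T \<le> g m"
  obtains N where "0 < N" "N \<le> m" "\<And>n. n < N \<Longrightarrow> g n < T" "T \<le> g N"
    "partition_list w lam0 T h = map g [0..<N] @ [T]"
proof -
  define N where "N = (LEAST n. T \<le> g n)"
  have N: "T \<le> g N" "N \<le> m" "\<And>n. n < N \<Longrightarrow> g n < T"
    unfolding N_def using T(2) by (auto intro: LeastI Least_le dest: not_less_Least)
  have "0 < N" using N(1) g(2) T(1) by (cases N) auto
  have "g n < T \<longleftrightarrow> n < N" for n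
    using N(1,3) strict_mono_less_eq[OF g(1), of N n] by (meson leD leI order_trans)
  then have "time_partition w lam0 T h = set (map g [0..<N] @ [T])"
    unfolding time_partition_def g_def[symmetric] by (auto simp: image_iff)
  moreover have "sorted (map g [0..<N])"
    by (simp add: sorted_iff_nth_mono strict_mono_less_eq[OF g(1)])
  then have "sorted (map g [0..<N] @ [T])"
    using N(3) by (auto simp: sorted_append intro: less_imp_le)
  moreover have "distinct (map g [0..<N] @ [T])"
    using strict_mono_eq[OF g(1)] by (auto simp: distinct_map inj_on_def dest: N(3))
  ultimately have "partition_list w lam0 T h = map g [0..<N] @ [T]"
    unfolding partition_list_def by (metis sorted_list_of_set.idem_if_sorted_distinct)
  with N \<open>0 < N\<close> show ?thesis by (intro that[of N])
qed

text \<open>Once \<open>k\<close> blocks cover the time interval, the partition has at most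
  \<open>k * Mh lam0 h\<close> steps; each satisfies the oscillation requirements of
  \<open>scheme_error\<close> because it stays inside one grid cell.\<close>

lemma (in blocks) scheme_solution_error:
  fixes H H1 H2 :: "'a::euclidean_space \<Rightarrow> real" and S :: "'a scheme"
  assumes H: "convex_on UNIV H1" "convex_on UNIV H2" "\<And>p. 0 \<le> H1 p" "\<And>p. 0 \<le> H2 p"
    "\<And>p. H p = H1 p - H2 p" "K-lipschitz_on UNIV H"
    and S: "scheme_invariant T S" "scheme_monotone T lam0 S" "scheme_consistent H T lam0 C0 S"
    and maps: "scheme_maps T S"
    and pos: "0 < h" "0 < C0" "0 < d" "0 < lam0" "0 < T"
    and sol: "pathwise_viscosity_solution H T w u0 u"
    and u0: "bounded (range u0)" "L-lipschitz_on UNIV u0"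
    and B: "\<And>p. norm p \<le> L \<Longrightarrow> H1 p + H2 p \<le> B"
    and k: "T \<le> stop k" and t: "t \<in> {0..T}"
  shows "\<bar>scheme_solution S w lam0 T u0 h x t - u x t\<bar>
    \<le> d / 2 * L\<^sup>2 + 10 * eta h * B + real (k * Mh lam0 h) * (C0 * (2 / d) * h\<^sup>2)"
proof -
  let ?g = "grid_time w lam0 h" and ?M = "Mh lam0 h"
  define \<zeta> where "\<zeta> = restrict (interp_path w h) {0..T}"
  obtain N where N: "0 < N" "N \<le> k * ?M" "\<And>n. n < N \<Longrightarrow> ?g n < T" "T \<le> ?g N"
    "partition_list w lam0 T h = map ?g [0..<N] @ [T]"
    using partition_list_eq[OF strict_mono_grid[OF pos(4,1)] grid_0[OF pos(4,1)] pos(5)]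
      k grid_mult[OF pos(4,1)] by metis
  define ss where "ss = partition_list w lam0 T h"
  define U where "U = scheme_at_grid S \<zeta> ss u0 h"
  have len: "length ss = Suc N" unfolding ss_def N(5) by simp
  have ss: "ss ! n = (if n < N then ?g n else T)" if "n \<le> N" for n
    using that unfolding ss_def N(5) by (auto simp: nth_append)
  have ssub: "{ss ! n..ss ! Suc n} \<subseteq> {?g n..?g (Suc n)}" "ss ! n < ss ! Suc n" if "n < N" for n
  proof -
    have "?g n < ?g (Suc n)" using strict_monoD[OF strict_mono_grid[OF pos(4,1)]] by simp
    moreover have "T \<le> ?g (Suc n)" if "\<not> Suc n < N"
      using that \<open>n < N\<close> N(4) by (metis Suc_lessI)
    ultimately show "{ss ! n..ss ! Suc n} \<subseteq> {?g n..?g (Suc n)}" "ss ! n < ss ! Suc n"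
      using that N(3)[OF that] ss[of n] ss[of "Suc n"] by auto
  qed
  have ss0: "ss ! 0 = 0" using ss[of 0] N(1) grid_0[OF pos(4,1)] by simp
  have ssN: "ss ! N = T" using ss[of N] by simp
  have ss_mono: "ss ! i \<le> ss ! j" if "i \<le> j" "j \<le> N" for i j
    using that
  proof (induction j)
    case (Suc j)
    then show ?case using ssub(2)[of j] by (cases "i = Suc j") auto
  qed simp
  have range: "0 \<le> ss ! n" "ss ! n \<le> ss ! Suc n" "ss ! Suc n \<le> T" if "n < N" for n
    using ss_mono[of 0 n] ss_mono[of n "Suc n"] ss_mono[of "Suc n" N] ss0 ssN that by auto
  have "\<zeta> \<in> Cpaths T"
  proof -
    have "continuous_on {0..T} (interp_path w h)"
      using k by (intro continuous_on_subset[OF continuous_on_interp_path[of k]]) auto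
    then have "continuous_on {0..T} \<zeta>" unfolding \<zeta>_def by (rule continuous_on_eq) simp
    then show ?thesis unfolding Cpaths_def \<zeta>_def by auto
  qed
  have \<zeta>: "\<zeta> r = interp_path w h r" if "r \<in> {0..T}" for r using that unfolding \<zeta>_def by simp
  have near: "\<bar>\<zeta> r - w r\<bar> \<le> eta h" if "r \<in> {0..T}" for r
  proof -
    \<comment> \<open>The block index is raised by one because \<open>stop_cover\<close> needs a
      strict inequality and \<open>r = T = stop k\<close> may occur.\<close>
    have "0 \<le> r" "r < stop (Suc k)" using that k stop_less_Suc[of k] by auto
    then obtain j where "r \<in> {stop j..<stop (Suc j)}" using stop_cover[of r "Suc k"] by blast
    then show ?thesis using interp_path_near[of r j] \<zeta>[OF that] by auto
  qed
  have oscM: "\<bar>\<zeta> r - \<zeta> r'\<bar> \<le> eta h / real ?M"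
    if "n < N" "r \<in> {ss ! n..ss ! Suc n}" "r' \<in> {ss ! n..ss ! Suc n}" for n r r'
  proof -
    have "r \<in> {0..T}" "r' \<in> {0..T}" using range[OF that(1)] that(2,3) by auto
    then show ?thesis
      using interp_path_grid_osc[OF pos(4,1), of r n r'] ssub(1)[OF that(1)] that(2,3) \<zeta> by auto
  qed
  have M1: "eta h / real ?M \<le> eta h"
    using M_pos[OF pos(4,1)] eta_pos by (simp add: divide_le_eq)
  have M2: "eta h / real ?M \<le> lam0 * h"
    using M_pos[OF pos(4,1)] M_ge[OF pos(4,1)] pos by (simp add: field_simps)
  have step: "\<bar>\<zeta> r - \<zeta> (ss ! n)\<bar> \<le> eta h \<and> \<bar>w r - w (ss ! n)\<bar> \<le> eta h"
    if "n < N" "r \<in> {ss ! n..ss ! Suc n}" for n r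
  proof
    have m: "ss ! n \<in> {ss ! n..ss ! Suc n}" using range[OF that(1)] by simp
    show "\<bar>\<zeta> r - \<zeta> (ss ! n)\<bar> \<le> eta h" using oscM[OF that m] M1 by simp
    show "\<bar>w r - w (ss ! n)\<bar> \<le> eta h"
      using that(2) m ssub(1)[OF that(1)] grid_subset[OF pos(4,1), of n]
      by (intro stop_osc[of _ "n div ?M"]) blast+
  qed
  define E where "E N = d / 2 * L\<^sup>2 + 10 * eta h * B + real N * (C0 * (2 / d) * h\<^sup>2)" for N
  have main: "\<bar>S h t (ss ! n) \<zeta> (U n) x - u x t\<bar> \<le> E N"
    if "n < N" "t \<in> {ss ! n..ss ! Suc n}" for n t
    unfolding E_def
  proof (rule scheme_error[where s = "(!) ss" and U = U and B = B and \<xi> = w,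
        OF H S maps pos(1,2) eta_pos pos(3) \<open>\<zeta> \<in> Cpaths T\<close> sol _ near ss0])
    show "continuous_on {0..T} w" by (rule continuous_on_subset[OF cont]) auto
    show "\<bar>\<zeta> r - \<zeta> r'\<bar> \<le> lam0 * h"
      if "n < N" "r \<in> {ss ! n..ss ! Suc n}" "r' \<in> {ss ! n..ss ! Suc n}" for n r r'
      using oscM[OF that] M2 by simp
  qed (use that range step u0 B pos in \<open>auto simp: U_def\<close>)
  have L0: "0 \<le> L" using u0(2) by (rule lipschitz_on_nonneg)
  have B0: "0 \<le> B" using B[of 0] H(3)[of 0] H(4)[of 0] L0 by simp
  have EN: "E N \<le> E (k * ?M)" unfolding E_def
    using N(2) pos by (intro add_left_mono mult_right_mono) (auto simp del: of_nat_mult)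
  have "\<bar>scheme_solution S w lam0 T u0 h x t - u x t\<bar> \<le> E (k * ?M)"
  proof (cases "t = 0")
    case True
    have "u x 0 = u0 x"
      using sol unfolding pathwise_viscosity_solution_def pathwise_subsolution_def
        pathwise_supersolution_def by (meson order_antisym)
    moreover have "0 \<le> E (k * ?M)" unfolding E_def using pos B0 eta_pos by simp
    ultimately show ?thesis using True unfolding scheme_solution_def by simp
  next
    case False
    \<comment> \<open>The least partition point not before \<open>t\<close>; its predecessor
      \<open>j\<close> is the index selected in \<open>scheme_solution\<close>, whose intervals are
      open on the left.\<close>
    define n where "n = (LEAST n. t \<le> ss ! n)"
    have "t \<le> ss ! n" "n \<le> N" "\<And>i. i < n \<Longrightarrow> ss ! i < t"
      unfolding n_def using t ssN by (auto intro: LeastI[of _ N] Least_le[of _ N] dest: not_less_Least)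
    note n = this
    have "n \<noteq> 0" using n(1) ss0 False t by (metis atLeastAtMost_iff order_antisym)
    then obtain j where "n = Suc j" using not0_implies_Suc by blast
    then have j: "j < N" "ss ! j < t" "t \<le> ss ! Suc j" using n by auto
    have "(THE n. Suc n < length ss \<and> ss ! n < t \<and> t \<le> ss ! Suc n) = j"
    proof (rule the_equality)
      fix i assume i: "Suc i < length ss \<and> ss ! i < t \<and> t \<le> ss ! Suc i"
      have "\<not> Suc i \<le> j" using ss_mono[of "Suc i" j] i j len by force
      moreover have "\<not> Suc j \<le> i" using ss_mono[of "Suc j" i] i j len by force
      ultimately show "i = j" by simp
    qed (use j len in auto)
    then have "scheme_solution S w lam0 T u0 h x t = S h t (ss ! j) \<zeta> (U j) x"
      using False unfolding scheme_solution_def Let_def ss_def[symmetric] \<zeta>_def[symmetric] U_def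
      by simp
    then show ?thesis using main[OF j(1), of t] j EN by auto
  qed
  then show ?thesis unfolding E_def .
qed


section \<open>Counting oscillation blocks\<close>

text \<open>The powers of 9/10 from the first one on sum to 9, hence the total 9/20 of
  \<open>e\<close>; continuity passes this to the limit point.\<close>

lemma telescoping_limit:
  fixes w :: "real \<Rightarrow> real"
  assumes cont: "continuous_on X w" and x: "x \<longlonglongrightarrow> r" "\<And>n. x n \<in> X" "r \<in> X"
    and step: "\<And>n. \<bar>w (x (Suc n)) - w (x n)\<bar> \<le> e / 20 * (9/10) ^ Suc n" and "0 \<le> e"
  shows "\<bar>w r - w (x 0)\<bar> \<le> 9 / 20 * e"
proof -
  have "\<bar>w (x n) - w (x 0)\<bar> \<le> 9 / 20 * e * (1 - (9/10) ^ n)" for n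
  proof (induction n)
    case (Suc n)
    have "\<bar>w (x (Suc n)) - w (x 0)\<bar> \<le> \<bar>w (x (Suc n)) - w (x n)\<bar> + \<bar>w (x n) - w (x 0)\<bar>" by linarith
    also have "\<dots> \<le> e / 20 * (9/10) ^ Suc n + 9 / 20 * e * (1 - (9/10) ^ n)"
      using Suc step by (intro add_mono)
    also have "\<dots> = 9 / 20 * e * (1 - (9/10) ^ Suc n)" by (simp add: algebra_simps)
    finally show ?case .
  qed simp
  also have "9 / 20 * e * (1 - (9/10) ^ n) \<le> 9 / 20 * e" for n
    using \<open>0 \<le> e\<close> by (intro mult_left_le) auto
  finally have le: "\<bar>w (x n) - w (x 0)\<bar> \<le> 9 / 20 * e" for n .
  have "(\<lambda>n. w (x n)) \<longlonglongrightarrow> w r"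
    using continuous_on_tendsto_compose[OF cont x(1) x(3)] x(2) by auto
  then have "(\<lambda>n. \<bar>w (x n) - w (x 0)\<bar>) \<longlonglongrightarrow> \<bar>w r - w (x 0)\<bar>"
    by (intro tendsto_intros)
  then show ?thesis by (rule LIMSEQ_le_const2) (use le in auto)
qed

text \<open>Chaining: the dyadic points of level \<open>m\<close> next to \<open>r1\<close> and \<open>r2\<close> coincide at the first level
  that has a point in \<open>[r1, r2]\<close>.\<close>

lemma ex_dyadic_increment:
  fixes w :: "real \<Rightarrow> real"
  assumes cont: "continuous_on {0..} w" and r: "0 \<le> r1" "r1 < r2" "r2 - r1 < 1 / 2 ^ m0"
    and e: "0 < e" "e \<le> \<bar>w r2 - w r1\<bar>"
  shows "\<exists>m i. m0 \<le> m \<and> r1 \<le> real i / 2 ^ m \<and> real (Suc i) / 2 ^ m \<le> r2 \<and>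
    e / 20 * (9/10) ^ (m - m0) \<le> \<bar>w (real (Suc i) / 2 ^ m) - w (real i / 2 ^ m)\<bar>"
proof (rule ccontr)
  assume contr: "\<not> ?thesis"
  have small: "\<bar>w (of_int (i + 1) / 2 ^ m) - w (of_int i / 2 ^ m)\<bar> \<le> e / 20 * (9/10) ^ (m - m0)"
    if "m0 \<le> m" "r1 \<le> of_int i / 2 ^ m" "of_int (i + 1) / 2 ^ m \<le> r2" for m i
  proof -
    have "0 \<le> real_of_int i / 2 ^ m" using that(2) r(1) by linarith
    then have "0 \<le> i" by (simp add: pos_le_divide_eq)
    then have "real (nat i) = of_int i" "real (Suc (nat i)) = of_int (i + 1)" by auto
    with contr that show ?thesis by (metis linear)
  qed
  \<comment> \<open>Index of the first dyadic point at or after \<open>r1\<close>; \<open>b\<close>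
    is that of the last one at or before \<open>r2\<close>.\<close>
  define a where "a m = \<lceil>r1 * 2 ^ m\<rceil>" for m :: nat
  define b where "b m = \<lfloor>r2 * 2 ^ m\<rfloor>" for m :: nat
  define A where "A m = real_of_int (a m) / 2 ^ m" for m
  define B where "B m = real_of_int (b m) / 2 ^ m" for m
  have A: "r1 \<le> A m" "A m \<le> r1 + 1 / 2 ^ m" for m
  proof -
    have "r1 * 2 ^ m \<le> of_int (a m)" "of_int (a m) \<le> r1 * 2 ^ m + 1" unfolding a_def by linarith+
    then have "r1 * 2 ^ m / 2 ^ m \<le> A m" "A m \<le> (r1 * 2 ^ m + 1) / 2 ^ m"
      unfolding A_def by (intro divide_right_mono; simp)+
    then show "r1 \<le> A m" "A m \<le> r1 + 1 / 2 ^ m" by (simp_all add: add_divide_distrib)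
  qed
  have B: "B m \<le> r2" "r2 - 1 / 2 ^ m \<le> B m" for m
  proof -
    have "of_int (b m) \<le> r2 * 2 ^ m" "r2 * 2 ^ m - 1 \<le> of_int (b m)" unfolding b_def by linarith+
    then have "B m \<le> r2 * 2 ^ m / 2 ^ m" "(r2 * 2 ^ m - 1) / 2 ^ m \<le> B m"
      unfolding B_def by (intro divide_right_mono; simp)+
    then show "B m \<le> r2" "r2 - 1 / 2 ^ m \<le> B m" by (simp_all add: diff_divide_distrib)
  qed
  have "\<exists>m\<ge>m0. a m \<le> b m"
  proof -
    obtain k where k: "(1/2) ^ k < (r2 - r1) / 2"
      using real_arch_pow_inv[of "(r2 - r1) / 2" "1/2"] r(2) by auto
    define m where "m = max m0 k"
    have "(1/2 :: real) ^ m \<le> (1/2) ^ k" unfolding m_def by (intro power_decreasing) auto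
    then have "1 / 2 ^ m < (r2 - r1) / 2" using k by (simp add: power_divide)
    moreover have "A m \<le> B m" if "u < (r2 - r1) / 2" "A m \<le> r1 + u" "r2 - u \<le> B m" for u
      using that by (simp add: field_simps)
    ultimately have "A m \<le> B m" using A(2)[of m] B(2)[of m] by blast
    then have "a m \<le> b m" unfolding A_def B_def by (simp add: divide_le_cancel)
    then show ?thesis unfolding m_def by (intro exI[of _ "max m0 k"]) auto
  qed
  define m1 where "m1 = (LEAST m. m0 \<le> m \<and> a m \<le> b m)"
  have m1: "m0 \<le> m1" "a m1 \<le> b m1" "\<And>m. m < m1 \<Longrightarrow> m0 \<le> m \<Longrightarrow> \<not> a m \<le> b m"
    using \<open>\<exists>m\<ge>m0. a m \<le> b m\<close> unfolding m1_def
    by (auto intro: LeastI2_ex dest!: not_less_Least)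
  \<comment> \<open>Of two neighbouring dyadic points one has an even index, so it already exists
    one level earlier, against minimality of \<open>m1\<close>. At level \<open>m0\<close> the
    interval is too short to contain two.\<close>
  have "a m1 = b m1"
  proof (rule ccontr)
    assume "a m1 \<noteq> b m1"
    then have ab: "a m1 + 1 \<le> b m1" using m1(2) by simp
    have a1: "r1 * 2 ^ m1 \<le> of_int (a m1)" unfolding a_def by linarith
    have "real_of_int (a m1 + 1) \<le> real_of_int (b m1)" using ab by (simp only: of_int_le_iff)
    then have b1: "real_of_int (a m1) + 1 \<le> r2 * 2 ^ m1" unfolding b_def by linarith
    show False
    proof (cases "m1 = m0")
      case True
      have "(r2 - r1) * 2 ^ m0 < 1" using r(3) by (simp add: field_simps)
      then show False using a1 b1 True by (simp add: algebra_simps)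
    next
      case False
      then obtain m where m: "m1 = Suc m" "m0 \<le> m" using m1(1) by (metis Suc_le_D Suc_le_mono le_antisym not_less_eq_eq)
      have "\<exists>n::int. r1 * 2 ^ m \<le> of_int n \<and> of_int n \<le> r2 * 2 ^ m"
      proof (cases "even (a m1)")
        case True
        then obtain n where "a m1 = 2 * n" by blast
        then show ?thesis using a1 b1 m(1) by (intro exI[of _ n]) (auto simp: algebra_simps)
      next
        case False
        then obtain n where "a m1 = 2 * n + 1" by (rule oddE)
        then show ?thesis using a1 b1 m(1) by (intro exI[of _ "n + 1"]) (auto simp: algebra_simps)
      qed
      then obtain n :: int where "r1 * 2 ^ m \<le> of_int n" "of_int n \<le> r2 * 2 ^ m" by blast
      then have "a m \<le> n" "n \<le> b m" unfolding a_def b_def by (auto simp: ceiling_le_iff le_floor_iff)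
      with m1(3)[of m] m show False by simp
    qed
  qed
  then have AB: "A m1 = B m1" unfolding A_def B_def by simp
  \<comment> \<open>Refinement moves the point next to \<open>r1\<close> by at most one interval of
    the new level, so \<open>small\<close> bounds each link of the chain.\<close>
  have a_Suc: "a (Suc m) = 2 * a m \<or> a (Suc m) + 1 = 2 * a m" for m
  proof -
    have "a (Suc m) \<le> 2 * a m" "2 * a m \<le> a (Suc m) + 1"
      unfolding a_def by (simp_all add: ceiling_le_iff) linarith+
    then show ?thesis by linarith
  qed
  have b_Suc: "b (Suc m) = 2 * b m \<or> b (Suc m) = 2 * b m + 1" for m
  proof -
    have "2 * b m \<le> b (Suc m)" "b (Suc m) \<le> 2 * b m + 1"
      unfolding b_def by (simp_all add: le_floor_iff) linarith+
    then show ?thesis by linarith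
  qed
  have Am: "A (m1 + n) \<le> A m1" for n
  proof (induction n)
    case (Suc n)
    have "real_of_int (a (Suc (m1 + n))) \<le> 2 * real_of_int (a (m1 + n))"
      using a_Suc[of "m1 + n"] by linarith
    then have "A (Suc (m1 + n)) \<le> A (m1 + n)" unfolding A_def by (simp add: field_simps)
    with Suc show ?case by simp
  qed simp
  have Bm: "B m1 \<le> B (m1 + n)" for n
  proof (induction n)
    case (Suc n)
    have "2 * real_of_int (b (m1 + n)) \<le> real_of_int (b (Suc (m1 + n)))"
      using b_Suc[of "m1 + n"] by linarith
    then have "B (m1 + n) \<le> B (Suc (m1 + n))" unfolding B_def by (simp add: field_simps)
    with Suc show ?case by simp
  qed simp
  \<comment> \<open>The thresholds are counted from \<open>m0\<close>, the chain from
    \<open>m1\<close>; since \<open>m0 \<le> m1\<close>, the weights only get smaller.\<close>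
  have pow: "e / 20 * (9/10) ^ (Suc (m1 + n) - m0) \<le> e / 20 * (9/10) ^ Suc n" for n
    using e(1) m1(1) by (intro mult_left_mono power_decreasing) auto
  have inv: "(\<lambda>n. 1 / 2 ^ (m1 + n) :: real) \<longlonglongrightarrow> 0"
    using LIMSEQ_ignore_initial_segment[OF LIMSEQ_power_zero[of "1/2 :: real"], of m1]
    by (simp add: power_divide add.commute)
  have w1: "\<bar>w r1 - w (A (m1 + 0))\<bar> \<le> 9 / 20 * e"
  proof (rule telescoping_limit[OF cont, where x = "\<lambda>n. A (m1 + n)"])
    show "(\<lambda>n. A (m1 + n)) \<longlonglongrightarrow> r1"
    proof (rule tendsto_sandwich[OF _ _ tendsto_const])
      show "(\<lambda>n. r1 + 1 / 2 ^ (m1 + n)) \<longlonglongrightarrow> r1" using tendsto_add[OF tendsto_const inv, of r1] by simp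
    qed (use A in auto)
    show "\<bar>w (A (m1 + Suc n)) - w (A (m1 + n))\<bar> \<le> e / 20 * (9/10) ^ Suc n" for n
    proof (cases "a (Suc (m1 + n)) = 2 * a (m1 + n)")
      case True
      then show ?thesis using e(1) unfolding A_def by simp
    next
      case False
      then have s: "a (Suc (m1 + n)) + 1 = 2 * a (m1 + n)" using a_Suc by blast
      have Aeq: "of_int (a (Suc (m1 + n)) + 1) / 2 ^ Suc (m1 + n) = A (m1 + n)"
        unfolding s A_def by simp
      have "\<bar>w (of_int (a (Suc (m1 + n)) + 1) / 2 ^ Suc (m1 + n)) - w (of_int (a (Suc (m1 + n))) / 2 ^ Suc (m1 + n))\<bar>
          \<le> e / 20 * (9/10) ^ (Suc (m1 + n) - m0)"
      proof (rule small)
        show "r1 \<le> of_int (a (Suc (m1 + n))) / 2 ^ Suc (m1 + n)" using A(1) unfolding A_def .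
        show "of_int (a (Suc (m1 + n)) + 1) / 2 ^ Suc (m1 + n) \<le> r2"
          unfolding Aeq using Am[of n] AB B(1)[of m1] by linarith
      qed (use m1(1) in simp)
      then show ?thesis unfolding Aeq using pow[of n] unfolding A_def by (simp add: abs_minus_commute)
    qed
  qed (use e(1) r(1) A(1) in \<open>auto intro: order_trans\<close>)
  have w2: "\<bar>w r2 - w (B (m1 + 0))\<bar> \<le> 9 / 20 * e"
  proof (rule telescoping_limit[OF cont, where x = "\<lambda>n. B (m1 + n)"])
    show "(\<lambda>n. B (m1 + n)) \<longlonglongrightarrow> r2"
    proof (rule tendsto_sandwich[OF _ _ _ tendsto_const])
      show "(\<lambda>n. r2 - 1 / 2 ^ (m1 + n)) \<longlonglongrightarrow> r2" using tendsto_diff[OF tendsto_const inv, of r2] by simp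
    qed (use B in auto)
    show "\<bar>w (B (m1 + Suc n)) - w (B (m1 + n))\<bar> \<le> e / 20 * (9/10) ^ Suc n" for n
    proof (cases "b (Suc (m1 + n)) = 2 * b (m1 + n)")
      case True
      then show ?thesis using e(1) unfolding B_def by simp
    next
      case False
      then have s: "b (Suc (m1 + n)) = 2 * b (m1 + n) + 1" using b_Suc by blast
      have Beq: "of_int (2 * b (m1 + n)) / 2 ^ Suc (m1 + n) = B (m1 + n)"
        unfolding B_def by simp
      have "\<bar>w (of_int (2 * b (m1 + n) + 1) / 2 ^ Suc (m1 + n)) - w (of_int (2 * b (m1 + n)) / 2 ^ Suc (m1 + n))\<bar>
          \<le> e / 20 * (9/10) ^ (Suc (m1 + n) - m0)"
      proof (rule small)
        show "of_int (2 * b (m1 + n) + 1) / 2 ^ Suc (m1 + n) \<le> r2" using B(1) unfolding B_def s[symmetric] .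
        show "r1 \<le> of_int (2 * b (m1 + n)) / 2 ^ Suc (m1 + n)"
          unfolding Beq using Bm[of n] AB A(1)[of m1] by linarith
      qed (use m1(1) in simp)
      then show ?thesis unfolding Beq using pow[of n] unfolding s[symmetric] B_def by simp
    qed
    show "B (m1 + n) \<in> {0..}" for n using Bm[of n] AB A(1)[of m1] r(1) by simp
  qed (use e(1) r in auto)
  \<comment> \<open>Both chains start at the common point, so the increment is at most 9/10 of
    \<open>e\<close>, against the assumption.\<close>
  have "\<bar>w r2 - w r1\<bar> \<le> 9 / 20 * e + 9 / 20 * e" using w1 w2 unfolding AB add_0_right by linarith
  with e show False by linarith
qed

text \<open>Long blocks are counted by their total length. Each short block owns a dyadic increment
  of size at least \<open>\<theta> m\<close>, and for each level the number of these is at most the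
  sum of fourth powers divided by \<open>\<theta> m ^ 4\<close>.\<close>

lemma block_count:
  fixes w :: "real \<Rightarrow> real" and t :: "nat \<Rightarrow> real"
  assumes cont: "continuous_on {0..} w" and t: "strict_mono t" "0 \<le> t 0" "t n \<le> T" and "0 < e"
    and inc: "\<And>k. k < n \<Longrightarrow> \<exists>r\<in>{t k..<t (Suc k)}. e \<le> \<bar>w (t (Suc k)) - w r\<bar>"
    and m0: "1 / 2 ^ m0 \<le> e\<^sup>2"
    and Q: "\<And>m. m0 \<le> m \<Longrightarrow>
      2 ^ m * (\<Sum>i<nat \<lceil>T * 2 ^ m\<rceil>. (w (real (Suc i) / 2 ^ m) - w (real i / 2 ^ m)) ^ 4) \<le> q"
  shows "real n \<le> T * 2 ^ m0 + 800000 * q / e\<^sup>2"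
proof -
  define L where "L = {k. k < n \<and> 1 / 2 ^ m0 \<le> t (Suc k) - t k}"
  define S where "S = {k. k < n \<and> \<not> 1 / 2 ^ m0 \<le> t (Suc k) - t k}"
  have fin: "finite L" "finite S" unfolding L_def S_def by auto
  have tn: "t k \<le> T" if "k \<le> n" for k
    using strict_mono_less_eq[OF t(1), of k n] that t(3) by simp
  have t0: "0 \<le> t k" for k using strict_mono_less_eq[OF t(1), of 0 k] t(2) by simp
  have "q \<ge> 0"
    by (rule order_trans[OF _ Q[OF order_refl]]) (intro mult_nonneg_nonneg sum_nonneg, auto)
  have "real (card L) * (1 / 2 ^ m0) = (\<Sum>k\<in>L. 1 / 2 ^ m0)" by simp
  also have "\<dots> \<le> (\<Sum>k\<in>L. t (Suc k) - t k)" unfolding L_def by (intro sum_mono) auto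
  also have "\<dots> \<le> (\<Sum>k<n. t (Suc k) - t k)"
    using strict_mono_less_eq[OF t(1)] unfolding L_def by (intro sum_mono2) auto
  also have "\<dots> = t n - t 0" by (rule sum_lessThan_telescope)
  also have "\<dots> \<le> T" using t by simp
  finally have L: "real (card L) \<le> T * 2 ^ m0" by (simp add: field_simps)
  define \<theta> where "\<theta> m = e / 20 * (9/10) ^ (m - m0)" for m
  have \<theta>_pos: "0 < \<theta> m" for m unfolding \<theta>_def using \<open>0 < e\<close> by simp
  have "\<exists>m i. m0 \<le> m \<and> t k \<le> real i / 2 ^ m \<and> real (Suc i) / 2 ^ m \<le> t (Suc k) \<and>
      \<theta> m \<le> \<bar>w (real (Suc i) / 2 ^ m) - w (real i / 2 ^ m)\<bar>" if "k \<in> S" for k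
  proof -
    have k: "k < n" "t (Suc k) - t k < 1 / 2 ^ m0" using that unfolding S_def by auto
    obtain r where r: "r \<in> {t k..<t (Suc k)}" "e \<le> \<bar>w (t (Suc k)) - w r\<bar>" using inc[OF k(1)] by blast
    have "\<exists>m i. m0 \<le> m \<and> r \<le> real i / 2 ^ m \<and> real (Suc i) / 2 ^ m \<le> t (Suc k) \<and>
      e / 20 * (9/10) ^ (m - m0) \<le> \<bar>w (real (Suc i) / 2 ^ m) - w (real i / 2 ^ m)\<bar>"
      using r k t0[of k] \<open>0 < e\<close> by (intro ex_dyadic_increment[OF cont]) auto
    then obtain m i where "m0 \<le> m" "r \<le> real i / 2 ^ m" "real (Suc i) / 2 ^ m \<le> t (Suc k)"
      "e / 20 * (9/10) ^ (m - m0) \<le> \<bar>w (real (Suc i) / 2 ^ m) - w (real i / 2 ^ m)\<bar>" by blast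
    moreover have "t k \<le> r" using r(1) by simp
    ultimately show ?thesis unfolding \<theta>_def by (meson order_trans)
  qed
  then obtain m i where mi: "\<And>k. k \<in> S \<Longrightarrow> m0 \<le> m k \<and> t k \<le> real (i k) / 2 ^ m k \<and>
      real (Suc (i k)) / 2 ^ m k \<le> t (Suc k) \<and>
      \<theta> (m k) \<le> \<bar>w (real (Suc (i k)) / 2 ^ m k) - w (real (i k) / 2 ^ m k)\<bar>"
    by metis
  define f where "f k = (m k, i k)" for k
  have inj: "inj_on f S"
  proof (rule inj_onI)
    \<comment> \<open>Different blocks have disjoint interiors, so no dyadic interval can lie in two
      of them.\<close>
    have aux: "\<not> k < l" if kl: "k \<in> S" "l \<in> S" "f k = f l" for k l
    proof
      assume "k < l"
      then have "t (Suc k) \<le> t l" using strict_mono_less_eq[OF t(1)] by simp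
      moreover have "real (Suc (i k)) / 2 ^ m k \<le> t (Suc k)" "t l \<le> real (i k) / 2 ^ m k"
        using mi[OF kl(1)] mi[OF kl(2)] kl(3) unfolding f_def by auto
      ultimately have "real (Suc (i k)) / 2 ^ m k \<le> real (i k) / 2 ^ m k" by linarith
      then show False by (simp add: divide_le_cancel)
    qed
    show "k = l" if "k \<in> S" "l \<in> S" "f k = f l" for k l
      using aux[OF that] aux[OF that(2,1)] that(3) by simp
  qed
  define mx where "mx = Max (insert m0 (m ` S))"
  define I where "I m = {..<nat \<lceil>T * 2 ^ m\<rceil>}" for m
  define D where "D = (\<lambda>(m, i). (w (real (Suc i) / 2 ^ m) - w (real i / 2 ^ m)) ^ 4 / \<theta> m ^ 4)"
  have sub: "f ` S \<subseteq> Sigma {m0..mx} I"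
  proof
    fix p assume "p \<in> f ` S"
    then obtain k where k: "k \<in> S" "p = (m k, i k)" unfolding f_def by auto
    have "m k \<le> mx" unfolding mx_def using fin k(1) by simp
    moreover have "real (Suc (i k)) / 2 ^ m k \<le> T"
      using mi[OF k(1)] tn[of "Suc k"] k(1) unfolding S_def by auto
    then have "real (Suc (i k)) \<le> T * 2 ^ m k" by (simp add: divide_le_eq)
    then have "i k < nat \<lceil>T * 2 ^ m k\<rceil>" by linarith
    ultimately show "p \<in> Sigma {m0..mx} I" using mi[OF k(1)] k(2) unfolding I_def by auto
  qed
  have "real (card S) = (\<Sum>p\<in>f ` S. 1)" using card_image[OF inj] by simp
  also have "\<dots> \<le> (\<Sum>p\<in>f ` S. D p)"
  proof (rule sum_mono)
    fix p assume "p \<in> f ` S"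
    then obtain k where k: "k \<in> S" "p = (m k, i k)" unfolding f_def by auto
    have "\<theta> (m k) ^ 4 \<le> \<bar>w (real (Suc (i k)) / 2 ^ m k) - w (real (i k) / 2 ^ m k)\<bar> ^ 4"
      using mi[OF k(1)] \<theta>_pos[of "m k"] by (intro power_mono) auto
    then show "1 \<le> D p" using \<theta>_pos[of "m k"] unfolding D_def k(2)
      by (simp add: power_even_abs)
  qed
  also have "\<dots> \<le> (\<Sum>p\<in>Sigma {m0..mx} I. D p)"
    using sub by (intro sum_mono2 finite_SigmaI) (auto simp: I_def D_def)
  also have "\<dots> = (\<Sum>m\<in>{m0..mx}. \<Sum>i\<in>I m. D (m, i))"
    by (subst sum.Sigma) (auto simp: I_def)
  \<comment> \<open>160000 is 20^4 from the thresholds, and 5000/6561 is (1/2) / (9/10)^4: the decay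
    in \<open>Q\<close> against the decay of the thresholds.\<close>
  also have "\<dots> \<le> (\<Sum>m\<in>{m0..mx}. 160000 * q / e\<^sup>2 * (5000 / 6561) ^ (m - m0))"
  proof (rule sum_mono)
    fix m assume "m \<in> {m0..mx}"
    then obtain j where m: "m = m0 + j" by (auto simp: le_iff_add)
    have "(\<Sum>i\<in>I m. D (m, i)) = (\<Sum>i\<in>I m. (w (real (Suc i) / 2 ^ m) - w (real i / 2 ^ m)) ^ 4) / \<theta> m ^ 4"
      unfolding D_def by (simp add: sum_divide_distrib)
    also have "\<dots> \<le> (q / 2 ^ m) / \<theta> m ^ 4"
      using Q[of m] m \<theta>_pos[of m] unfolding I_def
      by (intro divide_right_mono) (auto simp: field_simps)
    also have "\<dots> = (1 / 2 ^ m0) * (160000 * q / e ^ 4 * (5000 / 6561) ^ j)"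
    proof -
      define P where "P = (6561 / 10000 :: real) ^ j"
      have "0 < P" unfolding P_def by simp
      have 1: "\<theta> m ^ 4 = e ^ 4 / 160000 * P"
      proof -
        have "((9/10 :: real) ^ j) ^ 4 = ((9/10) ^ 4) ^ j"
          by (simp only: power_mult[symmetric] mult.commute)
        then show ?thesis unfolding \<theta>_def m P_def power_mult_distrib by (simp add: power_divide)
      qed
      have 2: "(5000 / 6561 :: real) ^ j = (1/2) ^ j / P"
        unfolding P_def by (simp flip: power_divide)
      have 3: "(2 :: real) ^ m = 2 ^ m0 * 2 ^ j" unfolding m by (rule power_add)
      show ?thesis unfolding 1 2 3 using \<open>0 < e\<close> \<open>0 < P\<close> by (simp add: power_one_over field_simps)
    qed
    also have "\<dots> \<le> e\<^sup>2 * (160000 * q / e ^ 4 * (5000 / 6561) ^ j)"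
      using m0 \<open>q \<ge> 0\<close> \<open>0 < e\<close> by (intro mult_right_mono) auto
    also have "\<dots> = 160000 * q / e\<^sup>2 * (5000 / 6561) ^ (m - m0)"
      using \<open>0 < e\<close> unfolding m by (simp add: power4_eq_xxxx power2_eq_square)
    finally show "(\<Sum>i\<in>I m. D (m, i)) \<le> 160000 * q / e\<^sup>2 * (5000 / 6561) ^ (m - m0)" .
  qed
  also have "\<dots> = 160000 * q / e\<^sup>2 * (\<Sum>m\<in>{m0..mx}. (5000 / 6561) ^ (m - m0))"
    by (simp add: sum_distrib_left)
  \<comment> \<open>The geometric series sums to 6561/1561, which is less than 5.\<close>
  also have "\<dots> \<le> 160000 * q / e\<^sup>2 * 5"
  proof (rule mult_left_mono)
    have "(\<Sum>m\<in>{m0..mx}. (5000 / 6561 :: real) ^ (m - m0)) = (\<Sum>j<Suc mx - m0. (5000 / 6561) ^ j)"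
      by (rule sum.reindex_bij_witness[of _ "\<lambda>j. j + m0" "\<lambda>m. m - m0"]) auto
    also have "\<dots> = (1 - (5000 / 6561) ^ (Suc mx - m0)) / (1561 / 6561)"
      by (subst sum_gp_strict) simp
    also have "\<dots> \<le> 1 / (1561 / 6561)" by (intro divide_right_mono) auto
    also have "\<dots> \<le> 5" by simp
    finally show "(\<Sum>m\<in>{m0..mx}. (5000 / 6561 :: real) ^ (m - m0)) \<le> 5" .
  qed (use \<open>q \<ge> 0\<close> in auto)
  finally have S: "real (card S) \<le> 800000 * q / e\<^sup>2" by simp
  have "n = card (L \<union> S)"
  proof -
    have "L \<union> S = {..<n}" unfolding L_def S_def by auto
    then show ?thesis by simp
  qed
  also have "\<dots> \<le> card L + card S" by (rule card_Un_le)
  finally show ?thesis using L S by simp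
qed


section \<open>Almost sure properties of Brownian motion\<close>

lemma (in prob_space) second_moment_sum:
  fixes Y :: "'i \<Rightarrow> 'a \<Rightarrow> real"
  assumes "finite I" "indep_vars (\<lambda>_. borel) Y I"
    and "\<And>i. i \<in> I \<Longrightarrow> integrable M (Y i)" "\<And>i. i \<in> I \<Longrightarrow> expectation (Y i) = 0"
    and "\<And>i. i \<in> I \<Longrightarrow> integrable M (\<lambda>\<omega>. (Y i \<omega>)\<^sup>2)" "\<And>i. i \<in> I \<Longrightarrow> expectation (\<lambda>\<omega>. (Y i \<omega>)\<^sup>2) \<le> v"
  shows "integrable M (\<lambda>\<omega>. (\<Sum>i\<in>I. Y i \<omega>)\<^sup>2) \<and>
    expectation (\<lambda>\<omega>. (\<Sum>i\<in>I. Y i \<omega>)\<^sup>2) \<le> real (card I) * v"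
  using assms
proof (induction I)
  case (insert i I)
  let ?S = "\<lambda>\<omega>. \<Sum>i\<in>I. Y i \<omega>"
  have IH: "integrable M (\<lambda>\<omega>. (?S \<omega>)\<^sup>2)" "expectation (\<lambda>\<omega>. (?S \<omega>)\<^sup>2) \<le> real (card I) * v"
    using insert.IH insert.prems indep_vars_subset[OF insert.prems(1), of I] by auto
  have S: "integrable M ?S" using insert.prems(2) by simp
  have ind: "indep_var borel (Y i) borel ?S"
    using insert.hyps insert.prems(1) by (intro indep_vars_sum)
  have YS: "integrable M (\<lambda>\<omega>. Y i \<omega> * ?S \<omega>)"
    using indep_var_integrable[OF ind _ S] insert.prems(2) by simp
  have "expectation (\<lambda>\<omega>. Y i \<omega> * ?S \<omega>) = expectation (Y i) * expectation ?S"
    using indep_var_lebesgue_integral[OF ind _ S] insert.prems(2) by simp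
  then have 0: "expectation (\<lambda>\<omega>. Y i \<omega> * ?S \<omega>) = 0" using insert.prems(3) by simp
  have eq: "(\<Sum>i\<in>insert i I. Y i \<omega>)\<^sup>2 = (Y i \<omega>)\<^sup>2 + 2 * (Y i \<omega> * ?S \<omega>) + (?S \<omega>)\<^sup>2" for \<omega>
    using insert.hyps by (simp add: power2_sum)
  have "expectation (\<lambda>\<omega>. (\<Sum>i\<in>insert i I. Y i \<omega>)\<^sup>2)
      = expectation (\<lambda>\<omega>. (Y i \<omega>)\<^sup>2) + expectation (\<lambda>\<omega>. (?S \<omega>)\<^sup>2)"
    unfolding eq using insert.prems(4) YS IH(1) 0 by simp
  also have "\<dots> \<le> v + real (card I) * v" using insert.prems(5) IH(2) by (intro add_mono) auto
  also have "\<dots> = real (card (insert i I)) * v" using insert.hyps by (simp add: algebra_simps)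
  finally have "expectation (\<lambda>\<omega>. (\<Sum>i\<in>insert i I. Y i \<omega>)\<^sup>2) \<le> real (card (insert i I)) * v" .
  moreover have "integrable M (\<lambda>\<omega>. (\<Sum>i\<in>insert i I. Y i \<omega>)\<^sup>2)"
    unfolding eq using insert.prems(4) YS IH(1) by simp
  ultimately show ?case by blast
qed simp

lemma (in prob_space) normal_even_moment:
  assumes X: "distributed M lborel X (normal_density 0 \<sigma>)" and "0 < \<sigma>"
  shows "integrable M (\<lambda>\<omega>. X \<omega> ^ (2 * k))"
    and "expectation (\<lambda>\<omega>. X \<omega> ^ (2 * k)) = fact (2 * k) / ((2 / \<sigma>\<^sup>2) ^ k * fact k)"
proof -
  show "integrable M (\<lambda>\<omega>. X \<omega> ^ (2 * k))"
    using distributed_integrable[OF X, of "\<lambda>x. x ^ (2 * k)"] integrable_normal_moment[OF assms(2), of 0 "2 * k"]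
    by simp
  show "expectation (\<lambda>\<omega>. X \<omega> ^ (2 * k)) = fact (2 * k) / ((2 / \<sigma>\<^sup>2) ^ k * fact k)"
    using distributed_integral[OF X, of "\<lambda>x. x ^ (2 * k)"] integral_normal_moment_even[OF assms(2), of 0 k]
    by simp
qed

text \<open>The fourth and eighth moments are 3 and 105 times the powers of \<open>\<sigma>\<close>,
  so the variance factor is 105 - 9 = 96.\<close>

lemma (in prob_space) centered_quartic:
  assumes X: "distributed M lborel X (normal_density 0 \<sigma>)" and "0 < \<sigma>"
  shows "integrable M (\<lambda>\<omega>. X \<omega> ^ 4 - 3 * \<sigma> ^ 4)" "expectation (\<lambda>\<omega>. X \<omega> ^ 4 - 3 * \<sigma> ^ 4) = 0"
    "integrable M (\<lambda>\<omega>. (X \<omega> ^ 4 - 3 * \<sigma> ^ 4)\<^sup>2)"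
    "expectation (\<lambda>\<omega>. (X \<omega> ^ 4 - 3 * \<sigma> ^ 4)\<^sup>2) = 96 * \<sigma> ^ 8"
proof -
  note m4 = normal_even_moment[OF assms, of 2] and m8 = normal_even_moment[OF assms, of 4]
  have i: "integrable M (\<lambda>\<omega>. X \<omega> ^ 4)" "integrable M (\<lambda>\<omega>. X \<omega> ^ 8)" using m4(1) m8(1) by auto
  have e4: "expectation (\<lambda>\<omega>. X \<omega> ^ 4) = 3 * \<sigma> ^ 4"
    using m4(2) assms(2) by (simp add: fact_numeral power_divide field_simps flip: power_mult)
  have e8: "expectation (\<lambda>\<omega>. X \<omega> ^ 8) = 105 * \<sigma> ^ 8"
    using m8(2) assms(2) by (simp add: fact_numeral power_divide field_simps flip: power_mult)
  have eq: "(X \<omega> ^ 4 - 3 * \<sigma> ^ 4)\<^sup>2 = X \<omega> ^ 8 - (6 * \<sigma> ^ 4) * X \<omega> ^ 4 + 9 * \<sigma> ^ 8" for \<omega>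
    by (simp add: power2_diff power_mult_distrib flip: power_mult)
  show "integrable M (\<lambda>\<omega>. X \<omega> ^ 4 - 3 * \<sigma> ^ 4)" using i by simp
  show "expectation (\<lambda>\<omega>. X \<omega> ^ 4 - 3 * \<sigma> ^ 4) = 0" using i e4 by (simp add: prob_space)
  show "integrable M (\<lambda>\<omega>. (X \<omega> ^ 4 - 3 * \<sigma> ^ 4)\<^sup>2)" unfolding eq using i by simp
  show "expectation (\<lambda>\<omega>. (X \<omega> ^ 4 - 3 * \<sigma> ^ 4)\<^sup>2) = 96 * \<sigma> ^ 8"
    unfolding eq using i by (simp add: prob_space e4 e8 flip: power_add)
qed

text \<open>At level \<open>m\<close> the variance of the sum is at most 96 (T + 1) 2^m 16^{-m}. A
  deviation of 2^{-m} therefore has probability at most 96 (T + 1) 2^{-m}, which is summable. The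
  mean is at most 3 (T + 1) 2^{-m} because of the ceiling, and adding the deviation gives 3 T +
  4.\<close>

lemma brownian_quartic_variation:
  assumes bm: "brownian_motion M W" and "0 < T"
  shows "AE \<omega> in M. \<forall>\<^sub>F m in sequentially. 2 ^ m *
    (\<Sum>i<nat \<lceil>T * 2 ^ m\<rceil>. (W (real (Suc i) / 2 ^ m) \<omega> - W (real i / 2 ^ m) \<omega>) ^ 4) \<le> 3 * T + 4"
proof -
  interpret prob_space M using bm unfolding brownian_motion_def by blast
  define N where "N m = nat \<lceil>T * 2 ^ m\<rceil>" for m
  define \<sigma> where "\<sigma> m = sqrt (1 / 2 ^ m)" for m :: nat
  define \<Delta> where "\<Delta> m i \<omega> = W (real (Suc i) / 2 ^ m) \<omega> - W (real i / 2 ^ m) \<omega>" for m i \<omega>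
  define Y where "Y m i \<omega> = \<Delta> m i \<omega> ^ 4 - 3 * \<sigma> m ^ 4" for m i \<omega>
  define A where "A m = {\<omega> \<in> space M. 1 / 2 ^ m \<le> \<bar>\<Sum>i<N m. Y m i \<omega>\<bar>}" for m
  have \<sigma>: "0 < \<sigma> m" "\<sigma> m ^ 4 = (1/4) ^ m" "\<sigma> m ^ 8 = (1/16) ^ m" for m
  proof -
    have s2: "(\<sigma> m)\<^sup>2 = (1/2) ^ m" unfolding \<sigma>_def by (simp add: power_divide)
    show "0 < \<sigma> m" unfolding \<sigma>_def by simp
    have "\<sigma> m ^ 4 = ((\<sigma> m)\<^sup>2)\<^sup>2" "\<sigma> m ^ 8 = ((\<sigma> m)\<^sup>2) ^ 4" by (simp_all flip: power_mult)
    then show "\<sigma> m ^ 4 = (1/4) ^ m" "\<sigma> m ^ 8 = (1/16) ^ m"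
      unfolding s2 by (simp_all add: power_divide flip: power_mult power_mult_distrib)
        (simp_all add: power_mult mult.commute[of m])
  qed
  have N: "real (N m) \<le> (T + 1) * 2 ^ m" for m
  proof -
    have "real (N m) \<le> T * 2 ^ m + 1" unfolding N_def using \<open>0 < T\<close> by simp
    also have "\<dots> \<le> T * 2 ^ m + 2 ^ m" by simp
    finally show ?thesis by (simp add: algebra_simps)
  qed
  have dist: "distributed M lborel (\<Delta> m i) (normal_density 0 (\<sigma> m))" for m i
  proof -
    have "distributed M lborel (\<lambda>\<omega>. W (real (Suc i) / 2 ^ m) \<omega> - W (real i / 2 ^ m) \<omega>)
        (normal_density 0 (sqrt (real (Suc i) / 2 ^ m - real i / 2 ^ m)))"
      using bm unfolding brownian_motion_def by (simp add: divide_strict_right_mono)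
    moreover have "real (Suc i) / 2 ^ m - real i / 2 ^ m = 1 / 2 ^ m"
      by (simp flip: diff_divide_distrib)
    ultimately show ?thesis unfolding \<Delta>_def \<sigma>_def by simp
  qed
  have indep: "indep_vars (\<lambda>_. borel) (Y m) {..<N m}" for m
  proof -
    have "mono (\<lambda>i. real i / 2 ^ m)" by (intro monoI divide_right_mono) auto
    moreover have "indep_vars (\<lambda>_. borel) (\<lambda>i \<omega>. W (r (Suc i)) \<omega> - W (r i) \<omega>) {..<n}"
      if "0 \<le> r 0" "mono r" for r :: "nat \<Rightarrow> real" and n
      using bm that unfolding brownian_motion_def by blast
    from this[of "\<lambda>i. real i / 2 ^ m" "N m"] calculation
    have "indep_vars (\<lambda>_. borel) (\<Delta> m) {..<N m}" unfolding \<Delta>_def by simp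
    then show ?thesis
      unfolding Y_def by (rule indep_vars_compose2) simp
  qed
  note Y = centered_quartic[OF dist \<sigma>(1), folded Y_def]
  have Ym: "Y m i \<in> borel_measurable M" for m i using Y(1) by (rule borel_measurable_integrable)
  have sq: "integrable M (\<lambda>\<omega>. (\<Sum>i<N m. Y m i \<omega>)\<^sup>2)"
    "expectation (\<lambda>\<omega>. (\<Sum>i<N m. Y m i \<omega>)\<^sup>2) \<le> real (N m) * (96 * \<sigma> m ^ 8)" for m
    using second_moment_sum[OF _ indep, of m "96 * \<sigma> m ^ 8"] Y by auto
  have prob_A: "prob (A m) \<le> 96 * (T + 1) * (1/2) ^ m" for m
  proof -
    have "prob (A m) \<le> expectation (\<lambda>\<omega>. (\<Sum>i<N m. Y m i \<omega>)\<^sup>2) / (1 / 2 ^ m)\<^sup>2"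
      unfolding A_def using sq(1) Ym by (intro second_moment_method) auto
    also have "\<dots> \<le> (((T + 1) * 2 ^ m) * (96 * (1/16) ^ m)) / (1 / 2 ^ m)\<^sup>2"
    proof (rule divide_right_mono)
      have "real (N m) * (96 * \<sigma> m ^ 8) \<le> ((T + 1) * 2 ^ m) * (96 * (1/16) ^ m)"
        unfolding \<sigma>(3) using N by (intro mult_right_mono) auto
      with sq(2) show "expectation (\<lambda>\<omega>. (\<Sum>i<N m. Y m i \<omega>)\<^sup>2) \<le> ((T + 1) * 2 ^ m) * (96 * (1/16) ^ m)"
        by (rule order_trans)
    qed simp
    also have "\<dots> = 96 * (T + 1) * (1/2) ^ m"
    proof -
      have "(16 :: real) ^ m = (2 ^ m) ^ 4" by (simp flip: power_mult) (simp add: power_mult mult.commute[of m])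
      then show ?thesis by (simp add: power_divide power2_eq_square power4_eq_xxxx)
    qed
    finally show ?thesis .
  qed
  have "AE \<omega> in M. \<forall>\<^sub>F m in sequentially. \<omega> \<in> space M - A m"
  proof (rule borel_cantelli_AE1)
    show "A m \<in> sets M" for m unfolding A_def using Ym by measurable
    show "summable (\<lambda>m. prob (A m))"
    proof (rule summable_comparison_test_ev)
      show "summable (\<lambda>m. 96 * (T + 1) * (1/2) ^ m)" by (intro summable_mult summable_geometric) simp
    qed (use prob_A in simp)
  qed (simp add: less_top[symmetric])
  then show ?thesis
  proof eventually_elim
    case (elim \<omega>)
    then show ?case
    proof eventually_elim
      case (elim m)
      then have "(\<Sum>i<N m. Y m i \<omega>) \<le> 1 / 2 ^ m" unfolding A_def by auto
      moreover have "(\<Sum>i<N m. Y m i \<omega>) = (\<Sum>i<N m. \<Delta> m i \<omega> ^ 4) - real (N m) * (3 * (1/4) ^ m)"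
        unfolding Y_def \<sigma>(2) by (simp add: sum_subtractf)
      ultimately have "(\<Sum>i<N m. \<Delta> m i \<omega> ^ 4) \<le> real (N m) * (3 * (1/4) ^ m) + 1 / 2 ^ m" by simp
      also have "\<dots> \<le> ((T + 1) * 2 ^ m) * (3 * (1/4) ^ m) + 1 / 2 ^ m"
        using N by (intro add_right_mono mult_right_mono) auto
      finally have "2 ^ m * (\<Sum>i<N m. \<Delta> m i \<omega> ^ 4)
          \<le> 2 ^ m * (((T + 1) * 2 ^ m) * (3 * (1/4) ^ m) + 1 / 2 ^ m)"
        by (intro mult_left_mono) auto
      also have "\<dots> = 3 * T + 4"
      proof -
        have "(4 :: real) ^ m = 2 ^ m * 2 ^ m" by (simp flip: power_mult_distrib)
        then show ?thesis by (simp add: power_divide field_simps)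
      qed
      finally show ?case unfolding \<Delta>_def N_def .
    qed
  qed
qed

text \<open>The density of \<open>W n - W 0\<close> is at most 1 / sqrt n, so the probability of
  staying in a fixed bounded interval at all positive integer times is 0. This makes all stopping
  times finite.\<close>

lemma brownian_unbounded:
  assumes bm: "brownian_motion M W"
  shows "AE \<omega> in M. \<forall>R::nat. \<exists>n::nat. real R < \<bar>W (real n) \<omega> - W 0 \<omega>\<bar>"
  unfolding AE_all_countable
proof
  fix R :: nat
  interpret prob_space M using bm unfolding brownian_motion_def by blast
  define A where "A n = (\<lambda>\<omega>. W (real n) \<omega> - W 0 \<omega>) -` {- real R..real R} \<inter> space M" for n :: nat
  have Wm: "W (real n) \<in> borel_measurable M" for n :: nat
    using bm unfolding brownian_motion_def by simp
  have A: "A n \<in> sets M" for n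
    unfolding A_def using Wm Wm[of 0] by (intro measurable_sets[of _ M borel]) auto
  \<comment> \<open>The shift to \<open>Suc n\<close> avoids the degenerate increment at time 0,
    which has no density.\<close>
  have prob_A: "prob (A (Suc n)) \<le> 2 * real R * (1 / sqrt (real (Suc n)))" for n
  proof -
    define s where "s = sqrt (real (Suc n))"
    have "0 < s" unfolding s_def by simp
    have "distributed M lborel (\<lambda>\<omega>. W (real (Suc n)) \<omega> - W 0 \<omega>) (normal_density 0 (sqrt (real (Suc n) - 0)))"
      using bm unfolding brownian_motion_def by (meson of_nat_0_less_iff order_refl zero_less_Suc)
    then have D: "distributed M lborel (\<lambda>\<omega>. W (real (Suc n)) \<omega> - W 0 \<omega>) (normal_density 0 s)"
      unfolding s_def by simp
    have dens: "normal_density 0 s x \<le> 1 / s" for x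
    proof -
      have "s = sqrt (s\<^sup>2)" using \<open>0 < s\<close> by simp
      also have "\<dots> \<le> sqrt (2 * pi * s\<^sup>2)"
        using pi_gt3 by (intro real_sqrt_le_mono) (auto simp: mult_le_cancel_right1)
      finally have "1 / sqrt (2 * pi * s\<^sup>2) \<le> 1 / s" using \<open>0 < s\<close> by (intro divide_left_mono) auto
      moreover have "1 / sqrt (2 * pi * s\<^sup>2) * exp (- (x - 0)\<^sup>2 / (2 * s\<^sup>2)) \<le> 1 / sqrt (2 * pi * s\<^sup>2) * 1"
        by (intro mult_left_mono) auto
      ultimately show ?thesis unfolding normal_density_def by simp
    qed
    have "emeasure M (A (Suc n))
        = (\<integral>\<^sup>+x. ennreal (normal_density 0 s x) * indicator {- real R..real R} x \<partial>lborel)"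
      unfolding A_def using D by (intro distributed_emeasure) auto
    also have "\<dots> \<le> (\<integral>\<^sup>+x. ennreal (1 / s) * indicator {- real R..real R} x \<partial>lborel)"
      using dens by (intro nn_integral_mono mult_right_mono ennreal_leI) auto
    also have "\<dots> = ennreal (1 / s) * ennreal (2 * real R)"
      by (simp add: nn_integral_cmult_indicator)
    also have "\<dots> = ennreal (2 * real R * (1 / s))"
      using \<open>0 < s\<close> by (simp add: ennreal_mult[symmetric] mult.commute)
    finally show ?thesis unfolding emeasure_eq_measure s_def by simp
  qed
  define B where "B = (\<Inter>n. A (Suc n))"
  have B: "B \<in> sets M" unfolding B_def using A by auto
  have "(\<lambda>n. 2 * real R * (1 / sqrt (real (Suc n)))) \<longlonglongrightarrow> 2 * real R * 0"
    by (intro tendsto_mult tendsto_const LIMSEQ_Suc[where f = "\<lambda>n. 1 / sqrt (real n)"])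
      (intro real_tendsto_divide_at_top[OF tendsto_const] filterlim_compose[OF sqrt_at_top filterlim_real_sequentially])
  moreover have "prob B \<le> 2 * real R * (1 / sqrt (real (Suc n)))" for n
    using A prob_A[of n] by (intro order_trans[OF finite_measure_mono prob_A]) (auto simp: B_def)
  ultimately have "prob B \<le> 0" by (intro LIMSEQ_le_const) auto
  then have "B \<in> null_sets M" using B by (simp add: null_sets_def emeasure_eq_measure measure_le_0_iff)
  then show "AE \<omega> in M. \<exists>n::nat. real R < \<bar>W (real n) \<omega> - W 0 \<omega>\<bar>"
  proof (rule AE_I')
    show "{\<omega> \<in> space M. \<not> (\<exists>n::nat. real R < \<bar>W (real n) \<omega> - W 0 \<omega>\<bar>)} \<subseteq> B"
    proof (intro subsetI)
      fix \<omega> assume "\<omega> \<in> {\<omega> \<in> space M. \<not> (\<exists>n::nat. real R < \<bar>W (real n) \<omega> - W 0 \<omega>\<bar>)}"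
      then have "\<omega> \<in> space M" and R: "\<bar>W (real n) \<omega> - W 0 \<omega>\<bar> \<le> real R" for n :: nat
        by (auto simp: not_less)
      moreover have "W (real n) \<omega> - W 0 \<omega> \<in> {- real R..real R}" for n :: nat
        using R[of n] unfolding atLeastAtMost_iff by linarith
      ultimately show "\<omega> \<in> B" unfolding B_def A_def by blast
    qed
  qed
qed


section \<open>The convergence rate\<close>

text \<open>The path is bounded on \<open>{0..a}\<close>, so a sufficiently large excursion from
  \<open>w 0\<close> must occur after \<open>a\<close> and is also far from
  \<open>w a\<close>.\<close>

lemma ex_osc_exceeds:
  assumes cont: "continuous_on {0..} w" and unb: "\<And>R::nat. \<exists>n::nat. real R < \<bar>w (real n) - w 0\<bar>"
    and "0 \<le> a"
  shows "\<exists>t>a. e < osc w a t"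
proof -
  have "bounded (w ` {0..a})"
    by (intro compact_imp_bounded compact_continuous_image continuous_on_subset[OF cont]) auto
  then obtain C where C: "\<forall>r\<in>{0..a}. \<bar>w r\<bar> \<le> C" unfolding bounded_iff by auto
  have "0 \<le> C" using C \<open>0 \<le> a\<close> by force
  obtain R :: nat where R: "e + 2 * C \<le> real R" "2 * C \<le> real R"
    using real_arch_simple[of "max (e + 2 * C) (2 * C)"] by auto
  obtain n :: nat where n: "real R < \<bar>w (real n) - w 0\<bar>" using unb by blast
  have w0: "\<bar>w 0\<bar> \<le> C" "\<bar>w a\<bar> \<le> C" using C \<open>0 \<le> a\<close> by auto
  have "a < real n"
  proof (rule ccontr)
    assume "\<not> a < real n"
    then have "\<bar>w (real n)\<bar> \<le> C" using C by auto
    with w0 n R show False by linarith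
  qed
  moreover have "e < \<bar>w (real n) - w a\<bar>" using n R w0 by linarith
  moreover have "\<bar>w (real n) - w a\<bar> \<le> osc w a (real n)"
    using \<open>a < real n\<close> \<open>0 \<le> a\<close> by (intro le_osc continuous_on_subset[OF cont]) auto
  ultimately show ?thesis by (intro exI[of _ "real n"]) auto
qed

text \<open>The least admissible level works: since the level before it fails, 2^m is at most twice
  1 / s.\<close>

lemma ex_dyadic_scale:
  fixes s :: real
  assumes "0 < s" "s < 1 / 2 ^ n"
  obtains m where "n \<le> m" "1 / 2 ^ m \<le> s" "2 ^ m \<le> 2 / s"
proof -
  define m where "m = (LEAST m. 1 / 2 ^ m \<le> s)"
  obtain k where "(1/2) ^ k < s" using real_arch_pow_inv[OF assms(1), of "1/2"] by auto
  then have "1 / 2 ^ k \<le> s" by (simp add: power_divide)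
  then have m: "1 / 2 ^ m \<le> s" unfolding m_def by (rule LeastI)
  have "(1 :: real) / 2 ^ m < 1 / 2 ^ n" using m assms(2) by linarith
  then have "(2 :: real) ^ n < 2 ^ m" by (simp add: divide_less_cancel field_simps)
  then have "n < m" by simp
  then obtain j where j: "m = Suc j" by (cases m) auto
  have "\<not> 1 / 2 ^ j \<le> s" using not_less_Least[of j "\<lambda>m. 1 / 2 ^ m \<le> s"] j unfolding m_def by simp
  then have "2 ^ m \<le> 2 / s" using assms(1) unfolding j by (simp add: field_simps)
  with m \<open>n < m\<close> show ?thesis by (intro that[of m]) auto
qed

text \<open>The identity \<open>h = eta h * d\<^sup>2\<close> balances the penalty error against the
  accumulated consistency error; \<open>h \<le> exp (-1)\<close> makes
  \<open>\<bar>ln h\<bar>\<close> at least 1, hence \<open>eta h \<le> d\<close>.\<close>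

lemma eta_rate:
  assumes "0 < h" "h \<le> exp (-1)"
  defines "d \<equiv> h powr (1/3) * \<bar>ln h\<bar> powr (1/3)"
  shows "0 < d" "0 < eta h" "eta h \<le> d" "h = eta h * d\<^sup>2"
proof -
  define l where "l = \<bar>ln h\<bar>"
  have "ln h \<le> ln (exp (-1))" using assms by (subst ln_le_cancel_iff) auto
  then have l: "1 \<le> l" unfolding l_def by simp
  show "0 < d" "0 < eta h" unfolding d_def eta_def l_def[symmetric] using assms(1) l by simp_all
  have "l powr (-2/3) \<le> l powr (1/3)" using l by (intro powr_mono) auto
  then show "eta h \<le> d" unfolding d_def eta_def l_def[symmetric] by (intro mult_left_mono) auto
  have "eta h * d\<^sup>2 = (h powr (1/3) * (h powr (1/3) * h powr (1/3))) *
      (l powr (-2/3) * (l powr (1/3) * l powr (1/3)))"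
    unfolding d_def eta_def l_def[symmetric] by (simp add: power2_eq_square)
  also have "\<dots> = h powr 1 * l powr 0" by (simp only: powr_add[symmetric]) simp
  also have "\<dots> = h" using assms(1) l by simp
  finally show "h = eta h * d\<^sup>2" by simp
qed

theorem theorem6p3:
  fixes H H1 H2 :: "'a::euclidean_space \<Rightarrow> real"
    and L lam0 C0 :: real
  assumes "0 < L" and "0 < lam0" and "0 < C0"
    and "convex_on UNIV H1" and "convex_on UNIV H2"
    and "\<And>p. 0 \<le> H1 p" and "\<And>p. 0 \<le> H2 p"
    and "\<And>p. H p = H1 p - H2 p"
    and "\<exists>K. K-lipschitz_on UNIV H"
  shows "\<exists>C>0. \<forall>(T::real) (u0 :: 'a \<Rightarrow> real) (S :: 'a scheme)
      (M :: 'w measure) (W :: real \<Rightarrow> 'w \<Rightarrow> real) (u :: 'w \<Rightarrow> 'a \<Rightarrow> real \<Rightarrow> real).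
    0 < T \<and>
    bounded (range u0) \<and> L-lipschitz_on UNIV u0 \<and>
    scheme_maps T S \<and> scheme_invariant T S \<and> scheme_monotone T lam0 S \<and>
    scheme_consistent H T lam0 C0 S \<and>
    brownian_motion M W \<and>
    (\<forall>\<omega>\<in>space M. continuous_on {0..} (\<lambda>t. W t \<omega>) \<longrightarrow>
       pathwise_viscosity_solution H T (\<lambda>t. W t \<omega>) u0 (u \<omega>))
    \<longrightarrow>
    (AE \<omega> in M.
       Limsup (at_right 0) (\<lambda>h. SUP (x, t) \<in> UNIV \<times> {0..T}.
          ereal (\<bar>scheme_solution S (\<lambda>t. W t \<omega>) lam0 T u0 h x t - u \<omega> x t\<bar>
                 / (h powr (1/3) * \<bar>ln h\<bar> powr (1/3))))
       \<le> ereal (C * (1 + T)))"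
proof -
  obtain K where K: "K-lipschitz_on UNIV H" using assms(9) by blast
  \<comment> \<open>The values 1 for \<open>d\<close> and \<open>c\<close> are placeholders: this
    instance only supplies \<open>bounded_A\<close>.\<close>
  interpret comparison H1 H2 1 1 K H 1
    by unfold_locales (use assms K in \<open>auto simp flip: assms(8)\<close>)
  obtain B where B: "0 \<le> B" "\<And>p. norm p \<le> L \<Longrightarrow> H1 p + H2 p \<le> B" using bounded_A by blast
  \<comment> \<open>This is 4 * 3200002: the 4 comes from \<open>e = eta h / 2\<close>, and 3200002
    bounds both coefficients in 2 T + 800000 (3 T + 4).\<close>
  define c1 where "c1 = (12800008 :: real)"
  \<comment> \<open>\<open>c1 + 1\<close> allows for rounding up the number of blocks; the 4
    combines the factor 2 in \<open>M_le2\<close> with the 2 of \<open>2 / d\<close>.\<close>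
  define C where "C = L\<^sup>2 / 2 + 10 * B + 4 * (c1 + 1) * C0 / lam0"
  have "0 < C" unfolding C_def c1_def using assms(1-3) B(1) by (intro add_nonneg_pos) auto
  show ?thesis
  proof (intro exI[of _ C] conjI allI impI; (elim conjE)?)
    fix T :: real and u0 :: "'a \<Rightarrow> real" and S :: "'a scheme" and M :: "'w measure"
      and W :: "real \<Rightarrow> 'w \<Rightarrow> real" and u :: "'w \<Rightarrow> 'a \<Rightarrow> real \<Rightarrow> real"
    assume T: "0 < T" and u0: "bounded (range u0)" "L-lipschitz_on UNIV u0"
      and S: "scheme_maps T S" "scheme_invariant T S" "scheme_monotone T lam0 S"
        "scheme_consistent H T lam0 C0 S"
      and bm: "brownian_motion M W"
      and sol: "\<forall>\<omega>\<in>space M. continuous_on {0..} (\<lambda>t. W t \<omega>) \<longrightarrow>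
       pathwise_viscosity_solution H T (\<lambda>t. W t \<omega>) u0 (u \<omega>)"
    have "AE \<omega> in M. continuous_on {0..} (\<lambda>t. W t \<omega>)"
      using bm unfolding brownian_motion_def by blast
    with brownian_quartic_variation[OF bm T] brownian_unbounded[OF bm] AE_space
    show "AE \<omega> in M.
       Limsup (at_right 0) (\<lambda>h. SUP (x, t) \<in> UNIV \<times> {0..T}.
          ereal (\<bar>scheme_solution S (\<lambda>t. W t \<omega>) lam0 T u0 h x t - u \<omega> x t\<bar>
                 / (h powr (1/3) * \<bar>ln h\<bar> powr (1/3))))
       \<le> ereal (C * (1 + T))"
    proof eventually_elim
      case (elim \<omega>)
      define w where "w = (\<lambda>t. W t \<omega>)"
      have cont: "continuous_on {0..} w" using elim unfolding w_def by blast
      have vis: "pathwise_viscosity_solution H T w u0 (u \<omega>)"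
        using sol elim unfolding w_def by blast
      have unb: "\<exists>n::nat. real R < \<bar>w (real n) - w 0\<bar>" for R :: nat
        using elim(2) unfolding w_def by blast
      obtain n0 where n0: "\<And>m. n0 \<le> m \<Longrightarrow> 2 ^ m *
          (\<Sum>i<nat \<lceil>T * 2 ^ m\<rceil>. (w (real (Suc i) / 2 ^ m) - w (real i / 2 ^ m)) ^ 4) \<le> 3 * T + 4"
        using elim(1) unfolding w_def eventually_sequentially by blast
      have "((\<lambda>h::real. h powr (1/3) * \<bar>ln h\<bar> powr (1/3)) \<longlongrightarrow> 0) (at_right 0)"
        by real_asymp
      \<comment> \<open>Below 1 so that squares decrease, below 1 / 2^n0 to reach the levels where
        the quartic sums are controlled, and below 1 / (lam0 + 1) so that
        \<open>lam0 * h \<le> eta h\<close>.\<close>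
      then have "\<forall>\<^sub>F h::real in at_right 0. h powr (1/3) * \<bar>ln h\<bar> powr (1/3)
          < min (min 1 (1 / 2 ^ n0)) (1 / (lam0 + 1))"
        using assms(2) by (intro order_tendstoD(2)) auto
      moreover have "\<forall>\<^sub>F h::real in at_right 0. 0 < h \<and> h \<le> exp (-1)"
        by (rule eventually_at_rightI[of _ "exp (-1)"]) auto
      ultimately have "\<forall>\<^sub>F h in at_right 0. (SUP (x, t) \<in> UNIV \<times> {0..T}.
          ereal (\<bar>scheme_solution S w lam0 T u0 h x t - u \<omega> x t\<bar>
                 / (h powr (1/3) * \<bar>ln h\<bar> powr (1/3)))) \<le> ereal (C * (1 + T))"
      proof eventually_elim
        case (elim h)
        define d where "d = h powr (1/3) * \<bar>ln h\<bar> powr (1/3)"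
        define e where "e = eta h / 2"
        have h: "0 < h" and "h \<le> exp (-1)" using elim by auto
        note rate = eta_rate[OF this, folded d_def]
        have small: "d < 1" "d < 1 / 2 ^ n0" "d < 1 / (lam0 + 1)" using elim unfolding d_def by (simp_all only: min_less_iff_conj)
        interpret blocks w h
          using cont rate(2) ex_osc_exceeds[OF cont unb] by unfold_locales
        have e: "0 < e" "e \<le> 1" unfolding e_def using rate small by auto
        have "e\<^sup>2 < 1 / 2 ^ n0"
        proof -
          have "e\<^sup>2 \<le> e" using e by (simp add: power2_eq_square mult_left_le)
          then show ?thesis using rate(2,3) small(2) unfolding e_def by linarith
        qed
        then obtain m0 where m0: "n0 \<le> m0" "1 / 2 ^ m0 \<le> e\<^sup>2" "2 ^ m0 \<le> 2 / e\<^sup>2"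
          using ex_dyadic_scale[of "e\<^sup>2" n0] e(1) by auto
        have count: "real n \<le> c1 * (1 + T) / (eta h)\<^sup>2" if "stop n \<le> T" for n
        proof -
          have "real n \<le> T * 2 ^ m0 + 800000 * (3 * T + 4) / e\<^sup>2"
            using n0 m0(1) stop_increment
            by (intro block_count[OF cont strict_mono_stop _ that e(1) _ m0(2)]) (auto simp: e_def)
          also have "\<dots> \<le> T * (2 / e\<^sup>2) + 800000 * (3 * T + 4) / e\<^sup>2"
            using m0(3) T by (intro add_right_mono mult_left_mono) auto
          also have "\<dots> = (2400002 * T + 3200000) / e\<^sup>2" by (simp add: add_divide_distrib algebra_simps)
          also have "\<dots> \<le> (3200002 * (1 + T)) / e\<^sup>2"
            using T by (intro divide_right_mono) auto
          also have "\<dots> = c1 * (1 + T) / (eta h)\<^sup>2"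
            unfolding e_def c1_def by (simp add: power_divide)
          finally show ?thesis .
        qed
        \<comment> \<open>One more than the bound in \<open>count\<close> allows, so the
          \<open>k\<close>-th stopping time lies beyond \<open>T\<close>.\<close>
        define k where "k = Suc (nat \<lfloor>c1 * (1 + T) / (eta h)\<^sup>2\<rfloor>)"
        have q0: "0 \<le> c1 * (1 + T) / (eta h)\<^sup>2" unfolding c1_def using T by simp
        have "c1 * (1 + T) / (eta h)\<^sup>2 < real k" unfolding k_def using q0 by linarith
        then have k: "T \<le> stop k" using count[of k] by linarith
        have "real k \<le> c1 * (1 + T) / (eta h)\<^sup>2 + 1" unfolding k_def using q0 by linarith
        also have "\<dots> \<le> c1 * (1 + T) / (eta h)\<^sup>2 + (1 + T) / (eta h)\<^sup>2"
        proof -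
          have "(eta h)\<^sup>2 \<le> 1" using rate small by (simp add: power_le_one)
          then have "1 \<le> (1 + T) / (eta h)\<^sup>2" using rate(2) T by (simp add: le_divide_eq)
          then show ?thesis by simp
        qed
        also have "\<dots> = (c1 + 1) * (1 + T) / (eta h)\<^sup>2" by (simp add: add_divide_distrib distrib_right)
        finally have k_le: "real k \<le> (c1 + 1) * (1 + T) / (eta h)\<^sup>2" .
        \<comment> \<open>The ceiling adds at most 1, and \<open>lam0 * h \<le> eta h\<close>
          absorbs it into the main term.\<close>
        have M_le2: "real (Mh lam0 h) \<le> 2 * eta h / (lam0 * h)"
        proof -
          have "d\<^sup>2 \<le> d" using rate(1) small(1) by (simp add: power2_eq_square mult_left_le)
          then have "lam0 * d\<^sup>2 \<le> lam0 * (1 / (lam0 + 1))"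
            using small(3) assms(2) by (intro mult_left_mono) auto
          also have "\<dots> \<le> 1" using assms(2) by simp
          finally have "eta h * (lam0 * d\<^sup>2) \<le> eta h * 1" using rate(2) by (intro mult_left_mono) auto
          then have "lam0 * h \<le> eta h" by (subst rate(4)) (simp add: mult_ac)
          then have "1 \<le> eta h / (lam0 * h)" using h assms(2) by simp
          from add_left_mono[OF this, of "eta h / (lam0 * h)"]
          have "eta h / (lam0 * h) + 1 \<le> 2 * eta h / (lam0 * h)" by (simp add: mult.commute)
          with M_le[OF assms(2) h] show ?thesis by (rule order_trans)
        qed
        have main: "d / 2 * L\<^sup>2 + 10 * eta h * B + real (k * Mh lam0 h) * (C0 * (2 / d) * h\<^sup>2)
            \<le> C * (1 + T) * d"
        proof -
          have "real (k * Mh lam0 h) * (C0 * (2 / d) * h\<^sup>2)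
              \<le> ((c1 + 1) * (1 + T) / (eta h)\<^sup>2 * (2 * eta h / (lam0 * h))) * (C0 * (2 / d) * h\<^sup>2)"
            unfolding of_nat_mult
            using k_le M_le2 rate(1) assms(3) h T
            by (intro mult_right_mono mult_mono) (auto simp: c1_def)
          also have "\<dots> = 4 * (c1 + 1) * C0 / lam0 * (1 + T) * (h / (eta h * d))"
            using h rate(1,2) assms(2) by (simp add: power2_eq_square field_simps)
          also have "h / (eta h * d) = d"
          proof -
            have "h / (eta h * d) = eta h * d\<^sup>2 / (eta h * d)" using rate(4) by simp
            then show ?thesis using rate(1,2) by (simp add: power2_eq_square)
          qed
          finally have 1: "real (k * Mh lam0 h) * (C0 * (2 / d) * h\<^sup>2)
              \<le> 4 * (c1 + 1) * C0 / lam0 * (1 + T) * d" .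
          have 2: "d / 2 * L\<^sup>2 + 10 * eta h * B \<le> (L\<^sup>2 / 2 + 10 * B) * d"
            using mult_left_mono[OF rate(3) B(1)] by (simp add: algebra_simps)
          also have "\<dots> \<le> (L\<^sup>2 / 2 + 10 * B) * (1 + T) * d"
          proof (rule mult_right_mono)
            have "0 \<le> (L\<^sup>2 / 2 + 10 * B) * T" using B(1) T by simp
            then show "L\<^sup>2 / 2 + 10 * B \<le> (L\<^sup>2 / 2 + 10 * B) * (1 + T)"
              by (simp only: distrib_left mult_1_right le_add_same_cancel1)
          qed (use rate(1) in simp)
          finally show ?thesis using 1 unfolding C_def by (simp add: algebra_simps)
        qed
        show ?case unfolding d_def[symmetric]
        proof (intro SUP_least, clarify)
          fix x :: 'a and t :: real assume t: "t \<in> {0..T}"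
          have "\<bar>scheme_solution S w lam0 T u0 h x t - u \<omega> x t\<bar>
              \<le> d / 2 * L\<^sup>2 + 10 * eta h * B + real (k * Mh lam0 h) * (C0 * (2 / d) * h\<^sup>2)"
            by (rule scheme_solution_error[OF assms(4-8) K S(2-4,1) h assms(3) rate(1) assms(2) T vis u0 B(2) k t])
          then have "\<bar>scheme_solution S w lam0 T u0 h x t - u \<omega> x t\<bar> / d \<le> C * (1 + T)"
            using main rate(1) by (simp add: divide_le_eq)
          then show "ereal (\<bar>scheme_solution S w lam0 T u0 h x t - u \<omega> x t\<bar> / d) \<le> ereal (C * (1 + T))"
            by simp
        qed
      qed
      then show ?case unfolding w_def by (rule Limsup_bounded)
    qed
  qed (fact \<open>0 < C\<close>)
qed

end
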